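(* Let $F$ be a finite field of characteristic two and let $G$ be a non-abelian group of order $2^4$. Then \[ |V_*(FG)|=n\cdot |F|^{\frac{1}{2}(|G|+|G_T|)-1}, \] where - $n=1$ if $G$ is isomorphic to one of $D_8 \mathbin{\mathsf Y} C_4$, $D_{16}$, $D_8\times C_2$; - $n=2$ if $G$ is isomorphic to one of $M_{16}$, $D^-_{16}$, $H_{16}$; - $n=4$ if $G$ is isomorphic to one of $Q_{16}$, $C_4\ltimes C_4$, $Q_8\times C_2$.
   Context: For a finite $2$-group $G$ and a finite field $F$ of characteristic two, $FG$ is the group algebra, and $*$ is the classical involution of $FG$, i.e. the $F$-linear extension of $g\mapsto g^{-1}$ ($g\in G$). $V(FG)$ is the group of normalized units of $FG$ (units whose coefficients sum to $1$). $V_*(FG)=\{u\in V(FG) : u^*=u^{-1}\}$. $G_T=\{g\in G : g^2=1\}$ (so $1\in G_T$). Commutators are $(x,y)=x^{-1}y^{-1}xy$. $C_k$ is the cyclic group of order $k$, $D_{k}$ the dihedral group of order $k$, $Q_{k}$ the (generalized) quaternion group of order $k$. The other groups are: $D_8 \mathbin{\mathsf Y} C_4=\langle a,b,c \mid a^4=b^2=c^4=1,\ (a,b)=a^2=c^2,\ (a,c)=(b,c)=1\rangle$ (central product); $M_{16}=\langle a,b\mid a^8=b^2=1,\ (a,b)=a^4\rangle$; $D^-_{16}=\langle a,b\mid a^8=b^2=1,\ (a,b)=a^2\rangle$ (semidihedral group of order $16$); $H_{16}=\langle a,b,c\mid a^4=b^2=c^2=1,\ (a,b)=c,\ (a,c)=(b,c)=1\rangle$;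 $C_4\ltimes C_4=\langle a,b\mid a^4=b^4=1,\ (a,b)=a^2\rangle$. *)

theory Defs
  imports "HOL-Algebra.Algebra"
begin

section \<open>Groups given by generators and relations\<close>

text \<open>
  A word is a list of letters; \<open>(x, True)\<close> stands for the generator \<open>x\<close> and \<open>(x, False)\<close>
  for its formal inverse. A relation \<open>l = r\<close> is a pair of words.
\<close>

type_synonym 'x word = "('x \<times> bool) list"

definition words :: "'x set \<Rightarrow> 'x word set" where
  "words S = lists (S \<times> UNIV)"

definition gen :: "'x \<Rightarrow> 'x word" where
  "gen x = [(x, True)]"

definition winv :: "'x word \<Rightarrow> 'x word" where
  "winv w = rev (map (\<lambda>(x, s). (x, \<not> s)) w)"

definition wpow :: "'x word \<Rightarrow> nat \<Rightarrow> 'x word" where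
  "wpow w n = concat (replicate n w)"

definition wcomm :: "'x word \<Rightarrow> 'x word \<Rightarrow> 'x word" where
  "wcomm u v = winv u @ winv v @ u @ v"

inductive word_eq :: "'x set \<Rightarrow> ('x word \<times> 'x word) set \<Rightarrow> 'x word \<Rightarrow> 'x word \<Rightarrow> bool"
  for S R where
  refl: "w \<in> words S \<Longrightarrow> word_eq S R w w"
| sym: "word_eq S R u v \<Longrightarrow> word_eq S R v u"
| trans: "word_eq S R u v \<Longrightarrow> word_eq S R v w \<Longrightarrow> word_eq S R u w"
| append: "word_eq S R u u' \<Longrightarrow> word_eq S R v v' \<Longrightarrow> word_eq S R (u @ v) (u' @ v')"
| cancel: "x \<in> S \<Longrightarrow> word_eq S R [(x, s), (x, \<not> s)] []"
| rel: "(l, r) \<in> R \<Longrightarrow> l \<in> words S \<Longrightarrow> r \<in> words S \<Longrightarrow> word_eq S R l r"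

text \<open>The group \<open>\<langle>S | R\<rangle>\<close>, with the congruence classes of words as elements.\<close>

definition presented_group :: "'x set \<Rightarrow> ('x word \<times> 'x word) set \<Rightarrow> 'x word set monoid" where
  "presented_group S R =
    \<lparr>carrier = words S // {(u, v). word_eq S R u v},
     monoid.mult = (\<lambda>P Q. {w. \<exists>u\<in>P. \<exists>v\<in>Q. word_eq S R (u @ v) w}),
     one = {w. word_eq S R [] w}\<rparr>"

lemma word_eq_words: "word_eq S R u v \<Longrightarrow> u \<in> words S \<and> v \<in> words S"
  by (induction rule: word_eq.induct) (auto simp: words_def)

lemma words_append: "u \<in> words S \<Longrightarrow> v \<in> words S \<Longrightarrow> u @ v \<in> words S"
  by (auto simp: words_def)

lemma words_winv: "u \<in> words S \<Longrightarrow> winv u \<in> words S"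
  by (auto simp: words_def winv_def)

lemma word_eq_winv: "w \<in> words S \<Longrightarrow> word_eq S R (winv w @ w) []"
proof (induction w)
  case Nil
  then show ?case by (auto simp: winv_def words_def intro: word_eq.refl)
next
  case (Cons p w)
  obtain x s where p: "p = (x, s)" by (cases p)
  have x: "x \<in> S" and w: "w \<in> words S"
    using Cons.prems by (auto simp: words_def p)
  have 1: "word_eq S R [(x, \<not> s), (x, s)] []"
    using word_eq.cancel[OF x, of R "\<not> s"] by simp
  have "word_eq S R (winv w @ [(x, \<not> s), (x, s)] @ w) (winv w @ [] @ w)"
    using w by (intro word_eq.append 1 word_eq.refl words_winv)
  then show ?case
    using Cons.IH[OF w] word_eq.trans by (fastforce simp: winv_def p)
qed

abbreviation word_class :: "'x set \<Rightarrow> ('x word \<times> 'x word) set \<Rightarrow> 'x word \<Rightarrow> 'x word set" where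
  "word_class S R u \<equiv> {w. word_eq S R u w}"

lemma word_class_eq_iff:
  "u \<in> words S \<Longrightarrow> word_class S R u = word_class S R v \<longleftrightarrow> word_eq S R u v"
  by (auto intro: word_eq.intros)

lemma carrier_presented_group:
  "carrier (presented_group S R) = word_class S R ` words S"
  by (auto simp: presented_group_def quotient_def)

lemma one_presented_group: "\<one>\<^bsub>presented_group S R\<^esub> = word_class S R []"
  by (simp add: presented_group_def)

lemma mult_presented_group:
  assumes "u \<in> words S" "v \<in> words S"
  shows "word_class S R u \<otimes>\<^bsub>presented_group S R\<^esub> word_class S R v = word_class S R (u @ v)"
  using assms
  by (auto simp: presented_group_def intro: word_eq.refl word_eq.append word_eq.trans)

lemma group_presented_group: "group (presented_group S R)"
proof (rule groupI)
  have Nil: "[] \<in> words S" by (simp add: words_def)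
  then show "\<one>\<^bsub>presented_group S R\<^esub> \<in> carrier (presented_group S R)"
    by (auto simp: one_presented_group carrier_presented_group)
  fix P assume "P \<in> carrier (presented_group S R)"
  then obtain u where u: "u \<in> words S" "P = word_class S R u"
    by (auto simp: carrier_presented_group)
  show "\<one>\<^bsub>presented_group S R\<^esub> \<otimes>\<^bsub>presented_group S R\<^esub> P = P"
    using u Nil by (simp add: one_presented_group mult_presented_group)
  have "word_class S R (winv u) \<otimes>\<^bsub>presented_group S R\<^esub> P = \<one>\<^bsub>presented_group S R\<^esub>"
    using u word_eq_winv[OF u(1)]
    by (simp add: one_presented_group mult_presented_group words_winv
        word_class_eq_iff words_append)
  then show "\<exists>Q\<in>carrier (presented_group S R). Q \<otimes>\<^bsub>presented_group S R\<^esub> P = \<one>\<^bsub>presented_group S R\<^esub>"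
    using u(1) by (auto simp: carrier_presented_group intro: words_winv)
qed (auto simp: carrier_presented_group mult_presented_group words_append)


section \<open>Specific groups\<close>

text \<open>
  The parameter \<open>k\<close> of \<open>dihedral_group\<close> and \<open>quaternion_group\<close> is the order of the group;
  it should be even, respectively a multiple of \<open>4\<close>. The relation \<open>b\<^sup>-\<^sup>1ab = a\<^sup>-\<^sup>1\<close> is
  \<open>(a, b) = a\<^sup>-\<^sup>2\<close> in terms of commutators.
\<close>

definition dihedral_group :: "nat \<Rightarrow> nat word set monoid" where
  "dihedral_group k = presented_group {0, 1}
    (let a = gen 0; b = gen 1 in
      {(wpow a (k div 2), []), (wpow b 2, []), (winv b @ a @ b, winv a)})"

definition quaternion_group :: "nat \<Rightarrow> nat word set monoid" where
  "quaternion_group k = presented_group {0, 1}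
    (let a = gen 0; b = gen 1 in
      {(wpow a (k div 2), []), (wpow b 2, wpow a (k div 4)), (winv b @ a @ b, winv a)})"

definition D8_Y_C4 :: "nat word set monoid" where
  "D8_Y_C4 = presented_group {0, 1, 2}
    (let a = gen 0; b = gen 1; c = gen 2 in
      {(wpow a 4, []), (wpow b 2, []), (wpow c 4, []),
       (wcomm a b, wpow a 2), (wpow a 2, wpow c 2),
       (wcomm a c, []), (wcomm b c, [])})"

definition M16 :: "nat word set monoid" where
  "M16 = presented_group {0, 1}
    (let a = gen 0; b = gen 1 in
      {(wpow a 8, []), (wpow b 2, []), (wcomm a b, wpow a 4)})"

definition D16_minus :: "nat word set monoid" where
  "D16_minus = presented_group {0, 1}
    (let a = gen 0; b = gen 1 in
      {(wpow a 8, []), (wpow b 2, []), (wcomm a b, wpow a 2)})"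

definition H16 :: "nat word set monoid" where
  "H16 = presented_group {0, 1, 2}
    (let a = gen 0; b = gen 1; c = gen 2 in
      {(wpow a 4, []), (wpow b 2, []), (wpow c 2, []),
       (wcomm a b, c), (wcomm a c, []), (wcomm b c, [])})"

definition C4_ltimes_C4 :: "nat word set monoid" where
  "C4_ltimes_C4 = presented_group {0, 1}
    (let a = gen 0; b = gen 1 in
      {(wpow a 4, []), (wpow b 4, []), (wcomm a b, wpow a 2)})"


section \<open>The group algebra of a finite group and its unitary units\<close>

text \<open>
  An element \<open>\<Sum>g\<in>G. x\<^sub>g g\<close> is represented by its coefficient function \<open>g \<mapsto> x\<^sub>g\<close>, extended by
  \<open>0\<close> outside the carrier. The group is meant to be finite: no finite support condition is imposed.
\<close>

definition group_algebra :: "('g, 'm) monoid_scheme \<Rightarrow> ('g \<Rightarrow> 'f::field) ring" where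
  "group_algebra G =
    \<lparr>carrier = {x. \<forall>g. g \<notin> carrier G \<longrightarrow> x g = 0},
     monoid.mult = (\<lambda>x y g. if g \<in> carrier G
        then \<Sum>h\<in>carrier G. x h * y (inv\<^bsub>G\<^esub> h \<otimes>\<^bsub>G\<^esub> g) else 0),
     one = (\<lambda>g. if g = \<one>\<^bsub>G\<^esub> then 1 else 0),
     ring.zero = (\<lambda>g. 0),
     ring.add = (\<lambda>x y g. x g + y g)\<rparr>"

definition group_elem :: "'g \<Rightarrow> 'g \<Rightarrow> 'f::field" where
  "group_elem h = (\<lambda>g. if g = h then 1 else 0)"

text \<open>The coefficient of \<open>(\<Sum>h\<in>G. x\<^sub>h h)\<^sup>* = \<Sum>h\<in>G. x\<^sub>h h\<^sup>-\<^sup>1\<close> at \<open>g\<close> is the \<open>x\<^sub>h\<close> with \<open>h = g\<^sup>-\<^sup>1\<close>.\<close>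

definition star :: "('g, 'm) monoid_scheme \<Rightarrow> ('g \<Rightarrow> 'f::field) \<Rightarrow> 'g \<Rightarrow> 'f" where
  "star G x = (\<lambda>g. if g \<in> carrier G then x (inv\<^bsub>G\<^esub> g) else 0)"

definition normalized_units :: "('g, 'm) monoid_scheme \<Rightarrow> ('g \<Rightarrow> 'f::field) set" where
  "normalized_units G = {u \<in> Units (group_algebra G). (\<Sum>g\<in>carrier G. u g) = 1}"

definition unitary_units :: "('g, 'm) monoid_scheme \<Rightarrow> ('g \<Rightarrow> 'f::field) set" where
  "unitary_units G = {u \<in> normalized_units G. star G u = inv\<^bsub>group_algebra G\<^esub> u}"

definition two_torsion :: "('g, 'm) monoid_scheme \<Rightarrow> 'g set" where
  "two_torsion G = {g \<in> carrier G. g [^]\<^bsub>G\<^esub> (2::nat) = \<one>\<^bsub>G\<^esub>}"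

context group
begin

lemma star_group_elem:
  assumes "h \<in> carrier G"
  shows "star G (group_elem h) = (group_elem (inv h) :: 'a \<Rightarrow> 'f::field)"
  using assms by (auto simp: star_def group_elem_def fun_eq_iff)

lemma star_linear:
  "star G (\<lambda>g. c * x g + d * y g) = (\<lambda>g. c * star G x g + d * star G y g)"
  by (auto simp: star_def)

lemma mult_group_elem:
  assumes "finite (carrier G)" "h \<in> carrier G" "k \<in> carrier G"
  shows "group_elem h \<otimes>\<^bsub>group_algebra G\<^esub> group_elem k = (group_elem (h \<otimes> k) :: 'a \<Rightarrow> 'f::field)"
proof
  fix g
  have *: "g \<in> carrier G \<Longrightarrow> inv h \<otimes> g = k \<longleftrightarrow> g = h \<otimes> k"
    using assms by (metis inv_closed inv_inv inv_solve_left m_closed)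
  have "(\<Sum>l\<in>carrier G. group_elem h l * group_elem k (inv l \<otimes> g)) =
      (\<Sum>l\<in>{h}. group_elem h l * (group_elem k (inv l \<otimes> g) :: 'f))"
    by (rule sum.mono_neutral_right) (use assms in \<open>auto simp: group_elem_def\<close>)
  then show "(group_elem h \<otimes>\<^bsub>group_algebra G\<^esub> group_elem k) g = (group_elem (h \<otimes> k) g :: 'f)"
    using assms * by (auto simp: group_algebra_def group_elem_def)
qed

lemma ring_group_algebra:
  assumes fin: "finite (carrier G)"
  shows "ring (group_algebra G :: ('a \<Rightarrow> 'f::field) ring)"
proof (rule ringI)
  show "abelian_group (group_algebra G :: ('a \<Rightarrow> 'f) ring)"
  proof (rule abelian_groupI)
    fix x :: "'a \<Rightarrow> 'f" assume "x \<in> carrier (group_algebra G)"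
    then show "\<exists>y\<in>carrier (group_algebra G). y \<oplus>\<^bsub>group_algebra G\<^esub> x = \<zero>\<^bsub>group_algebra G\<^esub>"
      by (intro bexI[of _ "\<lambda>g. - x g"]) (auto simp: group_algebra_def)
  qed (auto simp: group_algebra_def algebra_simps)
next
  show "Group.monoid (group_algebra G :: ('a \<Rightarrow> 'f) ring)"
  proof (rule monoidI)
    fix x y z :: "'a \<Rightarrow> 'f"
    assume "x \<in> carrier (group_algebra G)" "y \<in> carrier (group_algebra G)"
      "z \<in> carrier (group_algebra G)"
    have "(\<Sum>h\<in>carrier G. (\<Sum>k\<in>carrier G. x k * y (inv k \<otimes> h)) * z (inv h \<otimes> g)) =
        (\<Sum>k\<in>carrier G. x k * (\<Sum>h\<in>carrier G. y h * z (inv h \<otimes> (inv k \<otimes> g))))"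
      if g: "g \<in> carrier G" for g
    proof -
      have *: "(\<Sum>h\<in>carrier G. y (inv k \<otimes> h) * z (inv h \<otimes> g)) =
          (\<Sum>h\<in>carrier G. y h * z (inv h \<otimes> (inv k \<otimes> g)))" if k: "k \<in> carrier G" for k
      proof (rule sum.reindex_bij_witness[where i = "\<lambda>h. k \<otimes> h" and j = "\<lambda>h. inv k \<otimes> h"])
        fix h assume h: "h \<in> carrier G"
        have "inv (inv k \<otimes> h) \<otimes> (inv k \<otimes> g) = inv h \<otimes> (k \<otimes> (inv k \<otimes> g))"
          using h k g by (simp add: inv_mult_group m_assoc)
        also have "k \<otimes> (inv k \<otimes> g) = g"
          using k g by (simp add: m_assoc[symmetric])
        finally show "y (inv k \<otimes> h) * z (inv (inv k \<otimes> h) \<otimes> (inv k \<otimes> g)) =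
            y (inv k \<otimes> h) * z (inv h \<otimes> g)" by simp
      qed (use k g in \<open>auto simp: m_assoc[symmetric]\<close>)
      have "(\<Sum>h\<in>carrier G. (\<Sum>k\<in>carrier G. x k * y (inv k \<otimes> h)) * z (inv h \<otimes> g)) =
          (\<Sum>k\<in>carrier G. \<Sum>h\<in>carrier G. x k * (y (inv k \<otimes> h) * z (inv h \<otimes> g)))"
        unfolding sum_distrib_right by (subst sum.swap) (simp add: mult.assoc)
      then show ?thesis
        by (simp add: sum_distrib_left[symmetric] *)
    qed
    then show "x \<otimes>\<^bsub>group_algebra G\<^esub> y \<otimes>\<^bsub>group_algebra G\<^esub> z =
        x \<otimes>\<^bsub>group_algebra G\<^esub> (y \<otimes>\<^bsub>group_algebra G\<^esub> z)"
      by (auto simp: group_algebra_def fun_eq_iff)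
  next
    fix x :: "'a \<Rightarrow> 'f" assume x: "x \<in> carrier (group_algebra G)"
    show "\<one>\<^bsub>group_algebra G\<^esub> \<otimes>\<^bsub>group_algebra G\<^esub> x = x"
    proof
      fix g
      have "(\<Sum>h\<in>carrier G. (if h = \<one> then 1 else 0) * x (inv h \<otimes> g)) =
          (\<Sum>h\<in>{\<one>}. (if h = \<one> then 1 else 0) * x (inv h \<otimes> g))"
        by (rule sum.mono_neutral_right) (use fin in auto)
      then show "(\<one>\<^bsub>group_algebra G\<^esub> \<otimes>\<^bsub>group_algebra G\<^esub> x) g = x g"
        using x by (auto simp: group_algebra_def)
    qed
    show "x \<otimes>\<^bsub>group_algebra G\<^esub> \<one>\<^bsub>group_algebra G\<^esub> = x"
    proof
      fix g
      have "(\<Sum>h\<in>carrier G. x h * (if inv h \<otimes> g = \<one> then 1 else 0)) =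
          (\<Sum>h\<in>{g}. x h * (if inv h \<otimes> g = \<one> then 1 else 0))" if g: "g \<in> carrier G"
      proof (rule sum.mono_neutral_right)
        have "inv h \<otimes> g \<noteq> \<one>" if "h \<in> carrier G" "h \<noteq> g" for h
          using g that by (metis inv_closed inv_equality inv_inv)
        then show "\<forall>h\<in>carrier G - {g}. x h * (if inv h \<otimes> g = \<one> then 1 else 0) = 0"
          by auto
      qed (use fin g in auto)
      then show "(x \<otimes>\<^bsub>group_algebra G\<^esub> \<one>\<^bsub>group_algebra G\<^esub>) g = x g"
        using x by (auto simp: group_algebra_def)
    qed
  qed (auto simp: group_algebra_def)
qed (auto simp: group_algebra_def algebra_simps sum.distrib)

end

end

theory Submission
  imports Defs "HOL-Library.Cardinality"
begin

text \<open>
  An element \<open>u\<close> of augmentation 1 is a unitary unit iff \<open>\<Sum>\<^sub>h u\<^sub>h u\<^sub>g\<^sub>h = 0\<close> for all \<open>g \<noteq> 1\<close>. For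
  involutions \<open>g\<close> this is automatic in characteristic two. Choose a central involution \<open>z\<close> and an
  element \<open>c\<close> that is a central involution modulo \<open>z\<close> such that \<open>G/\<langle>z, c\<rangle>\<close> is the Klein
  four-group. Lifting solutions from \<open>G/\<langle>z, c\<rangle>\<close> to \<open>G/\<langle>z\<rangle>\<close> and then to \<open>G\<close>, the remaining
  equations become, up to squares, linear in the new unknowns, and they are solved by
  multiplication with an element of augmentation 1 of the group algebra of the Klein four-group,
  which is its own inverse.

  For the classification, a non-abelian group of order 16 has an abelian subgroup of order 8 (the
  centralizer of an element with two conjugates), and then also one that contains an element of
  order at least 4. This leaves finitely many polycyclic presentations, each of which is brought
  to one of nine forms by a change of generators.
\<close>

section \<open>Polycyclic coordinates\<close>

text \<open>The factor \<open>n\<close> originates in the image P of a unit in the group algebra of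
  the Klein four-group. Every element there is an involution, so the coefficients of P P* away from
  1 vanish by themselves. Comparing the equations of the four elements of one coset of \<langle>z,
  c\<rangle> may leave half of such a coefficient as a condition on P: \<open>e1\<close>,
  \<open>e2\<close> or \<open>e3\<close>. Write q for \<open>CARD('f)\<close>. Among the P of
  augmentation 1, \<open>e1\<close> = 0 has q^2 solutions (n = 1), \<open>e1\<close> =
  \<open>e2\<close> = 0 gives two disjoint lines (n = 2), and all three together leave the four
  group elements (n = 4). In the central product of D8 and C4, \<open>e1\<close> merely prescribes a
  component of the next layer, so P stays free (n = 1). The higher layers have the same number of
  solutions over every admissible P and contribute only powers of q.

  For the presentations, collection in polycyclic coordinates bounds the order of the presented
  group by 16. A homomorphism from it onto a group of order 16 therefore has no room for a
  kernel.\<close>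

text \<open>
  The parameters \<open>(m, k, p, q, r, s, t, u)\<close> with \<open>mk = 8\<close> stand for the relations
  \<open>x\<^sup>m = y\<^sup>k = 1\<close>, \<open>yx = xy\<close>, \<open>bx = x\<^sup>py\<^sup>qb\<close>, \<open>by = x\<^sup>ry\<^sup>sb\<close>, \<open>b\<^sup>2 = x\<^sup>ty\<^sup>u\<close>. The element
  \<open>x\<^sup>iy\<^sup>jb\<^sup>l\<close> is encoded by the number \<open>i + mj + 8l\<close>.
\<close>

type_synonym pc_param = "nat \<times> nat \<times> nat \<times> nat \<times> nat \<times> nat \<times> nat \<times> nat"

text \<open>Collection to normal form: b moves to the right past powers of x and y by its action on
  them, and a double b becomes \<open>x^t y^u\<close>. The formula makes sense for all parameters;
  associativity holds only for consistent ones.\<close>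

fun tmul :: "pc_param \<Rightarrow> nat \<Rightarrow> nat \<Rightarrow> nat" where
  "tmul (m, k, p, q, r, s, t, u) a c =
    (let i = a mod m; j = a div m mod k; i' = c mod m; j' = c div m mod k
     in if a < 8 then (i + i') mod m + m * ((j + j') mod k) + (if c < 8 then 0 else 8)
        else if c < 8 then (i + p * i' + r * j') mod m + m * ((j + q * i' + s * j') mod k) + 8
        else (i + p * i' + r * j' + t) mod m + m * ((j + q * i' + s * j' + u) mod k))"

fun pc_rels ::
  "('g, 'm) monoid_scheme \<Rightarrow> pc_param \<Rightarrow> 'g \<Rightarrow> 'g \<Rightarrow> 'g \<Rightarrow> bool"
  where
  "pc_rels G (m, k, p, q, r, s, t, u) x y b \<longleftrightarrow>
    m * k = 8 \<and> {x, y, b} \<subseteq> carrier G \<and>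
    x [^]\<^bsub>G\<^esub> m = \<one>\<^bsub>G\<^esub> \<and> y [^]\<^bsub>G\<^esub> k = \<one>\<^bsub>G\<^esub> \<and> y \<otimes>\<^bsub>G\<^esub> x = x \<otimes>\<^bsub>G\<^esub> y \<and>
    b \<otimes>\<^bsub>G\<^esub> x = x [^]\<^bsub>G\<^esub> p \<otimes>\<^bsub>G\<^esub> y [^]\<^bsub>G\<^esub> q \<otimes>\<^bsub>G\<^esub> b \<and>
    b \<otimes>\<^bsub>G\<^esub> y = x [^]\<^bsub>G\<^esub> r \<otimes>\<^bsub>G\<^esub> y [^]\<^bsub>G\<^esub> s \<otimes>\<^bsub>G\<^esub> b \<and>
    b \<otimes>\<^bsub>G\<^esub> b = x [^]\<^bsub>G\<^esub> t \<otimes>\<^bsub>G\<^esub> y [^]\<^bsub>G\<^esub> u"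

declare tmul.simps [simp del] pc_rels.simps [simp del]

definition pc_elem ::
  "('g, 'm) monoid_scheme \<Rightarrow> pc_param \<Rightarrow> 'g \<Rightarrow> 'g \<Rightarrow> 'g \<Rightarrow> nat \<Rightarrow> 'g" where
  "pc_elem G P x y b n =
    x [^]\<^bsub>G\<^esub> (n mod fst P) \<otimes>\<^bsub>G\<^esub> y [^]\<^bsub>G\<^esub> (n div fst P mod fst (snd P)) \<otimes>\<^bsub>G\<^esub>
    (if n < 8 then \<one>\<^bsub>G\<^esub> else b)"

definition pc_gen where
  "pc_gen G P x y b \<longleftrightarrow> pc_rels G P x y b \<and> carrier G \<subseteq> generate G {x, y, b}"

context group
begin

lemma pow_mod_eq:
  assumes "x \<in> carrier G" "x [^] (m::nat) = \<one>"
  shows "x [^] (n mod m) = x [^] n"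
proof -
  have "x [^] n = x [^] (m * (n div m) + n mod m)" by simp
  also have "\<dots> = x [^] (n mod m)"
    using assms by (simp only: nat_pow_mult[symmetric] nat_pow_pow[symmetric]) simp
  finally show ?thesis ..
qed

context
  fixes x y b m k p q r s t u
  assumes rels: "pc_rels G (m, k, p, q, r, s, t, u) x y b"
begin

lemma pc_closed [simp]: "x \<in> carrier G" "y \<in> carrier G" "b \<in> carrier G"
  using rels unfolding pc_rels.simps by blast+

lemma pc_relsD:
  "m * k = 8" "x [^] m = \<one>" "y [^] k = \<one>" "y \<otimes> x = x \<otimes> y"
  "b \<otimes> x = x [^] p \<otimes> y [^] q \<otimes> b" "b \<otimes> y = x [^] r \<otimes> y [^] s \<otimes> b"
  "b \<otimes> b = x [^] t \<otimes> y [^] u"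
  using rels unfolding pc_rels.simps by blast+

abbreviation (input) N where "N i j \<equiv> x [^] (i::nat) \<otimes> y [^] (j::nat)"

lemma N_mult: "N i j \<otimes> N i' j' = N (i + i') (j + j')"
proof -
  have "y [^] j \<otimes> x [^] i' = x [^] i' \<otimes> y [^] j"
    by (metis group_commutes_pow nat_pow_closed pc_closed(1,2) pc_relsD(4))
  then show ?thesis
    by (simp add: nat_pow_mult[symmetric] m_assoc) (simp add: m_assoc[symmetric])
qed

lemma N_pow: "N i j [^] (n::nat) = N (i * n) (j * n)"
  by (induction n) (simp_all add: N_mult add.commute)

lemma b_N: "b \<otimes> N i j = N (p * i + r * j) (q * i + s * j) \<otimes> b"
proof -
  \<comment> \<open>A relation b g = h b says that conjugation by b sends g to h, so it passes to
    powers.\<close>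
  have *: "b \<otimes> g [^] n = h [^] (n::nat) \<otimes> b"
    if "b \<otimes> g = h \<otimes> b" "g \<in> carrier G" "h \<in> carrier G" for g h n
  proof (induction n)
    case (Suc n)
    then show ?case
      using that by (simp add: m_assoc[symmetric]) (simp add: m_assoc that(1))
  qed simp
  have "b \<otimes> x [^] i = N (p * i) (q * i) \<otimes> b"
    using *[of x "N p q" i] pc_relsD(5) by (simp add: N_pow)
  moreover have "b \<otimes> y [^] j = N (r * j) (s * j) \<otimes> b"
    using *[of y "N r s" j] pc_relsD(6) by (simp add: N_pow)
  ultimately have "b \<otimes> N i j = N (p * i) (q * i) \<otimes> N (r * j) (s * j) \<otimes> b"
    by (simp add: m_assoc[symmetric]) (simp add: m_assoc)
  then show ?thesis by (simp add: N_mult)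
qed

lemma pc_elem_closed [simp]: "pc_elem G (m, k, P) x y b n \<in> carrier G"
  by (simp add: pc_elem_def)

text \<open>The exponents may be arbitrary: the mixed-radix digits are reduced modulo
  \<open>m\<close> and \<open>k\<close>, which the power relations allow. Since
  \<open>m * k = 8\<close>, the first two digits stay below 8, and the summand 0 or 8 can be read
  off.\<close>

lemma pc_elem_N:
  assumes "l \<in> {0, 8}"
  shows "pc_elem G (m, k, P) x y b (i mod m + m * (j mod k) + l) =
    N i j \<otimes> (if l = 0 then \<one> else b)"
    "i mod m + m * (j mod k) + l < 16"
proof -
  have mk: "m > 0" "k > 0" "m * k = 8"
    using pc_relsD(1) by (auto intro: Nat.gr0I)
  have lt: "i mod m + m * (j mod k) < 8"
  proof -
    have "i mod m + m * (j mod k) < m * (1 + j mod k)" using mk by simp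
    also have "\<dots> \<le> m * k" using mk by (intro mult_le_mono2) (simp add: Suc_leI)
    finally show ?thesis using mk by simp
  qed
  \<comment> \<open>As a multiple of \<open>m * k\<close>, the summand \<open>l\<close> disappears
    modulo \<open>m\<close> and, after division by \<open>m\<close>, modulo
    \<open>k\<close>.\<close>
  have l: "l = m * (k * (l div 8))"
    using assms mk(3) by (auto simp: mult.assoc[symmetric])
  have 1: "(i mod m + m * (j mod k) + l) mod m = i mod m"
    by (subst l) simp
  have "(i mod m + m * (j mod k) + l) div m = j mod k + k * (l div 8)"
    using mk(1) by (subst l) (simp add: distrib_left[symmetric] add.assoc)
  then have 2: "(i mod m + m * (j mod k) + l) div m mod k = j mod k" by simp
  show "pc_elem G (m, k, P) x y b (i mod m + m * (j mod k) + l) =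
      N i j \<otimes> (if l = 0 then \<one> else b)"
    using lt assms unfolding pc_elem_def fst_conv snd_conv 1 2
    by (auto simp: pow_mod_eq pc_relsD(2,3))
  show "i mod m + m * (j mod k) + l < 16"
    using lt assms by auto
qed

lemma pc_elem_mult:
  assumes "a < 16" "c < 16"
  shows "pc_elem G (m, k, P) x y b a \<otimes> pc_elem G (m, k, P) x y b c =
    pc_elem G (m, k, P) x y b (tmul (m, k, p, q, r, s, t, u) a c)"
proof -
  define i j i' j' where "i = a mod m" "j = a div m mod k" "i' = c mod m" "j' = c div m mod k"
  note defs = this
  have A: "pc_elem G (m, k, P) x y b a = N i j \<otimes> (if a < 8 then \<one> else b)"
    and C: "pc_elem G (m, k, P) x y b c = N i' j' \<otimes> (if c < 8 then \<one> else b)"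
    by (simp_all add: pc_elem_def defs)
  consider "a < 8" | "\<not> a < 8" "c < 8" | "\<not> a < 8" "\<not> c < 8" by blast
  then show ?thesis
  proof cases
    case 1
    define l :: nat where "l = (if c < 8 then 0 else 8)"
    have e: "tmul (m, k, p, q, r, s, t, u) a c = (i + i') mod m + m * ((j + j') mod k) + l"
      using 1 by (simp add: tmul.simps defs l_def Let_def)
    have "pc_elem G (m, k, P) x y b (tmul (m, k, p, q, r, s, t, u) a c) =
        N (i + i') (j + j') \<otimes> (if c < 8 then \<one> else b)"
      unfolding e by (subst pc_elem_N(1)) (auto simp: l_def)
    then show ?thesis
      using 1 by (simp add: A C N_mult m_assoc[symmetric])
  next
    case 2
    let ?i = "i + (p * i' + r * j')" and ?j = "j + (q * i' + s * j')"
    have e: "tmul (m, k, p, q, r, s, t, u) a c = ?i mod m + m * (?j mod k) + 8"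
      using 2 by (simp add: tmul.simps defs Let_def add.assoc)
    have "N i j \<otimes> b \<otimes> N i' j' = N i j \<otimes> (b \<otimes> N i' j')"
      by (simp add: m_assoc)
    also have "\<dots> = N i j \<otimes> N (p * i' + r * j') (q * i' + s * j') \<otimes> b"
      unfolding b_N by (simp add: m_assoc)
    also have "\<dots> = pc_elem G (m, k, P) x y b (tmul (m, k, p, q, r, s, t, u) a c)"
      unfolding e N_mult by (subst pc_elem_N(1)) auto
    finally show ?thesis
      using 2 by (simp add: A C)
  next
    case 3
    let ?i = "i + (p * i' + r * j') + t" and ?j = "j + (q * i' + s * j') + u"
    have e: "tmul (m, k, p, q, r, s, t, u) a c = ?i mod m + m * (?j mod k) + 0"
      using 3 by (simp add: tmul.simps defs Let_def add.assoc)
    have "N i j \<otimes> b \<otimes> (N i' j' \<otimes> b) = N i j \<otimes> (b \<otimes> N i' j') \<otimes> b"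
      by (simp add: m_assoc)
    also have "\<dots> = N i j \<otimes> N (p * i' + r * j') (q * i' + s * j') \<otimes> (b \<otimes> b)"
      unfolding b_N by (simp add: m_assoc)
    also have "\<dots> = pc_elem G (m, k, P) x y b (tmul (m, k, p, q, r, s, t, u) a c)"
      unfolding e pc_relsD(7) N_mult by (subst pc_elem_N(1)) auto
    finally show ?thesis
      using 3 by (simp add: A C)
  qed
qed

lemma tmul_less:
  assumes "a < 16" "c < 16"
  shows "tmul (m, k, p, q, r, s, t, u) a c < 16"
proof -
  have "i mod m + m * (j mod k) + 8 < 16" for i j
    using pc_elem_N(2)[of 8] by simp
  moreover have "i mod m + m * (j mod k) < 16" for i j
    using pc_elem_N(2)[of 0] by simp
  ultimately show ?thesis by (simp add: tmul.simps Let_def)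
qed

lemma pc_elem_0: "pc_elem G (m, k, P) x y b 0 = \<one>"
  by (simp add: pc_elem_def)

text \<open>The upper bound 16 on the order: the normal forms contain 1 and are closed under
  products, and finiteness supplies inverses, because left translation by a normal form permutes
  them.\<close>

lemma generate_subset_pc_elem:
  "generate G {x, y, b} \<subseteq> pc_elem G (m, k, P) x y b ` {..<16}" (is "_ \<subseteq> ?S")
proof -
  have S: "?S \<subseteq> carrier G" by auto
  have mult: "g \<otimes> h \<in> ?S" if gh: "g \<in> ?S" "h \<in> ?S" for g h
  proof -
    obtain i j where ij: "i < 16" "j < 16"
      and g: "g = pc_elem G (m, k, P) x y b i" and h: "h = pc_elem G (m, k, P) x y b j"
      using gh by (elim imageE) simp
    show ?thesis
      unfolding g h pc_elem_mult[OF ij] using tmul_less[OF ij] by blast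
  qed
  have one: "\<one> \<in> ?S"
    using pc_elem_0[of P] by (metis imageI lessThan_iff zero_less_numeral)
  have inv: "inv g \<in> ?S" if g: "g \<in> ?S" for g
  proof -
    have "(\<lambda>h. g \<otimes> h) ` ?S = ?S"
    proof (rule card_subset_eq)
      have "inj_on (\<lambda>h. g \<otimes> h) ?S"
        using S g by (auto simp: inj_on_def)
      then show "card ((\<lambda>h. g \<otimes> h) ` ?S) = card ?S" by (rule card_image)
    qed (use g mult in auto)
    then have "\<one> \<in> (\<lambda>h. g \<otimes> h) ` ?S" using one by simp
    then obtain h where h: "h \<in> ?S" "g \<otimes> h = \<one>" by (metis imageE)
    have "g \<in> carrier G" "h \<in> carrier G" using S g h by blast+
    then have "inv g = h" using h(2) inv_equality inv_comm by blast
    then show ?thesis using h by simp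
  qed
  have xyb: "{x, y, b} \<subseteq> ?S"
  proof -
    have *: "N i j \<otimes> (if l = 0 then \<one> else b) \<in> ?S" if "l \<in> {0, 8}" for i j l :: nat
      unfolding pc_elem_N(1)[OF that, of P i j, symmetric]
      using pc_elem_N(2)[OF that, of i j] by blast
    have "x \<in> ?S" "y \<in> ?S" "b \<in> ?S"
      using *[of 0 1 0] *[of 0 0 1] *[of 8 0 0] by simp_all
    then show ?thesis by simp
  qed
  show ?thesis
  proof
    fix g assume "g \<in> generate G {x, y, b}"
    then show "g \<in> ?S"
      by (induction rule: generate.induct) (use one xyb inv mult in blast)+
  qed
qed

end

text \<open>The relations by themselves permit normal forms to coincide. Sixteen normal forms
  exhausting a group of order 16 must be distinct.\<close>

lemma pc_gen_bij:
  assumes "pc_gen G P x y b" "order G = 16"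
  shows "bij_betw (pc_elem G P x y b) {..<16} (carrier G)"
proof -
  obtain m k p q r s t u where P: "P = (m, k, p, q, r, s, t, u)" by (cases P rule: prod_cases7) (metis surj_pair)
  have rels: "pc_rels G (m, k, p, q, r, s, t, u) x y b"
    and gen: "carrier G \<subseteq> generate G {x, y, b}"
    using assms by (auto simp: pc_gen_def P)
  have "pc_elem G P x y b ` {..<16} = carrier G"
    using generate_subset_pc_elem[OF rels] gen pc_elem_closed[OF rels] by (force simp: P)
  then show ?thesis
    using assms by (auto simp: bij_betw_def order_def intro!: eq_card_imp_inj_on)
qed

end

section \<open>Presented groups\<close>

lemma pc_rels_closed: "pc_rels G P x y b \<Longrightarrow> {x, y, b} \<subseteq> carrier G"
proof -
  obtain m k p q r s t u where P: "P = (m, k, p, q, r, s, t, u)"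
    by (cases P rule: prod_cases7) (metis surj_pair)
  show "pc_rels G P x y b \<Longrightarrow> {x, y, b} \<subseteq> carrier G"
    unfolding P pc_rels.simps by (elim conjE)
qed

definition (in group) word_eval :: "('x \<Rightarrow> 'a) \<Rightarrow> 'x word \<Rightarrow> 'a" where
  "word_eval \<phi> w = foldr (\<lambda>(x, s) g. (if s then \<phi> x else inv \<phi> x) \<otimes> g) w \<one>"

context group
begin

lemma word_eval_simps [simp]:
  "word_eval \<phi> [] = \<one>"
  "word_eval \<phi> ((x, s) # w) = (if s then \<phi> x else inv \<phi> x) \<otimes> word_eval \<phi> w"
  by (simp_all add: word_eval_def)

context
  fixes \<phi> :: "'x \<Rightarrow> 'a" and S
  assumes \<phi>: "\<phi> ` S \<subseteq> carrier G"
begin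

lemma word_eval_closed: "w \<in> words S \<Longrightarrow> word_eval \<phi> w \<in> carrier G"
  using \<phi> by (induction w) (auto simp: words_def)

lemma word_eval_append:
  "u \<in> words S \<Longrightarrow> v \<in> words S \<Longrightarrow> word_eval \<phi> (u @ v) = word_eval \<phi> u \<otimes> word_eval \<phi> v"
proof (induction u)
  case (Cons p u)
  obtain x s where p: "p = (x, s)" by (cases p)
  have "x \<in> S" "u \<in> words S" using Cons.prems by (auto simp: words_def p)
  then show ?case
    using Cons \<phi> word_eval_closed[of u] word_eval_closed[of v]
    by (auto simp: p m_assoc image_subset_iff)
qed (simp add: word_eval_closed)

lemma word_eval_word_eq:
  assumes "word_eq S R u v" "\<And>l r. (l, r) \<in> R \<Longrightarrow> word_eval \<phi> l = word_eval \<phi> r"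
  shows "word_eval \<phi> u = word_eval \<phi> v"
  using assms(1)
proof (induction rule: word_eq.induct)
  case (append u u' v v')
  then show ?case
    using word_eq_words[of S R u u'] word_eq_words[of S R v v'] by (simp add: word_eval_append)
next
  case (cancel x s)
  then have "\<phi> x \<in> carrier G" using \<phi> by blast
  then show ?case by simp
qed (use assms(2) in auto)

end

end

definition word_sat :: "('g, 'm) monoid_scheme \<Rightarrow> ('x \<Rightarrow> 'g) \<Rightarrow> ('x word \<times> 'x word) set \<Rightarrow> bool" where
  "word_sat G \<phi> R \<longleftrightarrow> (\<forall>(l, r) \<in> R. group.word_eval G \<phi> l = group.word_eval G \<phi> r)"

text \<open>Von Dyck's theorem: an assignment of generators that satisfies the relations extends to
  a homomorphism.\<close>

lemma presented_group_hom:
  assumes G: "group G" and \<phi>: "\<phi> ` S \<subseteq> carrier G" and sat: "word_sat G \<phi> R"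
  obtains h where "h \<in> hom (presented_group S R) G" "\<phi> ` S \<subseteq> h ` carrier (presented_group S R)"
proof -
  interpret group G by fact
  \<comment> \<open>Equivalent words have the same value, so any word chosen from the class gives
    the same result.\<close>
  define h where "h = (\<lambda>P. word_eval \<phi> (SOME w. w \<in> P))"
  have h: "h (word_class S R u) = word_eval \<phi> u" if "u \<in> words S" for u
  proof -
    have "word_eq S R u (SOME w. w \<in> word_class S R u)"
      using someI[of "\<lambda>w. w \<in> word_class S R u" u] that by (simp add: word_eq.refl)
    then show ?thesis
      using word_eval_word_eq[OF \<phi>] sat unfolding h_def word_sat_def by fastforce
  qed
  show thesis
  proof
    show "h \<in> hom (presented_group S R) G"
      by (rule homI)
        (auto simp: carrier_presented_group mult_presented_group h words_append
          word_eval_closed[OF \<phi>] word_eval_append[OF \<phi>])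
    show "\<phi> ` S \<subseteq> h ` carrier (presented_group S R)"
    proof
      fix g assume "g \<in> \<phi> ` S"
      then obtain a where a: "a \<in> S" "g = \<phi> a" by blast
      have w: "gen a \<in> words S" using a by (simp add: words_def gen_def)
      have "h (word_class S R (gen a)) = g"
        unfolding h[OF w] using a \<phi> by (auto simp: gen_def)
      then show "g \<in> h ` carrier (presented_group S R)"
        using w unfolding carrier_presented_group by blast
    qed
  qed
qed

text \<open>The classes of the one-letter words are the universal solution of the relations. Every
  word evaluates at them to its own class, which gives both the relations and generation.\<close>

lemma presented_group_gen:
  fixes S R
  defines "Q \<equiv> presented_group S R" and "\<phi> \<equiv> \<lambda>a. word_class S R (gen a)"
  assumes R: "R \<subseteq> words S \<times> words S"
  shows "\<phi> ` S \<subseteq> carrier Q" "word_sat Q \<phi> R" "carrier Q \<subseteq> generate Q (\<phi> ` S)"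
proof -
  interpret group Q unfolding Q_def by (rule group_presented_group)
  have gen: "gen a \<in> words S" if "a \<in> S" for a
    using that by (simp add: words_def gen_def)
  show \<phi>: "\<phi> ` S \<subseteq> carrier Q"
    using gen by (auto simp: Q_def \<phi>_def carrier_presented_group)
  have inv: "inv\<^bsub>Q\<^esub> (\<phi> a) = word_class S R [(a, False)]" if a: "a \<in> S" for a
  proof (rule inv_equality)
    have w: "[(a, False)] \<in> words S" using a by (simp add: words_def)
    show "word_class S R [(a, False)] \<otimes>\<^bsub>Q\<^esub> \<phi> a = \<one>\<^bsub>Q\<^esub>"
      using word_eq.cancel[OF a, of R False] w gen[OF a]
        word_class_eq_iff[OF words_append[OF w gen[OF a]], of R "[]"]
      by (simp add: Q_def \<phi>_def mult_presented_group one_presented_group) (simp add: gen_def)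
    show "word_class S R [(a, False)] \<in> carrier Q"
      using w by (auto simp: Q_def carrier_presented_group)
  qed (use \<phi> a in auto)
  have eval: "word_eval \<phi> w = word_class S R w \<and> word_class S R w \<in> generate Q (\<phi> ` S)"
    if "w \<in> words S" for w
    using that
  proof (induction w)
    case Nil
    then show ?case
      using generate.one[of Q "\<phi> ` S"] word_eval_simps(1)[of \<phi>]
      by (simp only: Q_def one_presented_group simp_thms)
  next
    case (Cons p w)
    obtain a s where p: "p = (a, s)" by (cases p)
    have a: "a \<in> S" and w: "w \<in> words S" using Cons.prems by (auto simp: words_def p)
    have as: "[(a, s)] \<in> words S" using a by (simp add: words_def)
    have 1: "(if s then \<phi> a else inv\<^bsub>Q\<^esub> (\<phi> a)) = word_class S R [(a, s)]"
      using inv[OF a] by (simp add: \<phi>_def gen_def)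
    have 2: "(if s then \<phi> a else inv\<^bsub>Q\<^esub> (\<phi> a)) \<in> generate Q (\<phi> ` S)"
      using a by (auto intro: generate.incl generate.inv)
    have 3: "word_class S R [(a, s)] \<otimes>\<^bsub>Q\<^esub> word_class S R w = word_class S R (p # w)"
      using as w by (simp add: Q_def mult_presented_group p)
    show ?case
      using Cons.IH[OF w] generate.eng[OF 2, of "word_class S R w"] 3 by (simp add: p 1)
  qed
  have "word_eval \<phi> l = word_eval \<phi> r" if lr: "(l, r) \<in> R" for l r
  proof -
    have "word_eq S R l r" "l \<in> words S" "r \<in> words S"
      using R lr by (auto intro: word_eq.rel)
    then show ?thesis by (simp add: eval word_class_eq_iff)
  qed
  then show "word_sat Q \<phi> R" by (auto simp: word_sat_def)
  show "carrier Q \<subseteq> generate Q (\<phi> ` S)"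
    using eval by (auto simp: Q_def carrier_presented_group)
qed

lemma (in group_hom) pc_gen_image:
  assumes "pc_gen G P x y b" "h ` carrier G = carrier H"
  shows "pc_gen H P (h x) (h y) (h b)"
proof -
  obtain m k p q r s t u where P: "P = (m, k, p, q, r, s, t, u)"
    by (cases P rule: prod_cases7) (metis surj_pair)
  have rels: "pc_rels G (m, k, p, q, r, s, t, u) x y b"
    and gen: "carrier G = generate G {x, y, b}"
    using assms(1) G.generate_incl[OF pc_rels_closed, of P x y b] by (auto simp: pc_gen_def P)
  note D = G.pc_relsD[OF rels] and c [simp] = G.pc_closed[OF rels]
  have "pc_rels H P (h x) (h y) (h b)"
    unfolding P pc_rels.simps
    using D(2-7)[THEN arg_cong[where f = h]] D(1)
    by (simp only: hom_mult hom_one G.nat_pow_closed G.m_closed c hom_nat_pow insert_subset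
        empty_subsetI hom_closed simp_thms)
  moreover have "carrier H \<subseteq> generate H {h x, h y, h b}"
    using generate_img[OF pc_rels_closed[OF rels]] gen assms(2)
    by (simp only: image_empty image_insert order_refl)
  ultimately show ?thesis by (simp add: pc_gen_def)
qed

text \<open>The source has at most 16 normal forms and the image has 16 elements, so a surjection is
  injective. The lower bound on the order of a presented group thus comes from the target.\<close>

lemma pc_gen_iso:
  assumes "group G" "group H" "h \<in> hom G H" "h ` carrier G = carrier H"
    and "pc_gen G P x y b" "order H = 16"
  shows "H \<cong> G"
proof -
  interpret group_hom G H h
    using assms by (simp add: group_hom_def group_hom_axioms_def)
  obtain m k p q r s t u where P: "P = (m, k, p, q, r, s, t, u)"
    by (cases P rule: prod_cases7) (metis surj_pair)
  have "carrier G \<subseteq> pc_elem G P x y b ` {..<16}"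
    using G.generate_subset_pc_elem[of m k p q r s t u x y b] assms(5)
    unfolding P pc_gen_def by (meson order_trans)
  then have fin: "finite (carrier G)" and "card (carrier G) \<le> card {..<16::nat}"
    by (rule finite_subset[OF _ finite_imageI[OF finite_lessThan]], rule surj_card_le[OF finite_lessThan])
  moreover have "card (h ` carrier G) \<le> card (carrier G)"
    using fin by (rule card_image_le)
  ultimately have "card (h ` carrier G) = card (carrier G)"
    using assms(4,6) by (simp add: order_def)
  then have "inj_on h (carrier G)" using fin by (rule eq_card_imp_inj_on[rotated])
  then have "h \<in> iso G H"
    using assms(3,4) by (simp add: iso_def bij_betw_def)
  then show ?thesis using G.iso_sym is_isoI by blast
qed

lemma iso_pc_gen:
  assumes "group G" "group Q" "G \<cong> Q" "pc_gen Q P x y b"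
  shows "\<exists>x y b. pc_gen G P x y b"
proof -
  obtain h where h: "h \<in> iso Q G"
    using group.iso_sym[OF assms(1,3)] by (auto simp: is_iso_def)
  interpret group_hom Q G h
    using assms h by (simp add: group_hom_def group_hom_axioms_def iso_def)
  show ?thesis
    using pc_gen_image[OF assms(4)] h by (auto simp: iso_def bij_betw_def)
qed

lemma (in group) generate_subsetI:
  assumes "A \<subseteq> generate G B" "B \<subseteq> carrier G"
  shows "generate G A \<subseteq> generate G B"
  using generate_subgroup_incl[OF assms(1) generate_is_subgroup[OF assms(2)]] .

text \<open>Reduces an isomorphism with a presented group to two translations of generators.
  \<open>fwd\<close>, applied to the universal solution, gives the presented group polycyclic
  generators; \<open>bwd\<close> solves the relations in \<open>G\<close>, whence a surjection onto
  \<open>G\<close> by Von Dyck's theorem.\<close>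

lemma presented_iso_iff:
  fixes G :: "('g, 'm) monoid_scheme" and S :: "'x set" and R
  defines "Q \<equiv> presented_group S R"
  assumes G: "group G" "order G = 16" and R: "R \<subseteq> words S \<times> words S"
    and fwd: "\<And>\<phi>. group Q \<Longrightarrow> \<phi> ` S \<subseteq> carrier Q \<Longrightarrow> word_sat Q \<phi> R \<Longrightarrow>
      \<exists>x y b. pc_rels Q P x y b \<and> \<phi> ` S \<subseteq> generate Q {x, y, b}"
    and bwd: "\<And>x y b. group G \<Longrightarrow> pc_rels G P x y b \<Longrightarrow>
      \<exists>\<phi>. \<phi> ` S \<subseteq> carrier G \<and> word_sat G \<phi> R \<and> {x, y, b} \<subseteq> generate G (\<phi> ` S)"
  shows "G \<cong> Q \<longleftrightarrow> (\<exists>x y b. pc_gen G P x y b)"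
proof -
  interpret G: group G by fact
  interpret Q: group Q unfolding Q_def by (rule group_presented_group)
  note gen = presented_group_gen[OF R, folded Q_def]
  obtain x y b where rels: "pc_rels Q P x y b"
    and sub: "(\<lambda>a. word_class S R (gen a)) ` S \<subseteq> generate Q {x, y, b}"
    using fwd[OF Q.is_group gen(1,2)] by blast
  have "{x, y, b} \<subseteq> carrier Q" using rels by (rule pc_rels_closed)
  then have pc: "pc_gen Q P x y b"
    using rels gen(3) Q.generate_subsetI[OF sub] by (auto simp: pc_gen_def)
  show ?thesis
  proof
    assume "\<exists>x y b. pc_gen G P x y b"
    then obtain x' y' b' where "pc_gen G P x' y' b'" by blast
    then have rels': "pc_rels G P x' y' b'" and gen': "carrier G \<subseteq> generate G {x', y', b'}"
      by (auto simp: pc_gen_def)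
    obtain \<phi> where \<phi>: "\<phi> ` S \<subseteq> carrier G" "word_sat G \<phi> R" "{x', y', b'} \<subseteq> generate G (\<phi> ` S)"
      using bwd[OF G(1) rels'] by blast
    obtain h where h: "h \<in> hom Q G" "\<phi> ` S \<subseteq> h ` carrier Q"
      using presented_group_hom[OF G(1) \<phi>(1,2)] unfolding Q_def by blast
    interpret group_hom Q G h
      using h by (simp add: group_hom_def group_hom_axioms_def G.is_group Q.is_group)
    have "carrier G \<subseteq> generate G (\<phi> ` S)"
      using gen' G.generate_subsetI[OF \<phi>(3,1)] by blast
    also have "\<dots> \<subseteq> h ` carrier Q"
      using G.generate_subgroup_incl[OF h(2) img_is_subgroup] .
    finally have "h ` carrier Q = carrier G" using h(1) by (auto simp: hom_def)
    then show "G \<cong> Q"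
      using pc_gen_iso[OF Q.is_group G(1) h(1) _ pc G(2)] by blast
  qed (use iso_pc_gen[OF G(1) Q.is_group _ pc] in blast)
qed

section \<open>Unitary units as solutions of quadratic equations\<close>

lemma (in group) finite_group_algebra:
  assumes "finite (carrier G)"
  shows "finite (carrier (group_algebra G :: ('a \<Rightarrow> 'f::{field,finite}) ring))"
proof -
  have "inj_on (\<lambda>x. restrict x (carrier G)) (carrier (group_algebra G :: ('a \<Rightarrow> 'f) ring))"
    by (rule inj_onI) (auto simp: group_algebra_def fun_eq_iff restrict_def split: if_splits, metis)
  moreover have "(\<lambda>x. restrict x (carrier G)) ` carrier (group_algebra G :: ('a \<Rightarrow> 'f) ring)
      \<subseteq> carrier G \<rightarrow>\<^sub>E UNIV"
    by auto
  ultimately show ?thesis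
    using finite_PiE[OF assms, of "\<lambda>_. UNIV :: 'f set"] by (meson finite_imageD finite_subset finite)
qed

text \<open>Left multiplication by \<open>v\<close> is injective because \<open>u\<close> undoes it,
  hence onto by finiteness. So \<open>v\<close> has a right inverse, which must be
  \<open>u\<close>.\<close>

lemma (in monoid) finite_right_inv_imp_left_inv:
  assumes "finite (carrier G)" "u \<in> carrier G" "v \<in> carrier G" "u \<otimes> v = \<one>"
  shows "v \<otimes> u = \<one>"
proof -
  have "inj_on (\<lambda>y. v \<otimes> y) (carrier G)"
  proof (rule inj_onI)
    fix y z assume yz: "y \<in> carrier G" "z \<in> carrier G" "v \<otimes> y = v \<otimes> z"
    then have "u \<otimes> v \<otimes> y = u \<otimes> v \<otimes> z"
      using assms(2,3) by (simp only: m_assoc)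
    then show "y = z" using yz(1,2) assms(4) by simp
  qed
  then have "(\<lambda>y. v \<otimes> y) ` carrier G = carrier G"
    using assms by (intro endo_inj_surj) auto
  then obtain y where y: "y \<in> carrier G" "v \<otimes> y = \<one>"
    by (metis one_closed imageE)
  have "u = u \<otimes> (v \<otimes> y)" using y assms by simp
  also have "\<dots> = u \<otimes> v \<otimes> y" using y(1) assms(2,3) by (simp only: m_assoc)
  also have "\<dots> = y" using y(1) assms(4) by simp
  finally show ?thesis using y by simp
qed

text \<open>Unitarity is u u* = 1, one-sided inverses being two-sided in a finite ring. The
  displayed sum is the coefficient of u u* at the inverse of \<open>g\<close>; as \<open>g\<close>
  runs through the group, so does its inverse.\<close>

lemma (in group) unitary_units_eq:
  assumes fin: "finite (carrier G)"
  shows "(unitary_units G :: ('a \<Rightarrow> 'f::{field,finite}) set) =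
    {u. (\<forall>g. g \<notin> carrier G \<longrightarrow> u g = 0) \<and> (\<Sum>g\<in>carrier G. u g) = 1 \<and>
      (\<forall>g\<in>carrier G. (\<Sum>h\<in>carrier G. u h * u (g \<otimes> h)) = (if g = \<one> then 1 else 0))}"
proof -
  define A :: "('a \<Rightarrow> 'f) ring" where "A = group_algebra G"
  interpret A: ring A unfolding A_def by (rule ring_group_algebra[OF fin])
  have star: "star G u \<in> carrier A" for u :: "'a \<Rightarrow> 'f"
    by (simp add: A_def star_def group_algebra_def)
  have 1: "u \<otimes>\<^bsub>A\<^esub> star G u = \<one>\<^bsub>A\<^esub> \<longleftrightarrow>
      (\<forall>g\<in>carrier G. (\<Sum>h\<in>carrier G. u h * u (g \<otimes> h)) = (if g = \<one> then 1 else 0))"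
    for u :: "'a \<Rightarrow> 'f"
  proof -
    define c where "c = (\<lambda>g. \<Sum>h\<in>carrier G. u h * u (inv g \<otimes> h))"
    have *: "(u \<otimes>\<^bsub>A\<^esub> star G u) g = (if g \<in> carrier G then c g else 0)" for g
      by (auto simp: A_def group_algebra_def star_def inv_mult_group c_def intro!: sum.cong)
    have "\<one>\<^bsub>A\<^esub> = (\<lambda>g. if g = \<one> then 1 else 0)"
      by (simp add: A_def group_algebra_def)
    then have "u \<otimes>\<^bsub>A\<^esub> star G u = \<one>\<^bsub>A\<^esub> \<longleftrightarrow>
      (\<forall>g. (if g \<in> carrier G then c g else 0) = (if g = \<one> then 1 else 0))"
      by (simp only: fun_eq_iff *)
    also have "\<dots> \<longleftrightarrow> (\<forall>g\<in>carrier G. c g = (if g = \<one> then 1 else 0))"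
      by auto
    also have "\<dots> \<longleftrightarrow>
      (\<forall>g\<in>carrier G. (\<Sum>h\<in>carrier G. u h * u (g \<otimes> h)) = (if g = \<one> then 1 else 0))"
    proof -
      have "(\<forall>g\<in>carrier G. F g) \<longleftrightarrow> (\<forall>g\<in>carrier G. F (inv g))" for F :: "'a \<Rightarrow> bool"
        by (metis inv_closed inv_inv)
      from this[of "\<lambda>g. c g = (if g = \<one> then 1 else 0)"]
      show ?thesis by (simp add: c_def cong: ball_cong)
    qed
    finally show ?thesis .
  qed
  have 2: "u \<in> Units A \<and> star G u = inv\<^bsub>A\<^esub> u \<longleftrightarrow> u \<otimes>\<^bsub>A\<^esub> star G u = \<one>\<^bsub>A\<^esub>"
    if u: "u \<in> carrier A" for u :: "'a \<Rightarrow> 'f"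
  proof
    assume "u \<in> Units A \<and> star G u = inv\<^bsub>A\<^esub> u"
    then show "u \<otimes>\<^bsub>A\<^esub> star G u = \<one>\<^bsub>A\<^esub>" by simp
  next
    assume *: "u \<otimes>\<^bsub>A\<^esub> star G u = \<one>\<^bsub>A\<^esub>"
    then have **: "star G u \<otimes>\<^bsub>A\<^esub> u = \<one>\<^bsub>A\<^esub>"
      using A.finite_right_inv_imp_left_inv[OF _ u star] finite_group_algebra[OF fin]
      by (simp add: A_def)
    have "u \<in> Units A" using * ** u star by (auto simp: Units_def)
    moreover have "inv\<^bsub>A\<^esub> u = star G u"
      using A.inv_char[OF u star * **] .
    ultimately show "u \<in> Units A \<and> star G u = inv\<^bsub>A\<^esub> u" by simp
  qed
  have "carrier A = {u. \<forall>g. g \<notin> carrier G \<longrightarrow> u g = 0}"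
    by (simp add: A_def group_algebra_def)
  then have "unitary_units G = {u. (\<forall>g. g \<notin> carrier G \<longrightarrow> u g = 0) \<and>
      u \<otimes>\<^bsub>A\<^esub> star G u = \<one>\<^bsub>A\<^esub> \<and> (\<Sum>g\<in>carrier G. u g) = 1}"
    using 2 A.Units_closed unfolding unitary_units_def normalized_units_def A_def[symmetric] by blast
  then show ?thesis unfolding 1 by blast
qed

locale char2 =
  fixes ty :: "'f::{field,finite} itself"
  assumes two [simp]: "(2::'f) = 0"
begin

lemma add_self [simp]: "x + x = (0::'f)"
  using two by (metis mult_2 mult_zero_left)

lemma add_self_left [simp]: "x + (x + y) = (y::'f)"
  by (simp add: add.assoc[symmetric])

lemma uminus_eq [simp]: "- x = (x::'f)"
  by (rule minus_unique) simp

lemma minus_eq [simp]: "x - y = (x + y :: 'f)"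
  using add_uminus_conv_diff[of x y] by simp

lemma add_eq_0 [simp]: "x + y = 0 \<longleftrightarrow> x = (y::'f)"
  using eq_neg_iff_add_eq_0[of x y] by simp

lemma square_add: "(x + y) ^ 2 = x ^ 2 + (y ^ 2 :: 'f)"
  by (simp add: power2_sum)

lemma sum_square: "(\<Sum>i\<in>A. f i ^ 2) = (\<Sum>i\<in>A. f i :: 'f) ^ 2"
  by (induction A rule: infinite_finite_induct) (simp_all add: square_add)

end

text \<open>If \<open>\<pi>\<close> is left translation by g, this is the coefficient of u u* at the
  inverse of g.\<close>

definition quad :: "'f list \<Rightarrow> (nat \<Rightarrow> nat) \<Rightarrow> 'f::field" where
  "quad xs \<pi> = (\<Sum>k<16. xs ! k * xs ! \<pi> k)"

text \<open>Index 0 is the identity. Its equation states that the sum of the squares is 1, which in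
  characteristic two is the square of the augmentation condition.\<close>

definition unitary_sols :: "(nat \<Rightarrow> nat \<Rightarrow> nat) \<Rightarrow> 'f::field list set" where
  "unitary_sols \<mu> = {xs. length xs = 16 \<and> sum_list xs = 1 \<and> (\<forall>g\<in>{1..<16}. quad xs (\<mu> g) = 0)}"

lemma (in char2) card_unitary_units:
  fixes G :: "('g, 'm) monoid_scheme"
  assumes G: "group G" and e: "bij_betw e {..<16} (carrier G)" "e 0 = \<one>\<^bsub>G\<^esub>"
    and mult: "\<And>i j. i < 16 \<Longrightarrow> j < 16 \<Longrightarrow> e i \<otimes>\<^bsub>G\<^esub> e j = e (\<mu> i j) \<and> \<mu> i j < 16"
  shows "card (unitary_units G :: ('g \<Rightarrow> 'f) set) = card (unitary_sols \<mu> :: 'f list set)"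
proof (rule bij_betw_same_card)
  interpret group G by fact
  have fin: "finite (carrier G)" using bij_betw_finite[OF e(1)] by simp
  have inj: "inj_on e {..<16}" and img: "e ` {..<16} = carrier G"
    using e(1) by (auto simp: bij_betw_def)
  define d where "d = inv_into {..<16} e"
  have de: "d (e i) = i" if "i < 16" for i
    using that inj by (simp add: d_def)
  have ed: "e (d g) = g" "d g < 16" if "g \<in> carrier G" for g
    using that img by (auto simp: d_def f_inv_into_f inv_into_into[of _ e "{..<16}", simplified])
  have sum: "(\<Sum>g\<in>carrier G. F g) = (\<Sum>i<16. F (e i))" for F :: "'g \<Rightarrow> 'f"
    using sum.reindex_bij_betw[OF e(1), of F] by simp
  have ec: "e i \<in> carrier G" if "i < 16" for i using that img by auto
  have \<mu>0: "\<mu> 0 i = i" if "i < 16" for i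
  proof -
    have "e (\<mu> 0 i) = e 0 \<otimes>\<^bsub>G\<^esub> e i" "\<mu> 0 i < 16" using mult[of 0 i] that by simp_all
    then show ?thesis using ec[OF that] de[OF that] de[of "\<mu> 0 i"] by (simp only: e(2) l_one)
  qed
  define f where "f = (\<lambda>u :: 'g \<Rightarrow> 'f. map (\<lambda>i. u (e i)) [0..<16])"
  have f_nth: "f u ! i = u (e i)" if "i < 16" for u i
    using that by (simp add: f_def)
  have quad: "quad (f u) (\<mu> i) = (\<Sum>h\<in>carrier G. u h * u (e i \<otimes>\<^bsub>G\<^esub> h))" if "i < 16" for u i
    using that mult by (simp add: quad_def sum f_nth)
  have sl: "sum_list (f u) = (\<Sum>h\<in>carrier G. u h)" for u
    by (simp add: f_def sum sum_list_sum_nth atLeast0LessThan)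
  \<comment> \<open>Squaring is additive in characteristic two, so the coefficient at the identity
    is the square of the augmentation.\<close>
  have q0: "quad (f u) (\<mu> 0) = (\<Sum>h\<in>carrier G. u h) ^ 2" for u
    by (simp add: quad_def \<mu>0 f_nth sum power2_eq_square[symmetric] sum_square)
  have iff: "(\<Sum>g\<in>carrier G. u g) = 1 \<and>
      (\<forall>g\<in>carrier G. (\<Sum>h\<in>carrier G. u h * u (g \<otimes>\<^bsub>G\<^esub> h)) = (if g = \<one>\<^bsub>G\<^esub> then 1 else 0))
      \<longleftrightarrow> f u \<in> unitary_sols \<mu>" (is "?l \<and> ?r \<longleftrightarrow> _") for u :: "'g \<Rightarrow> 'f"
  proof -
    have "?r \<longleftrightarrow> (\<forall>i<16. quad (f u) (\<mu> i) = (if i = 0 then 1 else 0))"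
    proof -
      have "e i = \<one>\<^bsub>G\<^esub> \<longleftrightarrow> i = 0" if "i < 16" for i
        using de[OF that] de[of 0] e(2) by auto
      then show ?thesis unfolding img[symmetric] ball_simps using quad by (simp add: img Ball_def)
    qed
    moreover have "\<dots> \<longleftrightarrow> quad (f u) (\<mu> 0) = 1 \<and> (\<forall>i\<in>{1..<16}. quad (f u) (\<mu> i) = 0)"
      by (auto simp: le_Suc_eq)
    ultimately show ?thesis
      by (auto simp: unitary_sols_def sl q0) (simp_all add: f_def)
  qed
  show "bij_betw f (unitary_units G) (unitary_sols \<mu>)"
  proof (rule bij_betw_byWitness)
    define f' where "f' = (\<lambda>xs :: 'f list. \<lambda>g. if g \<in> carrier G then xs ! d g else 0)"
    have ff': "f (f' xs) = xs" if "length xs = 16" for xs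
    proof (rule nth_equalityI)
      show len: "length (f (f' xs)) = length xs" using that by (simp add: f_def)
      fix i assume "i < length (f (f' xs))"
      then have "i < 16" using len that by simp
      then show "f (f' xs) ! i = xs ! i" by (simp add: f_nth f'_def de ec)
    qed
    show "\<forall>u\<in>unitary_units G. f' (f u) = u"
      by (auto simp: unitary_units_eq[OF fin] f'_def f_nth ed fun_eq_iff)
    show "\<forall>xs\<in>unitary_sols \<mu>. f (f' xs) = xs"
      by (auto simp: unitary_sols_def ff')
    show "f ` unitary_units G \<subseteq> unitary_sols \<mu>"
      using iff by (auto simp: unitary_units_eq[OF fin])
    show "f' ` unitary_sols \<mu> \<subseteq> unitary_units G"
    proof
      fix u assume "u \<in> f' ` unitary_sols \<mu>"
      then obtain xs where xs: "xs \<in> unitary_sols \<mu>" "u = f' xs" by blast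
      then have "f u \<in> unitary_sols \<mu>" using ff'[of xs] by (simp add: unitary_sols_def)
      then show "u \<in> unitary_units G"
        using iff[of u] xs(2) by (auto simp: unitary_units_eq[OF fin] f'_def)
    qed
  qed
qed

section \<open>Counting the solutions\<close>

lemma card_layer:
  fixes A :: "'a::finite \<Rightarrow> bool" and B :: "'a \<Rightarrow> 'b::finite \<Rightarrow> bool"
  assumes "\<And>a. A a \<Longrightarrow> card {b. B a b} = N"
  shows "card {(a, b). A a \<and> B a b} = card {a. A a} * N"
proof -
  have "{(a, b). A a \<and> B a b} = (SIGMA a:{a. A a}. {b. B a b})" by auto
  then show ?thesis using assms by (simp add: card_SigmaI)
qed

lemma card_witness:
  fixes g :: "'p \<Rightarrow> 'x"
  assumes "\<And>p. Q (g p)" "\<And>p. h (g p) = p" "\<And>x. Q x \<Longrightarrow> g (h x) = x"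
  shows "card {x. Q x} = card (UNIV :: 'p set)"
proof -
  have "bij_betw g (UNIV :: 'p set) {x. Q x}"
    by (rule bij_betw_byWitness[where f' = h]) (use assms in auto)
  then show ?thesis using bij_betw_same_card by metis
qed

lemma card_UNIV_Times: "card (UNIV :: ('a::finite \<times> 'b::finite) set) = card (UNIV :: 'a set) * card (UNIV :: 'b set)"
  unfolding UNIV_Times_UNIV[symmetric] by (rule card_cartesian_product)

type_synonym 'f quadruple = "'f \<times> 'f \<times> 'f \<times> 'f"

text \<open>Multiplication and augmentation of the group algebra of the Klein four-group.\<close>

fun conv :: "'f::field quadruple \<Rightarrow> 'f quadruple \<Rightarrow> 'f quadruple" where
  "conv (A, B, C, D) (p, q, r, s) =
    (A * p + B * q + C * r + D * s, A * q + B * p + C * s + D * r,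
     A * r + C * p + B * s + D * q, A * s + D * p + B * r + C * q)"

fun aug :: "'f::field quadruple \<Rightarrow> 'f" where
  "aug (A, B, C, D) = A + B + C + D"

text \<open>
  Linear coordinates on the group algebra of a group of order 16 that is given by a chain
  \<open>1 < \<langle>z\<rangle> < \<langle>z, c\<rangle> < G\<close>. The coefficients of a unit at the eight representatives modulo \<open>z\<close> are
  \<open>Y\<close> and \<open>Y + X\<close>; its image modulo \<open>z\<close> has the coefficients \<open>\<alpha>\<close> and \<open>\<alpha> + P\<close>, where \<open>P\<close> is
  the image modulo \<open>\<langle>z, c\<rangle>\<close>. In these coordinates the equations for \<open>X\<close> and for \<open>\<alpha>\<close> become
  equations for single components of \<open>conv P X\<close> and \<open>conv P \<alpha>\<close>.
\<close>

fun ulist :: "'f::field quadruple \<Rightarrow> 'f quadruple \<Rightarrow> 'f quadruple \<Rightarrow> 'f quadruple \<Rightarrow> 'f list" where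
  "ulist (A, B, C, D) (p, q, r, s) (Y0, Y1, Y2, Y3) (X0, X1, X2, X3) =
    [Y0, Y1, Y0 + X0, Y1 + X1, Y2, Y3, Y2 + X2, Y3 + X3,
     Y0 + p, Y1 + q, Y0 + X0 + (p + A), Y1 + X1 + (q + B),
     Y2 + r, Y3 + s, Y2 + X2 + (r + C), Y3 + X3 + (s + D)]"

text \<open>The multiplication table after renumbering the elements by the permutation \<open>\<sigma>\<close>.\<close>

definition gmul :: "nat list \<Rightarrow> pc_param \<Rightarrow> nat \<Rightarrow> nat \<Rightarrow> nat" where
  "gmul \<sigma> P i j = length (takeWhile (\<lambda>m. m \<noteq> tmul P (\<sigma> ! i) (\<sigma> ! j)) \<sigma>)"

text \<open>The bits of a position mean: 1 for x, 2 for c = \<open>x^2\<close>, 4 for b, and 8 for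
  the element numbered 4, which serves as z: it is \<open>x^4\<close> if x has order 8, and y
  otherwise.\<close>

abbreviation std_perm :: "nat list" where
  "std_perm \<equiv> [0, 1, 2, 3, 8, 9, 10, 11, 4, 5, 6, 7, 12, 13, 14, 15]"

lemma upt_0_16: "[0..<16] = [0, 1, 2, 3, 4, 5, 6, 7, 8, 9, 10, 11, 12, 13, 14, 15]"
  by code_simp

lemma upt_1_16: "[1..<16] = [1, 2, 3, 4, 5, 6, 7, 8, 9, 10, 11, 12, 13, 14, 15]"
  by code_simp

lemma quad_list: "quad xs \<pi> = (\<Sum>k\<leftarrow>[0..<16]. xs ! k * xs ! \<pi> k)"
  by (simp add: quad_def interv_sum_list_conv_sum_set_nat atLeast0LessThan)

context char2
begin

section \<open>Linear coordinates over the group algebra of the Klein four-group\<close>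

lemma aug_conv: "aug (conv P \<alpha>) = aug P * (aug \<alpha> :: 'f)"
  by (cases P; cases \<alpha>) (simp add: algebra_simps)

text \<open>In this commutative algebra of characteristic two the mixed terms of a square cancel and
  every group element squares to 1. The square of \<open>P\<close> is therefore the square of its
  augmentation.\<close>

lemma conv_conv:
  assumes "aug P = (1 :: 'f)"
  shows "conv P (conv P \<alpha>) = \<alpha>"
proof -
  obtain A B C D where P: "P = (A, B, C, D)" by (cases P)
  obtain p q r s where \<alpha>: "\<alpha> = (p, q, r, s)" by (cases \<alpha>)
  let ?N = "(A + B + C + D) * (A + B + C + D)"
  have "conv P (conv P \<alpha>) = (?N * p, ?N * q, ?N * r, ?N * s)"
    by (simp add: P \<alpha> algebra_simps)
  then show ?thesis using assms by (simp add: P \<alpha>)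
qed

lemma ulist_bij:
  "bij_betw (\<lambda>(P, \<alpha>, Z, W). ulist P \<alpha> Z W)
    (UNIV :: ('f quadruple \<times> 'f quadruple \<times> 'f quadruple \<times> 'f quadruple) set) {xs. length xs = 16}"
    (is "bij_betw ?u _ _")
proof -
  \<comment> \<open>The inverse recovers P from sums over the cosets of \<langle>z, c\<rangle>
    (positions i, i + 2, i + 8, i + 10) and \<alpha> from sums over the cosets of
    \<langle>z\<rangle> (positions i, i + 8).\<close>
  define d :: "'f list \<Rightarrow> 'f quadruple \<times> 'f quadruple \<times> 'f quadruple \<times> 'f quadruple" where
    "d xs =
      ((xs!0 + xs!2 + xs!8 + xs!10, xs!1 + xs!3 + xs!9 + xs!11,
        xs!4 + xs!6 + xs!12 + xs!14, xs!5 + xs!7 + xs!13 + xs!15),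
       (xs!0 + xs!8, xs!1 + xs!9, xs!4 + xs!12, xs!5 + xs!13),
       (xs!0, xs!1, xs!4, xs!5), (xs!0 + xs!2, xs!1 + xs!3, xs!4 + xs!6, xs!5 + xs!7))" for xs
  show ?thesis
  proof (rule bij_betw_byWitness[where f' = d])
    show "\<forall>t\<in>UNIV. d (?u t) = t"
      by (auto simp: d_def algebra_simps)
    show "?u ` UNIV \<subseteq> {xs. length xs = 16}" by auto
    show "\<forall>xs\<in>{xs. length xs = 16}. ?u (d xs) = xs"
    proof
      fix xs :: "'f list" assume "xs \<in> {xs. length xs = 16}"
      then have "xs = map (\<lambda>i. xs ! i) [0..<16]" by (metis map_nth mem_Collect_eq)
      then have "xs = map (\<lambda>i. xs ! i) [0, 1, 2, 3, 4, 5, 6, 7, 8, 9, 10, 11, 12, 13, 14, 15]"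
        by (simp only: upt_0_16)
      then show "?u (d xs) = xs"
        by (simp only: d_def prod.case ulist.simps list.map) (simp add: algebra_simps)
    qed
  qed simp
qed

text \<open>For fixed P of augmentation 1 the involution \<open>conv P\<close> replaces \<alpha> and
  W by \<open>conv P \<alpha>\<close> and \<open>conv P W\<close>, in which the conditions concern
  single components. The coefficients Z are unconstrained, whence the factor with exponent 4; the
  number of choices for W must not depend on P and \<alpha>.\<close>

lemma card_unitary_sols:
  assumes iff: "\<And>P \<alpha> Z W. ulist P \<alpha> Z W \<in> unitary_sols \<mu> \<longleftrightarrow>
      aug P = (1::'f) \<and> \<Phi> P (conv P \<alpha>) \<and> \<Psi> P \<alpha> (conv P W)"
    and K: "card {(P, \<beta>). aug P = (1::'f) \<and> \<Phi> P \<beta>} = K"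
    and M: "\<And>P \<alpha>. aug P = (1::'f) \<Longrightarrow> card {x. \<Psi> P \<alpha> x} = M"
  shows "card (unitary_sols \<mu> :: 'f list set) = K * (card (UNIV :: 'f set) ^ 4 * M)"
proof -
  let ?u = "\<lambda>(P, \<alpha>, Z, W). ulist P \<alpha> Z W :: 'f list"
  let ?S = "{((P, \<beta>), (Z :: 'f quadruple, x)). (aug P = (1::'f) \<and> \<Phi> P \<beta>) \<and> \<Psi> P (conv P \<beta>) x}"
  have inj: "inj ?u" and surj: "?u ` UNIV = {xs :: 'f list. length xs = 16}"
    using bij_betw_imp_inj_on[OF ulist_bij] bij_betw_imp_surj_on[OF ulist_bij] by blast+
  have "unitary_sols \<mu> = ?u ` {t. ?u t \<in> unitary_sols \<mu>}"
  proof -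
    have "unitary_sols \<mu> \<subseteq> range ?u"
      unfolding surj by (auto simp: unitary_sols_def)
    then show ?thesis by blast
  qed
  then have "card (unitary_sols \<mu> :: 'f list set) = card {t. ?u t \<in> unitary_sols \<mu>}"
    using card_image[OF inj_on_subset[OF inj subset_UNIV], of "{t. ?u t \<in> unitary_sols \<mu>}"] by simp
  also have "\<dots> = card ?S"
  proof (rule bij_betw_same_card)
    show "bij_betw (\<lambda>(P, \<alpha>, Z, W). ((P, conv P \<alpha>), (Z, conv P W))) {t. ?u t \<in> unitary_sols \<mu>} ?S"
      by (rule bij_betw_byWitness[where f' = "\<lambda>((P, \<beta>), (Z, x)). (P, conv P \<beta>, Z, conv P x)"])
        (auto simp: iff conv_conv simp del: conv.simps aug.simps ulist.simps)
  qed
  also have "\<dots> = card {(P, \<beta>). aug P = (1::'f) \<and> \<Phi> P \<beta>} * (card (UNIV :: 'f set) ^ 4 * M)"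
  proof -
    have *: "card {(Z :: 'f quadruple, x). \<Psi> P (conv P \<beta>) x} = card (UNIV :: 'f set) ^ 4 * M"
      if "aug P = 1" for P \<beta>
      using card_layer[of "\<lambda>_ :: 'f quadruple. True" "\<lambda>_. \<Psi> P (conv P \<beta>)" M] M[OF that]
      by (simp add: card_UNIV_Times power4_eq_xxxx mult.assoc)
    let ?A = "\<lambda>(P, \<beta>). aug P = (1::'f) \<and> \<Phi> P \<beta>"
    let ?B = "\<lambda>(P, \<beta>) (Z :: 'f quadruple, x). \<Psi> P (conv P \<beta>) x"
    have "?S = {(a, b). ?A a \<and> ?B a b}" by auto
    also have "card \<dots> = card {a. ?A a} * (card (UNIV :: 'f set) ^ 4 * M)"
      by (rule card_layer) (use * in auto)
    finally show ?thesis .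
  qed
  finally show ?thesis unfolding K .
qed

lemma unitary_sols_iff:
  "ulist P \<alpha> Z W \<in> unitary_sols \<mu> \<longleftrightarrow>
    aug P = (1::'f) \<and> list_all (\<lambda>x. x = 0) (map (\<lambda>g. quad (ulist P \<alpha> Z W) (\<mu> g)) [1..<16])"
proof -
  have "length (ulist P \<alpha> Z W) = 16 \<and> sum_list (ulist P \<alpha> Z W) = aug P"
    by (cases P; cases \<alpha>; cases Z; cases W) (simp add: algebra_simps)
  then show ?thesis by (auto simp: unitary_sols_def list_all_iff)
qed

lemmas quad_expand = upt_1_16 upt_0_16 list.map quad_list ulist.simps sum_list.Cons sum_list.Nil

section \<open>The coefficient equations of the nine groups in linear coordinates\<close>

text \<open>Positions with bit 4 are reflections and give 0, as does the involution z at position 8.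
  The four odd powers of x give \<open>xx\<close> or \<open>xx + e1\<close>, that is, component 1 of
  \<open>conv P W\<close> plus known terms, together with the condition \<open>e1\<close> on P. The
  recurring expressions enter as variables so that they remain atoms in the counting.\<close>

lemma quads_D16:
  assumes "e1 = A * B + C * D"
    and "f1 = (p + q + r + s) ^ 2 + (A * p + B * q + C * r + D * s)"
    and "xx = (A * X1 + B * X0 + C * X3 + D * X2) + (A * B + B * p + C * D + D * r + p * q + r * s)"
  shows "map (\<lambda>g. quad (ulist (A, B, C, D) (p, q, r, s) (Y0, Y1, Y2, Y3) (X0, X1, X2, X3))
      (gmul std_perm (8, 1, 7, 0, 0, 0, 0, 0) g)) [1..<16] =
    [xx, f1, xx + e1, 0, 0, 0, 0, 0, xx + e1, f1, xx, 0, 0, 0, 0 :: 'f]"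
  unfolding assms
  by (simp only: quad_expand, simp add: gmul_def tmul.simps, simp add: power2_eq_square algebra_simps)

text \<open>The products of b with odd powers of x have order 4; they contribute \<open>bxy\<close>,
  an equation for component 3 of \<open>conv P \<alpha>\<close>, and the condition
  \<open>e2\<close>.\<close>

lemma quads_SD16:
  assumes "e1 = A * B + C * D"
    and "e2 = A * D + B * C"
    and "f1 = (p + q + r + s) ^ 2 + (A * p + B * q + C * r + D * s)"
    and "bxy = (A * s + D * p + B * r + C * q) + (A * D + B * C)"
    and "xx = (A * X1 + B * X0 + C * X3 + D * X2) + (A * B + B * p + C * D + D * r + p * q + r * s)"
  shows "map (\<lambda>g. quad (ulist (A, B, C, D) (p, q, r, s) (Y0, Y1, Y2, Y3) (X0, X1, X2, X3))
      (gmul std_perm (8, 1, 3, 0, 0, 0, 0, 0) g)) [1..<16] =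
    [xx, f1, xx + e1, 0, bxy, 0, bxy + e2, 0, xx + e1, f1, xx, 0, bxy, 0, bxy + e2 :: 'f]"
  unfolding assms
  by (simp only: quad_expand, simp add: gmul_def tmul.simps, simp add: power2_eq_square algebra_simps)

text \<open>Here x and xb both have order 8, so two components of \<open>conv P W\<close> are
  constrained; \<open>by\<close> belongs to \<open>x^2 b\<close> and its inverse, of order
  4.\<close>

lemma quads_M16:
  assumes "e1 = A * B + C * D"
    and "e2 = A * D + B * C"
    and "f1 = (p + q + r + s) ^ 2 + (A * p + B * q + C * r + D * s)"
    and "by = (A * r + C * p + B * s + D * q)"
    and "xx = (A * X1 + B * X0 + C * X3 + D * X2) + (A * B + B * p + C * D + D * r + p * q + r * s)"
    and "xxy = (A * X3 + D * X0 + B * X2 + C * X1) + (A * D + A * s + B * C + C * q + p * s + q * r)"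
  shows "map (\<lambda>g. quad (ulist (A, B, C, D) (p, q, r, s) (Y0, Y1, Y2, Y3) (X0, X1, X2, X3))
      (gmul std_perm (8, 1, 5, 0, 0, 0, 0, 0) g)) [1..<16] =
    [xx, f1, xx + e1, 0, xxy, by, xxy, 0, xx + e1, f1, xx, 0, xxy + e2, by, xxy + e2 :: 'f]"
  unfolding assms
  by (simp only: quad_expand, simp add: gmul_def tmul.simps, simp add: power2_eq_square algebra_simps)

text \<open>All elements outside \<langle>x\<rangle> have order 4, so components 2 and 3 of
  \<open>conv P \<alpha>\<close> are constrained and all three conditions on P occur.\<close>

lemma quads_Q16:
  assumes "e1 = A * B + C * D"
    and "e2 = A * D + B * C"
    and "e3 = A * C + B * D"
    and "f1 = (p + q + r + s) ^ 2 + (A * p + B * q + C * r + D * s)"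
    and "by = (A * r + C * p + B * s + D * q) + (A * C)"
    and "bxy = (A * s + D * p + B * r + C * q) + (A * D + B * C)"
    and "xx = (A * X1 + B * X0 + C * X3 + D * X2) + (A * B + B * p + C * D + D * r + p * q + r * s)"
  shows "map (\<lambda>g. quad (ulist (A, B, C, D) (p, q, r, s) (Y0, Y1, Y2, Y3) (X0, X1, X2, X3))
      (gmul std_perm (8, 1, 7, 0, 0, 0, 4, 0) g)) [1..<16] =
    [xx, f1, xx + e1, by, bxy, by + e3, bxy + e2, 0, xx + e1, f1, xx, by, bxy, by + e3, bxy + e2 :: 'f]"
  unfolding assms
  by (simp only: quad_expand, simp add: gmul_def tmul.simps, simp add: power2_eq_square algebra_simps)

lemma quads_D8C2:
  assumes "e1 = A * B + C * D"
    and "xx = (A * X1 + B * X0 + C * X3 + D * X2) + (A * B + C * D)"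
  shows "map (\<lambda>g. quad (ulist (A, B, C, D) (p, q, r, s) (Y0, Y1, Y2, Y3) (X0, X1, X2, X3))
      (gmul std_perm (4, 2, 3, 0, 0, 1, 0, 0) g)) [1..<16] =
    [xx, 0, xx, 0, 0, 0, 0, 0, xx + e1, 0, xx + e1, 0, 0, 0, 0 :: 'f]"
  unfolding assms
  by (simp only: quad_expand, simp add: gmul_def tmul.simps, simp add: power2_eq_square algebra_simps)

lemma quads_C4C4:
  assumes "e1 = A * B + C * D"
    and "e2 = A * D + B * C"
    and "e3 = A * C + B * D"
    and "by = (A * r + C * p + B * s + D * q) + (A * C)"
    and "bxy = (A * s + D * p + B * r + C * q) + (A * D + B * C)"
    and "xx = (A * X1 + B * X0 + C * X3 + D * X2) + (A * B + C * D)"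
  shows "map (\<lambda>g. quad (ulist (A, B, C, D) (p, q, r, s) (Y0, Y1, Y2, Y3) (X0, X1, X2, X3))
      (gmul std_perm (4, 2, 3, 0, 0, 1, 0, 1) g)) [1..<16] =
    [xx, 0, xx, by, bxy, by + e3, bxy + e2, 0, xx + e1, 0, xx + e1, by, bxy, by + e3, bxy + e2 :: 'f]"
  unfolding assms
  by (simp only: quad_expand, simp add: gmul_def tmul.simps, simp add: power2_eq_square algebra_simps)

text \<open>The renumbering takes z = \<open>x^2\<close>, c = y, and xb and b as representatives at
  positions 1 and 4. The square of xb is zc, which puts the only equation for W at component 1, as
  in most of the other groups.\<close>

lemma quads_H16:
  assumes "e1 = A * B + C * D"
    and "e2 = A * D + B * C"
    and "bxy = (A * s + D * p + B * r + C * q) + (A * D + B * C)"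
    and "xx = (A * X1 + B * X0 + C * X3 + D * X2) + (A * B + A * q + B * p + C * D + C * s + D * r)"
  shows "map (\<lambda>g. quad (ulist (A, B, C, D) (p, q, r, s) (Y0, Y1, Y2, Y3) (X0, X1, X2, X3))
      (gmul [0, 9, 4, 13, 8, 1, 12, 5, 2, 11, 6, 15, 10, 3, 14, 7] (4, 2, 1, 1, 0, 1, 0, 0) g)) [1..<16] =
    [xx, 0, xx + e1, 0, bxy, 0, bxy + e2, 0, xx + e1, 0, xx, 0, bxy, 0, bxy + e2 :: 'f]"
  unfolding assms
  by (simp only: quad_expand, simp add: gmul_def tmul.simps, simp add: power2_eq_square algebra_simps)

text \<open>The renumbering takes z = \<open>x^2\<close> and c = y. Modulo z the group is elementary
  abelian: g and zg give the same equation, and W does not occur.\<close>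

lemma quads_Q8C2:
  assumes "e1 = A * B + C * D"
    and "e2 = A * D + B * C"
    and "e3 = A * C + B * D"
    and "bx = (A * q + B * p + C * s + D * r) + (A * B + C * D)"
    and "by = (A * r + C * p + B * s + D * q) + (A * C + B * D)"
    and "bxy = (A * s + D * p + B * r + C * q) + (A * D + B * C)"
  shows "map (\<lambda>g. quad (ulist (A, B, C, D) (p, q, r, s) (Y0, Y1, Y2, Y3) (X0, X1, X2, X3))
      (gmul [0, 1, 4, 5, 8, 9, 12, 13, 2, 3, 6, 7, 10, 11, 14, 15] (4, 2, 3, 0, 0, 1, 2, 0) g)) [1..<16] =
    [bx, 0, bx + e1, by, bxy, by + e3, bxy + e2, 0, bx, 0, bx + e1, by, bxy, by + e3, bxy + e2 :: 'f]"
  unfolding assms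
  by (simp only: quad_expand, simp add: gmul_def tmul.simps, simp add: power2_eq_square algebra_simps)

text \<open>The renumbering takes z = \<open>x^2\<close> and c = xy, a central element of order 4
  with square z. Again the group is elementary abelian modulo z. The element cx is an involution, so
  its equation is void and \<open>e1\<close> does not become a separate condition.\<close>

lemma quads_D8YC4:
  assumes "e1 = A * B + C * D"
    and "f1 = (p + q + r + s) ^ 2 + (A * p + B * q + C * r + D * s)"
    and "bx = (A * q + B * p + C * s + D * r) + (A * B + C * D)"
    and "by = (A * r + C * p + B * s + D * q)"
    and "bxy = (A * s + D * p + B * r + C * q)"
  shows "map (\<lambda>g. quad (ulist (A, B, C, D) (p, q, r, s) (Y0, Y1, Y2, Y3) (X0, X1, X2, X3))
      (gmul [0, 1, 5, 6, 8, 9, 13, 14, 2, 3, 7, 4, 10, 11, 15, 12] (4, 2, 3, 0, 2, 1, 0, 0) g)) [1..<16] =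
    [bx, f1, 0, 0, 0, by, bxy, 0, bx, f1, 0, 0, 0, by, bxy :: 'f]"
  unfolding assms
  by (simp only: quad_expand, simp add: gmul_def tmul.simps, simp add: power2_eq_square algebra_simps)

end

context char2
begin

section \<open>Numbers of solutions of the equations for single components\<close>

lemma card_quadruple_1: "card {x :: 'f quadruple. fst (snd x) + c = 0} = CARD('f) ^ 3"
  by (subst card_witness[where g = "\<lambda>(s, t, u). (s, c, t, u)" and h = "\<lambda>(s, _, t, u). (s, t, u)"])
    (auto simp: card_UNIV_Times power3_eq_cube)

lemma card_quadruple_3: "card {x :: 'f quadruple. snd (snd (snd x)) + c = 0} = CARD('f) ^ 3"
  by (subst card_witness[where g = "\<lambda>(s, t, u). (s, t, u, c)" and h = "\<lambda>(s, t, u, _). (s, t, u)"])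
    (auto simp: card_UNIV_Times power3_eq_cube)

lemma card_quadruple_13:
  "card {x :: 'f quadruple. fst (snd x) + c = 0 \<and> snd (snd (snd x)) + d = 0} = CARD('f) ^ 2"
  by (subst card_witness[where g = "\<lambda>(s, t). (s, c, t, d)" and h = "\<lambda>(s, _, t, _). (s, t)"])
    (auto simp: card_UNIV_Times power2_eq_square)

lemma card_quadruple_23:
  "card {x :: 'f quadruple. fst (snd (snd x)) + c = 0 \<and> snd (snd (snd x)) + d = 0} = CARD('f) ^ 2"
  by (subst card_witness[where g = "\<lambda>(s, t). (s, t, c, d)" and h = "\<lambda>(s, t, _, _). (s, t)"])
    (auto simp: card_UNIV_Times power2_eq_square)

lemma card_quadruple_123:
  "card {x :: 'f quadruple. fst (snd x) + b = 0 \<and> fst (snd (snd x)) + c = 0 \<and>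
    snd (snd (snd x)) + d = 0} = CARD('f)"
  by (subst card_witness[where g = "\<lambda>s. (s, b, c, d)" and h = fst]) auto

text \<open>The augmentation t serves as parameter: it determines the first component as
  \<open>t^2\<close>, and the second component is then whatever makes the augmentation equal to t.
  No quadratic equation has to be solved.\<close>

lemma card_aug:
  "card {x :: 'f quadruple. (aug x) ^ 2 + fst x = 0} = CARD('f) ^ 3"
  by (subst card_witness[where g = "\<lambda>(t, y, z). (t ^ 2, t + t ^ 2 + y + z, y, z)"
        and h = "\<lambda>x. (aug x, snd (snd x))"])
    (auto simp: card_UNIV_Times power3_eq_cube algebra_simps)

lemma card_aug_3:
  "card {x :: 'f quadruple. (aug x) ^ 2 + fst x = 0 \<and> snd (snd (snd x)) + c = 0} = CARD('f) ^ 2"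
  by (subst card_witness[where g = "\<lambda>(t, y). (t ^ 2, t + t ^ 2 + y + c, y, c)"
        and h = "\<lambda>x. (aug x, fst (snd (snd x)))"])
    (auto simp: card_UNIV_Times power2_eq_square[of "CARD('f)"] algebra_simps)

lemma card_aug_2:
  "card {x :: 'f quadruple. (aug x) ^ 2 + fst x = 0 \<and> fst (snd (snd x)) + c = 0} = CARD('f) ^ 2"
  by (subst card_witness[where g = "\<lambda>(t, y). (t ^ 2, t + t ^ 2 + y + c, c, y)"
        and h = "\<lambda>x. (aug x, snd (snd (snd x)))"])
    (auto simp: card_UNIV_Times power2_eq_square[of "CARD('f)"] algebra_simps)

lemma card_aug_23:
  "card {x :: 'f quadruple. (aug x) ^ 2 + fst x = 0 \<and> fst (snd (snd x)) + c = 0 \<and>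
    snd (snd (snd x)) + d = 0} = CARD('f)"
  by (subst card_witness[where g = "\<lambda>t. (t ^ 2, t + t ^ 2 + c + d, c, d)" and h = aug])
    (auto simp: algebra_simps)

lemma card_quadruple: "card {x :: 'f quadruple. True} = CARD('f) ^ 4"
  by (simp add: power4_eq_xxxx mult.assoc)

section \<open>The conditions on the image in the group algebra of the Klein four-group\<close>

text \<open>The coefficient of P P* at a nontrivial element counts each of two products twice.
  Counting them once gives \<open>e1\<close> for the first generator, \<open>e2\<close> for the
  product of both generators and \<open>e3\<close> for the second generator.\<close>

fun e1 :: "'f quadruple \<Rightarrow> 'f" where "e1 (A, B, C, D) = A * B + C * D"
fun e2 :: "'f quadruple \<Rightarrow> 'f" where "e2 (A, B, C, D) = A * D + B * C"
fun e3 :: "'f quadruple \<Rightarrow> 'f" where "e3 (A, B, C, D) = A * C + B * D"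

lemma add_eq_iff: "x + y = z \<longleftrightarrow> y = x + (z :: 'f)"
  by auto

lemma aug_1_iff: "aug (A, B, C, D) = (1 :: 'f) \<longleftrightarrow> D = 1 + A + B + C"
  using add_eq_iff[of "A + B + C" D 1] by (simp add: add.commute add.left_commute)

lemma e1_factor:
  assumes "aug (A, B, C, D) = (1 :: 'f)"
  shows "e1 (A, B, C, D) = (A + C) * (B + C) + C"
  using assms unfolding aug_1_iff by (simp add: algebra_simps)

lemma e12_factor: "e1 (A, B, C, D) + e2 (A, B, C, D) = (A + C) * (B + D :: 'f)"
  by (simp add: algebra_simps)

text \<open>With s = A + C and t = B + C the equation becomes C = s t + c, and augmentation 1 then
  gives D. Hence (s, t) parametrizes the solutions for every right-hand side.\<close>

lemma card_e1_eq: "card {P. aug P = (1 :: 'f) \<and> e1 P = c} = CARD('f) ^ 2"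
proof (subst card_witness[where g = "\<lambda>(s, t). (s + (s * t + c), t + (s * t + c), s * t + c, 1 + s + t + (s * t + c))"
      and h = "\<lambda>(A, B, C, D). (A + C, B + C)"])
  fix P :: "'f quadruple"
  assume *: "aug P = 1 \<and> e1 P = c"
  obtain A B C D where P: "P = (A, B, C, D)" by (cases P)
  have "(A + C) * (B + C) + C = c" using * e1_factor[of A B C D] unfolding P by metis
  then have C: "(A + C) * (B + C) + c = C" by (simp only: add_eq_iff[of _ C c] add_eq_iff[of _ c C])
  have "D = 1 + A + B + C" using * by (simp only: P aug_1_iff)
  moreover have "1 + (A + C) + (B + C) + C = 1 + A + B + C" by (simp add: add.commute add.left_commute)
  ultimately show "(\<lambda>(s, t). (s + (s * t + c), t + (s * t + c), s * t + c, 1 + s + t + (s * t + c)))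
      ((\<lambda>(A, B, C, D). (A + C, B + C)) P) = P"
    by (simp only: P prod.case C) (simp add: add.assoc)
qed (auto simp: card_UNIV_Times power2_eq_square algebra_simps)

text \<open>The sum of \<open>e1\<close> and \<open>e2\<close> is (A + C)(B + D), and the two
  factors add up to 1. So one of them vanishes, and \<open>e1\<close> = 0 then makes the two equal
  coefficients zero.\<close>

lemma e12_iff:
  "aug P = (1 :: 'f) \<and> e1 P = 0 \<and> e2 P = 0 \<longleftrightarrow>
    (\<exists>c. P = (0, c, 0, c + 1)) \<or> (\<exists>c. P = (c, 0, c + 1, 0))"
proof
  obtain A B C D where P: "P = (A, B, C, D)" by (cases P)
  assume *: "aug P = 1 \<and> e1 P = 0 \<and> e2 P = 0"
  then have D: "D = 1 + A + B + C" and e: "(A + C) * (B + C) = C" and "(A + C) * (B + D) = 0"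
    using aug_1_iff[of A B C D] e1_factor[of A B C D] e12_factor[of A B C D] by (auto simp: P)
  then consider "A = C" | "B = D" by auto
  then show "(\<exists>c. P = (0, c, 0, c + 1)) \<or> (\<exists>c. P = (c, 0, c + 1, 0))"
  proof cases
    case 1
    then have "C = 0" using e by simp
    then show ?thesis using 1 D by (simp add: P add.commute)
  next
    case 2
    then have "A + C = 1" using D by (metis add.assoc add.commute add_self_left)
    then have "C = A + 1" "B = 0" using e add_eq_iff[of A C 1] by (auto simp: algebra_simps)
    then show ?thesis using 2 by (simp add: P)
  qed
qed (auto simp: algebra_simps)

lemma card_e12: "card {P. aug P = (1 :: 'f) \<and> e1 P = 0 \<and> e2 P = 0} = 2 * CARD('f)"
proof -
  have "{P. aug P = (1 :: 'f) \<and> e1 P = 0 \<and> e2 P = 0} =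
      range (\<lambda>c. (0, c, 0, c + 1)) \<union> range (\<lambda>c. (c, 0, c + 1, 0))"
    unfolding e12_iff by auto
  moreover have "card (range (\<lambda>c :: 'f. (0 :: 'f, c, 0 :: 'f, c + 1))) = CARD('f)"
    "card (range (\<lambda>c :: 'f. (c, 0 :: 'f, c + 1, 0 :: 'f))) = CARD('f)"
    by (auto intro!: card_image injI)
  moreover have "range (\<lambda>c :: 'f. (0 :: 'f, c, 0 :: 'f, c + 1)) \<inter> range (\<lambda>c. (c, 0, c + 1, 0)) = {}"
    by auto
  ultimately show ?thesis by (simp add: card_Un_disjoint)
qed

text \<open>On each of the two lines \<open>e3\<close> is c (c + 1); its zeros are the four group
  elements.\<close>

lemma card_e123: "card {P. aug P = (1 :: 'f) \<and> e1 P = 0 \<and> e2 P = 0 \<and> e3 P = 0} = 4"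
proof -
  have *: "aug P = (1 :: 'f) \<and> e1 P = 0 \<and> e2 P = 0 \<and> e3 P = 0 \<longleftrightarrow>
      (aug P = (1 :: 'f) \<and> e1 P = 0 \<and> e2 P = 0) \<and> e3 P = 0" for P
    by blast
  have "c * (c + 1) = 0 \<longleftrightarrow> c = 0 \<or> c = (1 :: 'f)" for c by auto
  then have "{P. aug P = (1 :: 'f) \<and> e1 P = 0 \<and> e2 P = 0 \<and> e3 P = 0} =
      {(1, 0, 0, 0), (0, 1, 0, 0), (0, 0, 1, 0), (0, 0, 0, 1)}"
    unfolding * e12_iff by auto
  then show ?thesis by simp
qed

section \<open>Counting the solutions for the nine multiplication tables\<close>

lemma card_sols_D16:
  "card (unitary_sols (gmul std_perm (8, 1, 7, 0, 0, 0, 0, 0)) :: 'f list set) =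
    (CARD('f) ^ 2) * (CARD('f) ^ 3) * (CARD('f) ^ 4 * CARD('f) ^ 3)"
proof -
  \<comment> \<open>\<open>?\<Phi>\<close> collects the conditions on P and on \<beta> =
    \<open>conv P \<alpha>\<close>. \<open>?\<Psi>\<close> is the condition on
    \<open>conv P W\<close>: its inhomogeneous part depends on P and \<alpha>, its number of
    solutions does not.\<close>
  let ?\<Phi> = "\<lambda>(P :: 'f quadruple) (\<beta> :: 'f quadruple). (e1 P = 0) \<and> (case P of (A, B, C, D) \<Rightarrow> (aug \<beta>) ^ 2 + fst \<beta> = 0)"
    and ?\<Psi> = "\<lambda>(A, B, C, D) (p, q, r, s) (x :: 'f quadruple). fst (snd x) + (A * B + B * p + C * D + D * r + p * q + r * s) = 0"
  have iff: "ulist P \<alpha> Z W \<in> unitary_sols (gmul std_perm (8, 1, 7, 0, 0, 0, 0, 0)) \<longleftrightarrow>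
      aug P = 1 \<and> ?\<Phi> P (conv P \<alpha>) \<and> ?\<Psi> P \<alpha> (conv P W)"
    for P \<alpha> Z W :: "'f quadruple"
  proof -
    obtain A B C D p q r s Y0 Y1 Y2 Y3 X0 X1 X2 X3
      where v: "P = (A, B, C, D)" "\<alpha> = (p, q, r, s)" "Z = (Y0, Y1, Y2, Y3)" "W = (X0, X1, X2, X3)"
      by (metis surj_pair)
    define e1' where "e1' = A * B + C * D"
    define f1 where "f1 = (p + q + r + s) ^ 2 + (A * p + B * q + C * r + D * s)"
    define h1 where "h1 = (A * X1 + B * X0 + C * X3 + D * X2) + (A * B + B * p + C * D + D * r + p * q + r * s)"
    show ?thesis
    proof (cases "aug P = 1")
      case True
      \<comment> \<open>Since P has augmentation 1, \<alpha> and \<open>conv P \<alpha>\<close> have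
        the same augmentation, so the square in \<open>f1\<close> is a condition on \<beta>
        alone.\<close>
      then have s: "aug (conv P \<alpha>) = p + q + r + s"
        by (simp only: aug_conv) (simp add: v)
      have "?\<Phi> P (conv P \<alpha>) \<and> ?\<Psi> P \<alpha> (conv P W) \<longleftrightarrow> e1' = 0 \<and> f1 = 0 \<and> h1 = 0"
        unfolding s unfolding v by (simp add: e1'_def f1_def h1_def)
      also have "\<dots> \<longleftrightarrow> ulist P \<alpha> Z W \<in> unitary_sols (gmul std_perm (8, 1, 7, 0, 0, 0, 0, 0))"
        using True unfolding unitary_sols_iff v quads_D16[OF e1'_def f1_def h1_def] by auto
      finally show ?thesis using True by blast
    qed (simp add: unitary_sols_iff)
  qed
  have "card {\<beta> :: 'f quadruple. case P of (A, B, C, D) \<Rightarrow> (aug \<beta>) ^ 2 + fst \<beta> = 0} = CARD('f) ^ 3" for P :: "'f quadruple"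
    by (cases P) (simp only: prod.case card_aug)
  then have "card {(P :: 'f quadruple, \<beta> :: 'f quadruple). (aug P = 1 \<and> e1 P = 0) \<and> (case P of (A, B, C, D) \<Rightarrow> (aug \<beta>) ^ 2 + fst \<beta> = 0)} = (CARD('f) ^ 2) * (CARD('f) ^ 3)"
    by (subst card_layer) (simp_all only: card_e1_eq)
  then have K: "card {(P, \<beta>). aug P = 1 \<and> ?\<Phi> P \<beta>} = (CARD('f) ^ 2) * (CARD('f) ^ 3)"
    by (simp only: conj_assoc)
  have M: "card {x. ?\<Psi> P \<alpha> x} = CARD('f) ^ 3" for P \<alpha> :: "'f quadruple"
    by (cases P; cases \<alpha>) (simp only: prod.case card_quadruple_1)
  show ?thesis by (rule card_unitary_sols[OF iff K M])
qed

lemma card_sols_SD16: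
  "card (unitary_sols (gmul std_perm (8, 1, 3, 0, 0, 0, 0, 0)) :: 'f list set) =
    (2 * CARD('f)) * (CARD('f) ^ 2) * (CARD('f) ^ 4 * CARD('f) ^ 3)"
proof -
  let ?\<Phi> = "\<lambda>(P :: 'f quadruple) (\<beta> :: 'f quadruple). (e1 P = 0 \<and> e2 P = 0) \<and> (case P of (A, B, C, D) \<Rightarrow> (aug \<beta>) ^ 2 + fst \<beta> = 0 \<and> snd (snd (snd \<beta>)) + (A * D + B * C) = 0)"
    and ?\<Psi> = "\<lambda>(A, B, C, D) (p, q, r, s) (x :: 'f quadruple). fst (snd x) + (A * B + B * p + C * D + D * r + p * q + r * s) = 0"
  have iff: "ulist P \<alpha> Z W \<in> unitary_sols (gmul std_perm (8, 1, 3, 0, 0, 0, 0, 0)) \<longleftrightarrow>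
      aug P = 1 \<and> ?\<Phi> P (conv P \<alpha>) \<and> ?\<Psi> P \<alpha> (conv P W)"
    for P \<alpha> Z W :: "'f quadruple"
  proof -
    obtain A B C D p q r s Y0 Y1 Y2 Y3 X0 X1 X2 X3
      where v: "P = (A, B, C, D)" "\<alpha> = (p, q, r, s)" "Z = (Y0, Y1, Y2, Y3)" "W = (X0, X1, X2, X3)"
      by (metis surj_pair)
    define e1' where "e1' = A * B + C * D"
    define e2' where "e2' = A * D + B * C"
    define f1 where "f1 = (p + q + r + s) ^ 2 + (A * p + B * q + C * r + D * s)"
    define g3 where "g3 = (A * s + D * p + B * r + C * q) + (A * D + B * C)"
    define h1 where "h1 = (A * X1 + B * X0 + C * X3 + D * X2) + (A * B + B * p + C * D + D * r + p * q + r * s)"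
    show ?thesis
    proof (cases "aug P = 1")
      case True
      then have s: "aug (conv P \<alpha>) = p + q + r + s"
        by (simp only: aug_conv) (simp add: v)
      have "?\<Phi> P (conv P \<alpha>) \<and> ?\<Psi> P \<alpha> (conv P W) \<longleftrightarrow> e1' = 0 \<and> e2' = 0 \<and> f1 = 0 \<and> g3 = 0 \<and> h1 = 0"
        unfolding s unfolding v by (simp add: e1'_def e2'_def f1_def g3_def h1_def)
      also have "\<dots> \<longleftrightarrow> ulist P \<alpha> Z W \<in> unitary_sols (gmul std_perm (8, 1, 3, 0, 0, 0, 0, 0))"
        using True unfolding unitary_sols_iff v quads_SD16[OF e1'_def e2'_def f1_def g3_def h1_def] by auto
      finally show ?thesis using True by blast
    qed (simp add: unitary_sols_iff)
  qed
  have "card {\<beta> :: 'f quadruple. case P of (A, B, C, D) \<Rightarrow> (aug \<beta>) ^ 2 + fst \<beta> = 0 \<and> snd (snd (snd \<beta>)) + (A * D + B * C) = 0} = CARD('f) ^ 2" for P :: "'f quadruple"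
    by (cases P) (simp only: prod.case card_aug_3)
  then have "card {(P :: 'f quadruple, \<beta> :: 'f quadruple). (aug P = 1 \<and> e1 P = 0 \<and> e2 P = 0) \<and> (case P of (A, B, C, D) \<Rightarrow> (aug \<beta>) ^ 2 + fst \<beta> = 0 \<and> snd (snd (snd \<beta>)) + (A * D + B * C) = 0)} = (2 * CARD('f)) * (CARD('f) ^ 2)"
    by (subst card_layer) (simp_all only: card_e12)
  then have K: "card {(P, \<beta>). aug P = 1 \<and> ?\<Phi> P \<beta>} = (2 * CARD('f)) * (CARD('f) ^ 2)"
    by (simp only: conj_assoc)
  have M: "card {x. ?\<Psi> P \<alpha> x} = CARD('f) ^ 3" for P \<alpha> :: "'f quadruple"
    by (cases P; cases \<alpha>) (simp only: prod.case card_quadruple_1)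
  show ?thesis by (rule card_unitary_sols[OF iff K M])
qed

lemma card_sols_M16:
  "card (unitary_sols (gmul std_perm (8, 1, 5, 0, 0, 0, 0, 0)) :: 'f list set) =
    (2 * CARD('f)) * (CARD('f) ^ 2) * (CARD('f) ^ 4 * CARD('f) ^ 2)"
proof -
  let ?\<Phi> = "\<lambda>(P :: 'f quadruple) (\<beta> :: 'f quadruple). (e1 P = 0 \<and> e2 P = 0) \<and> (case P of (A, B, C, D) \<Rightarrow> (aug \<beta>) ^ 2 + fst \<beta> = 0 \<and> fst (snd (snd \<beta>)) + (0) = 0)"
    and ?\<Psi> = "\<lambda>(A, B, C, D) (p, q, r, s) (x :: 'f quadruple). fst (snd x) + (A * B + B * p + C * D + D * r + p * q + r * s) = 0 \<and> snd (snd (snd x)) + (A * D + A * s + B * C + C * q + p * s + q * r) = 0"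
  have iff: "ulist P \<alpha> Z W \<in> unitary_sols (gmul std_perm (8, 1, 5, 0, 0, 0, 0, 0)) \<longleftrightarrow>
      aug P = 1 \<and> ?\<Phi> P (conv P \<alpha>) \<and> ?\<Psi> P \<alpha> (conv P W)"
    for P \<alpha> Z W :: "'f quadruple"
  proof -
    obtain A B C D p q r s Y0 Y1 Y2 Y3 X0 X1 X2 X3
      where v: "P = (A, B, C, D)" "\<alpha> = (p, q, r, s)" "Z = (Y0, Y1, Y2, Y3)" "W = (X0, X1, X2, X3)"
      by (metis surj_pair)
    define e1' where "e1' = A * B + C * D"
    define e2' where "e2' = A * D + B * C"
    define f1 where "f1 = (p + q + r + s) ^ 2 + (A * p + B * q + C * r + D * s)"
    define g2 where "g2 = (A * r + C * p + B * s + D * q)"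
    define h1 where "h1 = (A * X1 + B * X0 + C * X3 + D * X2) + (A * B + B * p + C * D + D * r + p * q + r * s)"
    define h3 where "h3 = (A * X3 + D * X0 + B * X2 + C * X1) + (A * D + A * s + B * C + C * q + p * s + q * r)"
    show ?thesis
    proof (cases "aug P = 1")
      case True
      then have s: "aug (conv P \<alpha>) = p + q + r + s"
        by (simp only: aug_conv) (simp add: v)
      have "?\<Phi> P (conv P \<alpha>) \<and> ?\<Psi> P \<alpha> (conv P W) \<longleftrightarrow> e1' = 0 \<and> e2' = 0 \<and> f1 = 0 \<and> g2 = 0 \<and> h1 = 0 \<and> h3 = 0"
        unfolding s unfolding v by (simp add: e1'_def e2'_def f1_def g2_def h1_def h3_def)
      also have "\<dots> \<longleftrightarrow> ulist P \<alpha> Z W \<in> unitary_sols (gmul std_perm (8, 1, 5, 0, 0, 0, 0, 0))"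
        using True unfolding unitary_sols_iff v quads_M16[OF e1'_def e2'_def f1_def g2_def h1_def h3_def] by auto
      finally show ?thesis using True by blast
    qed (simp add: unitary_sols_iff)
  qed
  have "card {\<beta> :: 'f quadruple. case P of (A, B, C, D) \<Rightarrow> (aug \<beta>) ^ 2 + fst \<beta> = 0 \<and> fst (snd (snd \<beta>)) + (0) = 0} = CARD('f) ^ 2" for P :: "'f quadruple"
    by (cases P) (simp only: prod.case card_aug_2)
  then have "card {(P :: 'f quadruple, \<beta> :: 'f quadruple). (aug P = 1 \<and> e1 P = 0 \<and> e2 P = 0) \<and> (case P of (A, B, C, D) \<Rightarrow> (aug \<beta>) ^ 2 + fst \<beta> = 0 \<and> fst (snd (snd \<beta>)) + (0) = 0)} = (2 * CARD('f)) * (CARD('f) ^ 2)"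
    by (subst card_layer) (simp_all only: card_e12)
  then have K: "card {(P, \<beta>). aug P = 1 \<and> ?\<Phi> P \<beta>} = (2 * CARD('f)) * (CARD('f) ^ 2)"
    by (simp only: conj_assoc)
  have M: "card {x. ?\<Psi> P \<alpha> x} = CARD('f) ^ 2" for P \<alpha> :: "'f quadruple"
    by (cases P; cases \<alpha>) (simp only: prod.case card_quadruple_13)
  show ?thesis by (rule card_unitary_sols[OF iff K M])
qed

lemma card_sols_Q16:
  "card (unitary_sols (gmul std_perm (8, 1, 7, 0, 0, 0, 4, 0)) :: 'f list set) =
    (4) * (CARD('f)) * (CARD('f) ^ 4 * CARD('f) ^ 3)"
proof -
  let ?\<Phi> = "\<lambda>(P :: 'f quadruple) (\<beta> :: 'f quadruple). (e1 P = 0 \<and> e2 P = 0 \<and> e3 P = 0) \<and> (case P of (A, B, C, D) \<Rightarrow> (aug \<beta>) ^ 2 + fst \<beta> = 0 \<and> fst (snd (snd \<beta>)) + (A * C) = 0 \<and> snd (snd (snd \<beta>)) + (A * D + B * C) = 0)"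
    and ?\<Psi> = "\<lambda>(A, B, C, D) (p, q, r, s) (x :: 'f quadruple). fst (snd x) + (A * B + B * p + C * D + D * r + p * q + r * s) = 0"
  have iff: "ulist P \<alpha> Z W \<in> unitary_sols (gmul std_perm (8, 1, 7, 0, 0, 0, 4, 0)) \<longleftrightarrow>
      aug P = 1 \<and> ?\<Phi> P (conv P \<alpha>) \<and> ?\<Psi> P \<alpha> (conv P W)"
    for P \<alpha> Z W :: "'f quadruple"
  proof -
    obtain A B C D p q r s Y0 Y1 Y2 Y3 X0 X1 X2 X3
      where v: "P = (A, B, C, D)" "\<alpha> = (p, q, r, s)" "Z = (Y0, Y1, Y2, Y3)" "W = (X0, X1, X2, X3)"
      by (metis surj_pair)
    define e1' where "e1' = A * B + C * D"
    define e2' where "e2' = A * D + B * C"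
    define e3' where "e3' = A * C + B * D"
    define f1 where "f1 = (p + q + r + s) ^ 2 + (A * p + B * q + C * r + D * s)"
    define g2 where "g2 = (A * r + C * p + B * s + D * q) + (A * C)"
    define g3 where "g3 = (A * s + D * p + B * r + C * q) + (A * D + B * C)"
    define h1 where "h1 = (A * X1 + B * X0 + C * X3 + D * X2) + (A * B + B * p + C * D + D * r + p * q + r * s)"
    show ?thesis
    proof (cases "aug P = 1")
      case True
      then have s: "aug (conv P \<alpha>) = p + q + r + s"
        by (simp only: aug_conv) (simp add: v)
      have "?\<Phi> P (conv P \<alpha>) \<and> ?\<Psi> P \<alpha> (conv P W) \<longleftrightarrow> e1' = 0 \<and> e2' = 0 \<and> e3' = 0 \<and> f1 = 0 \<and> g2 = 0 \<and> g3 = 0 \<and> h1 = 0"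
        unfolding s unfolding v by (simp add: e1'_def e2'_def e3'_def f1_def g2_def g3_def h1_def)
      also have "\<dots> \<longleftrightarrow> ulist P \<alpha> Z W \<in> unitary_sols (gmul std_perm (8, 1, 7, 0, 0, 0, 4, 0))"
        using True unfolding unitary_sols_iff v quads_Q16[OF e1'_def e2'_def e3'_def f1_def g2_def g3_def h1_def] by auto
      finally show ?thesis using True by blast
    qed (simp add: unitary_sols_iff)
  qed
  have "card {\<beta> :: 'f quadruple. case P of (A, B, C, D) \<Rightarrow> (aug \<beta>) ^ 2 + fst \<beta> = 0 \<and> fst (snd (snd \<beta>)) + (A * C) = 0 \<and> snd (snd (snd \<beta>)) + (A * D + B * C) = 0} = CARD('f)" for P :: "'f quadruple"
    by (cases P) (simp only: prod.case card_aug_23)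
  then have "card {(P :: 'f quadruple, \<beta> :: 'f quadruple). (aug P = 1 \<and> e1 P = 0 \<and> e2 P = 0 \<and> e3 P = 0) \<and> (case P of (A, B, C, D) \<Rightarrow> (aug \<beta>) ^ 2 + fst \<beta> = 0 \<and> fst (snd (snd \<beta>)) + (A * C) = 0 \<and> snd (snd (snd \<beta>)) + (A * D + B * C) = 0)} = (4) * (CARD('f))"
    by (subst card_layer) (simp_all only: card_e123)
  then have K: "card {(P, \<beta>). aug P = 1 \<and> ?\<Phi> P \<beta>} = (4) * (CARD('f))"
    by (simp only: conj_assoc)
  have M: "card {x. ?\<Psi> P \<alpha> x} = CARD('f) ^ 3" for P \<alpha> :: "'f quadruple"
    by (cases P; cases \<alpha>) (simp only: prod.case card_quadruple_1)
  show ?thesis by (rule card_unitary_sols[OF iff K M])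
qed

lemma card_sols_D8C2:
  "card (unitary_sols (gmul std_perm (4, 2, 3, 0, 0, 1, 0, 0)) :: 'f list set) =
    (CARD('f) ^ 2) * (CARD('f) ^ 4) * (CARD('f) ^ 4 * CARD('f) ^ 3)"
proof -
  let ?\<Phi> = "\<lambda>(P :: 'f quadruple) (\<beta> :: 'f quadruple). (e1 P = 0) \<and> (case P of (A, B, C, D) \<Rightarrow> True)"
    and ?\<Psi> = "\<lambda>(A, B, C, D) (p, q, r, s) (x :: 'f quadruple). fst (snd x) + (A * B + C * D) = 0"
  have iff: "ulist P \<alpha> Z W \<in> unitary_sols (gmul std_perm (4, 2, 3, 0, 0, 1, 0, 0)) \<longleftrightarrow>
      aug P = 1 \<and> ?\<Phi> P (conv P \<alpha>) \<and> ?\<Psi> P \<alpha> (conv P W)"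
    for P \<alpha> Z W :: "'f quadruple"
  proof -
    obtain A B C D p q r s Y0 Y1 Y2 Y3 X0 X1 X2 X3
      where v: "P = (A, B, C, D)" "\<alpha> = (p, q, r, s)" "Z = (Y0, Y1, Y2, Y3)" "W = (X0, X1, X2, X3)"
      by (metis surj_pair)
    define e1' where "e1' = A * B + C * D"
    define h1 where "h1 = (A * X1 + B * X0 + C * X3 + D * X2) + (A * B + C * D)"
    show ?thesis
    proof (cases "aug P = 1")
      case True
      then have s: "aug (conv P \<alpha>) = p + q + r + s"
        by (simp only: aug_conv) (simp add: v)
      have "?\<Phi> P (conv P \<alpha>) \<and> ?\<Psi> P \<alpha> (conv P W) \<longleftrightarrow> e1' = 0 \<and> h1 = 0"
        unfolding s unfolding v by (simp add: e1'_def h1_def)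
      also have "\<dots> \<longleftrightarrow> ulist P \<alpha> Z W \<in> unitary_sols (gmul std_perm (4, 2, 3, 0, 0, 1, 0, 0))"
        using True unfolding unitary_sols_iff v quads_D8C2[OF e1'_def h1_def] by auto
      finally show ?thesis using True by blast
    qed (simp add: unitary_sols_iff)
  qed
  have "card {\<beta> :: 'f quadruple. case P of (A, B, C, D) \<Rightarrow> True} = CARD('f) ^ 4" for P :: "'f quadruple"
    by (cases P) (simp only: prod.case card_quadruple)
  then have "card {(P :: 'f quadruple, \<beta> :: 'f quadruple). (aug P = 1 \<and> e1 P = 0) \<and> (case P of (A, B, C, D) \<Rightarrow> True)} = (CARD('f) ^ 2) * (CARD('f) ^ 4)"
    by (subst card_layer) (simp_all only: card_e1_eq)
  then have K: "card {(P, \<beta>). aug P = 1 \<and> ?\<Phi> P \<beta>} = (CARD('f) ^ 2) * (CARD('f) ^ 4)"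
    by (simp only: conj_assoc)
  have M: "card {x. ?\<Psi> P \<alpha> x} = CARD('f) ^ 3" for P \<alpha> :: "'f quadruple"
    by (cases P; cases \<alpha>) (simp only: prod.case card_quadruple_1)
  show ?thesis by (rule card_unitary_sols[OF iff K M])
qed

lemma card_sols_C4C4:
  "card (unitary_sols (gmul std_perm (4, 2, 3, 0, 0, 1, 0, 1)) :: 'f list set) =
    (4) * (CARD('f) ^ 2) * (CARD('f) ^ 4 * CARD('f) ^ 3)"
proof -
  let ?\<Phi> = "\<lambda>(P :: 'f quadruple) (\<beta> :: 'f quadruple). (e1 P = 0 \<and> e2 P = 0 \<and> e3 P = 0) \<and> (case P of (A, B, C, D) \<Rightarrow> fst (snd (snd \<beta>)) + (A * C) = 0 \<and> snd (snd (snd \<beta>)) + (A * D + B * C) = 0)"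
    and ?\<Psi> = "\<lambda>(A, B, C, D) (p, q, r, s) (x :: 'f quadruple). fst (snd x) + (A * B + C * D) = 0"
  have iff: "ulist P \<alpha> Z W \<in> unitary_sols (gmul std_perm (4, 2, 3, 0, 0, 1, 0, 1)) \<longleftrightarrow>
      aug P = 1 \<and> ?\<Phi> P (conv P \<alpha>) \<and> ?\<Psi> P \<alpha> (conv P W)"
    for P \<alpha> Z W :: "'f quadruple"
  proof -
    obtain A B C D p q r s Y0 Y1 Y2 Y3 X0 X1 X2 X3
      where v: "P = (A, B, C, D)" "\<alpha> = (p, q, r, s)" "Z = (Y0, Y1, Y2, Y3)" "W = (X0, X1, X2, X3)"
      by (metis surj_pair)
    define e1' where "e1' = A * B + C * D"
    define e2' where "e2' = A * D + B * C"
    define e3' where "e3' = A * C + B * D"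
    define g2 where "g2 = (A * r + C * p + B * s + D * q) + (A * C)"
    define g3 where "g3 = (A * s + D * p + B * r + C * q) + (A * D + B * C)"
    define h1 where "h1 = (A * X1 + B * X0 + C * X3 + D * X2) + (A * B + C * D)"
    show ?thesis
    proof (cases "aug P = 1")
      case True
      then have s: "aug (conv P \<alpha>) = p + q + r + s"
        by (simp only: aug_conv) (simp add: v)
      have "?\<Phi> P (conv P \<alpha>) \<and> ?\<Psi> P \<alpha> (conv P W) \<longleftrightarrow> e1' = 0 \<and> e2' = 0 \<and> e3' = 0 \<and> g2 = 0 \<and> g3 = 0 \<and> h1 = 0"
        unfolding s unfolding v by (simp add: e1'_def e2'_def e3'_def g2_def g3_def h1_def)
      also have "\<dots> \<longleftrightarrow> ulist P \<alpha> Z W \<in> unitary_sols (gmul std_perm (4, 2, 3, 0, 0, 1, 0, 1))"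
        using True unfolding unitary_sols_iff v quads_C4C4[OF e1'_def e2'_def e3'_def g2_def g3_def h1_def] by auto
      finally show ?thesis using True by blast
    qed (simp add: unitary_sols_iff)
  qed
  have "card {\<beta> :: 'f quadruple. case P of (A, B, C, D) \<Rightarrow> fst (snd (snd \<beta>)) + (A * C) = 0 \<and> snd (snd (snd \<beta>)) + (A * D + B * C) = 0} = CARD('f) ^ 2" for P :: "'f quadruple"
    by (cases P) (simp only: prod.case card_quadruple_23)
  then have "card {(P :: 'f quadruple, \<beta> :: 'f quadruple). (aug P = 1 \<and> e1 P = 0 \<and> e2 P = 0 \<and> e3 P = 0) \<and> (case P of (A, B, C, D) \<Rightarrow> fst (snd (snd \<beta>)) + (A * C) = 0 \<and> snd (snd (snd \<beta>)) + (A * D + B * C) = 0)} = (4) * (CARD('f) ^ 2)"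
    by (subst card_layer) (simp_all only: card_e123)
  then have K: "card {(P, \<beta>). aug P = 1 \<and> ?\<Phi> P \<beta>} = (4) * (CARD('f) ^ 2)"
    by (simp only: conj_assoc)
  have M: "card {x. ?\<Psi> P \<alpha> x} = CARD('f) ^ 3" for P \<alpha> :: "'f quadruple"
    by (cases P; cases \<alpha>) (simp only: prod.case card_quadruple_1)
  show ?thesis by (rule card_unitary_sols[OF iff K M])
qed

lemma card_sols_H16:
  "card (unitary_sols (gmul [0, 9, 4, 13, 8, 1, 12, 5, 2, 11, 6, 15, 10, 3, 14, 7] (4, 2, 1, 1, 0, 1, 0, 0)) :: 'f list set) =
    (2 * CARD('f)) * (CARD('f) ^ 3) * (CARD('f) ^ 4 * CARD('f) ^ 3)"
proof -
  let ?\<Phi> = "\<lambda>(P :: 'f quadruple) (\<beta> :: 'f quadruple). (e1 P = 0 \<and> e2 P = 0) \<and> (case P of (A, B, C, D) \<Rightarrow> snd (snd (snd \<beta>)) + (A * D + B * C) = 0)"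
    and ?\<Psi> = "\<lambda>(A, B, C, D) (p, q, r, s) (x :: 'f quadruple). fst (snd x) + (A * B + A * q + B * p + C * D + C * s + D * r) = 0"
  have iff: "ulist P \<alpha> Z W \<in> unitary_sols (gmul [0, 9, 4, 13, 8, 1, 12, 5, 2, 11, 6, 15, 10, 3, 14, 7] (4, 2, 1, 1, 0, 1, 0, 0)) \<longleftrightarrow>
      aug P = 1 \<and> ?\<Phi> P (conv P \<alpha>) \<and> ?\<Psi> P \<alpha> (conv P W)"
    for P \<alpha> Z W :: "'f quadruple"
  proof -
    obtain A B C D p q r s Y0 Y1 Y2 Y3 X0 X1 X2 X3
      where v: "P = (A, B, C, D)" "\<alpha> = (p, q, r, s)" "Z = (Y0, Y1, Y2, Y3)" "W = (X0, X1, X2, X3)"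
      by (metis surj_pair)
    define e1' where "e1' = A * B + C * D"
    define e2' where "e2' = A * D + B * C"
    define g3 where "g3 = (A * s + D * p + B * r + C * q) + (A * D + B * C)"
    define h1 where "h1 = (A * X1 + B * X0 + C * X3 + D * X2) + (A * B + A * q + B * p + C * D + C * s + D * r)"
    show ?thesis
    proof (cases "aug P = 1")
      case True
      then have s: "aug (conv P \<alpha>) = p + q + r + s"
        by (simp only: aug_conv) (simp add: v)
      have "?\<Phi> P (conv P \<alpha>) \<and> ?\<Psi> P \<alpha> (conv P W) \<longleftrightarrow> e1' = 0 \<and> e2' = 0 \<and> g3 = 0 \<and> h1 = 0"
        unfolding s unfolding v by (simp add: e1'_def e2'_def g3_def h1_def)
      also have "\<dots> \<longleftrightarrow> ulist P \<alpha> Z W \<in> unitary_sols (gmul [0, 9, 4, 13, 8, 1, 12, 5, 2, 11, 6, 15, 10, 3, 14, 7] (4, 2, 1, 1, 0, 1, 0, 0))"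
        using True unfolding unitary_sols_iff v quads_H16[OF e1'_def e2'_def g3_def h1_def] by auto
      finally show ?thesis using True by blast
    qed (simp add: unitary_sols_iff)
  qed
  have "card {\<beta> :: 'f quadruple. case P of (A, B, C, D) \<Rightarrow> snd (snd (snd \<beta>)) + (A * D + B * C) = 0} = CARD('f) ^ 3" for P :: "'f quadruple"
    by (cases P) (simp only: prod.case card_quadruple_3)
  then have "card {(P :: 'f quadruple, \<beta> :: 'f quadruple). (aug P = 1 \<and> e1 P = 0 \<and> e2 P = 0) \<and> (case P of (A, B, C, D) \<Rightarrow> snd (snd (snd \<beta>)) + (A * D + B * C) = 0)} = (2 * CARD('f)) * (CARD('f) ^ 3)"
    by (subst card_layer) (simp_all only: card_e12)
  then have K: "card {(P, \<beta>). aug P = 1 \<and> ?\<Phi> P \<beta>} = (2 * CARD('f)) * (CARD('f) ^ 3)"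
    by (simp only: conj_assoc)
  have M: "card {x. ?\<Psi> P \<alpha> x} = CARD('f) ^ 3" for P \<alpha> :: "'f quadruple"
    by (cases P; cases \<alpha>) (simp only: prod.case card_quadruple_1)
  show ?thesis by (rule card_unitary_sols[OF iff K M])
qed

text \<open>W is unconstrained, and \<beta> keeps only its first component free.\<close>

lemma card_sols_Q8C2:
  "card (unitary_sols (gmul [0, 1, 4, 5, 8, 9, 12, 13, 2, 3, 6, 7, 10, 11, 14, 15] (4, 2, 3, 0, 0, 1, 2, 0)) :: 'f list set) =
    (4) * (CARD('f)) * (CARD('f) ^ 4 * CARD('f) ^ 4)"
proof -
  let ?\<Phi> = "\<lambda>(P :: 'f quadruple) (\<beta> :: 'f quadruple). (e1 P = 0 \<and> e2 P = 0 \<and> e3 P = 0) \<and> (case P of (A, B, C, D) \<Rightarrow> fst (snd \<beta>) + (A * B + C * D) = 0 \<and> fst (snd (snd \<beta>)) + (A * C + B * D) = 0 \<and> snd (snd (snd \<beta>)) + (A * D + B * C) = 0)"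
    and ?\<Psi> = "\<lambda>(A, B, C, D) (p, q, r, s) (x :: 'f quadruple). True"
  have iff: "ulist P \<alpha> Z W \<in> unitary_sols (gmul [0, 1, 4, 5, 8, 9, 12, 13, 2, 3, 6, 7, 10, 11, 14, 15] (4, 2, 3, 0, 0, 1, 2, 0)) \<longleftrightarrow>
      aug P = 1 \<and> ?\<Phi> P (conv P \<alpha>) \<and> ?\<Psi> P \<alpha> (conv P W)"
    for P \<alpha> Z W :: "'f quadruple"
  proof -
    obtain A B C D p q r s Y0 Y1 Y2 Y3 X0 X1 X2 X3
      where v: "P = (A, B, C, D)" "\<alpha> = (p, q, r, s)" "Z = (Y0, Y1, Y2, Y3)" "W = (X0, X1, X2, X3)"
      by (metis surj_pair)
    define e1' where "e1' = A * B + C * D"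
    define e2' where "e2' = A * D + B * C"
    define e3' where "e3' = A * C + B * D"
    define g1 where "g1 = (A * q + B * p + C * s + D * r) + (A * B + C * D)"
    define g2 where "g2 = (A * r + C * p + B * s + D * q) + (A * C + B * D)"
    define g3 where "g3 = (A * s + D * p + B * r + C * q) + (A * D + B * C)"
    show ?thesis
    proof (cases "aug P = 1")
      case True
      then have s: "aug (conv P \<alpha>) = p + q + r + s"
        by (simp only: aug_conv) (simp add: v)
      have "?\<Phi> P (conv P \<alpha>) \<and> ?\<Psi> P \<alpha> (conv P W) \<longleftrightarrow> e1' = 0 \<and> e2' = 0 \<and> e3' = 0 \<and> g1 = 0 \<and> g2 = 0 \<and> g3 = 0"
        unfolding s unfolding v by (simp add: e1'_def e2'_def e3'_def g1_def g2_def g3_def)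
      also have "\<dots> \<longleftrightarrow> ulist P \<alpha> Z W \<in> unitary_sols (gmul [0, 1, 4, 5, 8, 9, 12, 13, 2, 3, 6, 7, 10, 11, 14, 15] (4, 2, 3, 0, 0, 1, 2, 0))"
        using True unfolding unitary_sols_iff v quads_Q8C2[OF e1'_def e2'_def e3'_def g1_def g2_def g3_def] by auto
      finally show ?thesis using True by blast
    qed (simp add: unitary_sols_iff)
  qed
  have "card {\<beta> :: 'f quadruple. case P of (A, B, C, D) \<Rightarrow> fst (snd \<beta>) + (A * B + C * D) = 0 \<and> fst (snd (snd \<beta>)) + (A * C + B * D) = 0 \<and> snd (snd (snd \<beta>)) + (A * D + B * C) = 0} = CARD('f)" for P :: "'f quadruple"
    by (cases P) (simp only: prod.case card_quadruple_123)
  then have "card {(P :: 'f quadruple, \<beta> :: 'f quadruple). (aug P = 1 \<and> e1 P = 0 \<and> e2 P = 0 \<and> e3 P = 0) \<and> (case P of (A, B, C, D) \<Rightarrow> fst (snd \<beta>) + (A * B + C * D) = 0 \<and> fst (snd (snd \<beta>)) + (A * C + B * D) = 0 \<and> snd (snd (snd \<beta>)) + (A * D + B * C) = 0)} = (4) * (CARD('f))"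
    by (subst card_layer) (simp_all only: card_e123)
  then have K: "card {(P, \<beta>). aug P = 1 \<and> ?\<Phi> P \<beta>} = (4) * (CARD('f))"
    by (simp only: conj_assoc)
  have M: "card {x. ?\<Psi> P \<alpha> x} = CARD('f) ^ 4" for P \<alpha> :: "'f quadruple"
    by (cases P; cases \<alpha>) (simp only: prod.case card_quadruple)
  show ?thesis by (rule card_unitary_sols[OF iff K M])
qed

text \<open>P and \<beta> are coupled by a single equation between \<open>e1 P\<close> and the
  second component of \<beta>. Counting \<beta> before P turns it into a level set of
  \<open>e1\<close>, whose size is the same for every value.\<close>

lemma card_sols_D8YC4:
  "card (unitary_sols (gmul [0, 1, 5, 6, 8, 9, 13, 14, 2, 3, 7, 4, 10, 11, 15, 12] (4, 2, 3, 0, 2, 1, 0, 0)) :: 'f list set) =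
    CARD('f) ^ 3 * (CARD('f) ^ 4 * CARD('f) ^ 4)"
proof -
  let ?\<Phi> = "\<lambda>(P :: 'f quadruple) (\<beta> :: 'f quadruple). (aug \<beta>) ^ 2 + fst \<beta> = 0 \<and> fst (snd \<beta>) + e1 P = 0 \<and> fst (snd (snd \<beta>)) + (0) = 0 \<and> snd (snd (snd \<beta>)) + (0) = 0"
    and ?\<Psi> = "\<lambda>(A, B, C, D) (p, q, r, s) (x :: 'f quadruple). True"
  have iff: "ulist P \<alpha> Z W \<in> unitary_sols (gmul [0, 1, 5, 6, 8, 9, 13, 14, 2, 3, 7, 4, 10, 11, 15, 12] (4, 2, 3, 0, 2, 1, 0, 0)) \<longleftrightarrow>
      aug P = 1 \<and> ?\<Phi> P (conv P \<alpha>) \<and> ?\<Psi> P \<alpha> (conv P W)"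
    for P \<alpha> Z W :: "'f quadruple"
  proof -
    obtain A B C D p q r s Y0 Y1 Y2 Y3 X0 X1 X2 X3
      where v: "P = (A, B, C, D)" "\<alpha> = (p, q, r, s)" "Z = (Y0, Y1, Y2, Y3)" "W = (X0, X1, X2, X3)"
      by (metis surj_pair)
    define e1' where "e1' = A * B + C * D"
    define f1 where "f1 = (p + q + r + s) ^ 2 + (A * p + B * q + C * r + D * s)"
    define g1 where "g1 = (A * q + B * p + C * s + D * r) + (A * B + C * D)"
    define g2 where "g2 = (A * r + C * p + B * s + D * q)"
    define g3 where "g3 = (A * s + D * p + B * r + C * q)"
    show ?thesis
    proof (cases "aug P = 1")
      case True
      then have s: "aug (conv P \<alpha>) = p + q + r + s"
        by (simp only: aug_conv) (simp add: v)
      have "?\<Phi> P (conv P \<alpha>) \<and> ?\<Psi> P \<alpha> (conv P W) \<longleftrightarrow> f1 = 0 \<and> g1 = 0 \<and> g2 = 0 \<and> g3 = 0"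
        unfolding s unfolding v by (simp add: e1'_def f1_def g1_def g2_def g3_def)
      also have "\<dots> \<longleftrightarrow> ulist P \<alpha> Z W \<in> unitary_sols (gmul [0, 1, 5, 6, 8, 9, 13, 14, 2, 3, 7, 4, 10, 11, 15, 12] (4, 2, 3, 0, 2, 1, 0, 0))"
        using True unfolding unitary_sols_iff v quads_D8YC4[OF e1'_def f1_def g1_def g2_def g3_def] by auto
      finally show ?thesis using True by blast
    qed (simp add: unitary_sols_iff)
  qed
  let ?A = "\<lambda>\<beta> :: 'f quadruple. (aug \<beta>) ^ 2 + fst \<beta> = 0 \<and> fst (snd (snd \<beta>)) + 0 = 0 \<and> snd (snd (snd \<beta>)) + 0 = 0"
  have "card {(P, \<beta>). aug P = 1 \<and> ?\<Phi> P \<beta>} = card {(\<beta>, P). ?A \<beta> \<and> (aug P = 1 \<and> e1 P = fst (snd \<beta>))}"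
    by (rule bij_betw_same_card, rule bij_betw_byWitness[where f = prod.swap and f' = prod.swap]) auto
  also have "\<dots> = CARD('f) * CARD('f) ^ 2"
    by (subst card_layer) (simp_all only: card_e1_eq card_aug_23)
  finally have K: "card {(P, \<beta>). aug P = 1 \<and> ?\<Phi> P \<beta>} = CARD('f) ^ 3"
    by (simp add: power3_eq_cube power2_eq_square)
  have M: "card {x. ?\<Psi> P \<alpha> x} = CARD('f) ^ 4" for P \<alpha> :: "'f quadruple"
    by (cases P; cases \<alpha>) (simp only: prod.case card_quadruple)
  show ?thesis by (rule card_unitary_sols[OF iff K M])
qed

end

section \<open>Change of generators\<close>

fun pc_pow :: "pc_param \<Rightarrow> nat \<Rightarrow> nat \<Rightarrow> nat" where
  "pc_pow P a 0 = 0"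
| "pc_pow P a (Suc n) = tmul P (pc_pow P a n) a"

fun pc_word :: "pc_param \<Rightarrow> nat \<times> nat \<times> nat \<Rightarrow> nat \<times> nat \<times> nat \<Rightarrow> nat" where
  "pc_word P (a, c, d) (i, j, l) = tmul P (tmul P (pc_pow P a i) (pc_pow P c j)) (pc_pow P d l)"

text \<open>The last argument contains the exponents that express the old generators in the new ones.\<close>

fun pc_check :: "pc_param \<Rightarrow> pc_param \<Rightarrow> nat \<times> nat \<times> nat \<Rightarrow>
    (nat \<times> nat \<times> nat) \<times> (nat \<times> nat \<times> nat) \<times> (nat \<times> nat \<times> nat) \<Rightarrow> bool" where
  "pc_check P (m, k, p, q, r, s, t, u) (a, c, d) (ex, ey, eb) \<longleftrightarrow>
    m * k = 8 \<and> a < 16 \<and> c < 16 \<and> d < 16 \<and>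
    pc_pow P a m = 0 \<and> pc_pow P c k = 0 \<and> tmul P c a = tmul P a c \<and>
    tmul P d a = tmul P (tmul P (pc_pow P a p) (pc_pow P c q)) d \<and>
    tmul P d c = tmul P (tmul P (pc_pow P a r) (pc_pow P c s)) d \<and>
    tmul P d d = tmul P (pc_pow P a t) (pc_pow P c u) \<and>
    (fst P = 4 \<or> fst P = 8) \<and> pc_word P (a, c, d) ex = 1 \<and>
    pc_word P (a, c, d) ey = fst P mod 8 \<and> pc_word P (a, c, d) eb = 8"

context group
begin

lemma pc_elem_mult':
  assumes "pc_rels G P x y b" "i < 16" "j < 16"
  shows "pc_elem G P x y b i \<otimes> pc_elem G P x y b j = pc_elem G P x y b (tmul P i j)"
    "tmul P i j < 16"
proof -
  obtain m k p q r s t u where P: "P = (m, k, p, q, r, s, t, u)"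
    by (cases P rule: prod_cases7) (metis surj_pair)
  show "pc_elem G P x y b i \<otimes> pc_elem G P x y b j = pc_elem G P x y b (tmul P i j)"
    "tmul P i j < 16"
    using pc_elem_mult[of m k p q r s t u x y b] tmul_less[of m k p q r s t u x y b] assms
    unfolding P by blast+
qed

lemma pc_elem_closed': "pc_rels G P x y b \<Longrightarrow> pc_elem G P x y b n \<in> carrier G"
  using pc_rels_closed[of G P x y b] by (simp add: pc_elem_def)

lemma pc_elem_pow:
  assumes "pc_rels G P x y b" "a < 16"
  shows "pc_elem G P x y b a [^] (n :: nat) = pc_elem G P x y b (pc_pow P a n) \<and> pc_pow P a n < 16"
proof (induction n)
  case 0
  then show ?case by (simp add: pc_elem_def)
next
  case (Suc n)
  then show ?case
    using assms pc_elem_mult'[OF assms(1), of "pc_pow P a n" a] by simp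
qed

text \<open>The relations for the new generators are identities between numbers under
  \<open>tmul P\<close>, hence hold in every group with parameters \<open>P\<close>. The exponents
  \<open>es\<close> show that the old generators are words in the new ones.\<close>

lemma pc_change:
  assumes "pc_gen G P x y b" "pc_check P Q n es"
  shows "\<exists>x y b. pc_gen G Q x y b"
proof -
  obtain m k p q r s t u where Q: "Q = (m, k, p, q, r, s, t, u)"
    by (cases Q rule: prod_cases7) (metis surj_pair)
  obtain a c d where n: "n = (a, c, d)" by (cases n)
  obtain i1 j1 l1 i2 j2 l2 i3 j3 l3 where es: "es = ((i1, j1, l1), (i2, j2, l2), (i3, j3, l3))"
    by (metis surj_pair)
  define w where "w = (\<lambda>i j l. tmul P (tmul P (pc_pow P a i) (pc_pow P c j)) (pc_pow P d l))"
  define E where "E = pc_elem G P x y b"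
  have rels: "pc_rels G P x y b" and gen: "carrier G \<subseteq> generate G {x, y, b}"
    using assms(1) by (auto simp: pc_gen_def)
  have c: "m * k = 8" "a < 16" "c < 16" "d < 16"
    "pc_pow P a m = 0" "pc_pow P c k = 0" "tmul P c a = tmul P a c"
    "tmul P d a = tmul P (tmul P (pc_pow P a p) (pc_pow P c q)) d"
    "tmul P d c = tmul P (tmul P (pc_pow P a r) (pc_pow P c s)) d"
    "tmul P d d = tmul P (pc_pow P a t) (pc_pow P c u)"
    and m: "fst P = 4 \<or> fst P = 8"
    and w: "w i1 j1 l1 = 1" "w i2 j2 l2 = fst P mod 8" "w i3 j3 l3 = 8"
    using assms(2) unfolding Q n es pc_check.simps pc_word.simps w_def by blast+
  have mult: "E (tmul P i j) = E i \<otimes> E j" "tmul P i j < 16" if "i < 16" "j < 16" for i j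
    using pc_elem_mult'[OF rels that] by (simp_all add: E_def)
  have pow: "E (pc_pow P i e) = E i [^] e" "pc_pow P i e < 16" if "i < 16" for i e
    using pc_elem_pow[OF rels that] by (simp_all add: E_def)
  have E0: "E 0 = \<one>" by (simp add: E_def pc_elem_def)
  have Ec: "E i \<in> carrier G" for i
    using pc_elem_closed'[OF rels] by (simp add: E_def)
  have E3: "E (tmul P (tmul P (pc_pow P a i) (pc_pow P c j)) (pc_pow P d l)) =
      E a [^] i \<otimes> E c [^] j \<otimes> E d [^] l" for i j l
    by (simp add: mult pow c(2-4))
  have E2: "E (tmul P (tmul P (pc_pow P a i) (pc_pow P c j)) d) =
      E a [^] i \<otimes> E c [^] j \<otimes> E d" for i j
    by (simp add: mult pow c(2-4))
  have E1: "E (tmul P (pc_pow P a i) (pc_pow P c j)) = E a [^] i \<otimes> E c [^] j" for i j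
    by (simp add: mult pow c(2-4))
  have "pc_rels G Q (E a) (E c) (E d)"
    unfolding Q pc_rels.simps
  proof (intro conjI)
    show "E a [^] m = \<one>" "E c [^] k = \<one>"
      using c(5,6) E0 pow(1)[OF c(2), of m] pow(1)[OF c(3), of k] by simp_all
    show "E c \<otimes> E a = E a \<otimes> E c"
      using mult(1)[OF c(3,2)] mult(1)[OF c(2,3)] c(7) by simp
    show "E d \<otimes> E a = E a [^] p \<otimes> E c [^] q \<otimes> E d"
      using mult(1)[OF c(4,2)] E2 c(8) by simp
    show "E d \<otimes> E c = E a [^] r \<otimes> E c [^] s \<otimes> E d"
      using mult(1)[OF c(4,3)] E2 c(9) by simp
    show "E d \<otimes> E d = E a [^] t \<otimes> E c [^] u"
      using mult(1)[OF c(4,4)] E1 c(10) by simp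
  qed (use c(1) Ec in auto)
  moreover have "carrier G \<subseteq> generate G {E a, E c, E d}"
  proof -
    have xyb: "x \<in> carrier G" "y \<in> carrier G" "b \<in> carrier G"
      using pc_rels_closed[OF rels] by auto
    obtain m' k' p' q' r' s' t' u' where P: "P = (m', k', p', q', r', s', t', u')"
      by (cases P rule: prod_cases7) (metis surj_pair)
    have k: "m' * k' = 8" "y [^] k' = \<one>"
      using pc_relsD(1,3)[OF rels[unfolded P]] by simp_all
    \<comment> \<open>The number \<open>fst P mod 8\<close> is that of y: 4 if x has exponent 4, and
      0, the identity, if the second factor is trivial.\<close>
    have xyb': "E 1 = x \<and> E (fst P mod 8) = y \<and> E 8 = b"
    proof (cases "m' = 4")
      case True
      then have "k' = 2" using k(1) by simp
      then show ?thesis using xyb unfolding E_def pc_elem_def P True fst_conv snd_conv by simp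
    next
      case False
      then have "m' = 8" using m by (simp add: P)
      moreover from this have "k' = 1" using k(1) by simp
      moreover from this have "y = \<one>" using k(2) xyb by (simp add: nat_pow_eone)
      ultimately show ?thesis using xyb unfolding E_def pc_elem_def P fst_conv snd_conv by simp
    qed
    have S: "{E a, E c, E d} \<subseteq> carrier G" using Ec by auto
    then interpret S: subgroup "generate G {E a, E c, E d}" G
      by (rule generate_is_subgroup)
    have "h [^] j \<in> generate G {E a, E c, E d}" if "h \<in> {E a, E c, E d}" for h and j :: nat
      using that by (induction j) (auto intro: generate.incl)
    then have g: "E (w i j l) \<in> generate G {E a, E c, E d}" for i j l
      unfolding w_def E3 by simp
    have "{x, y, b} \<subseteq> generate G {E a, E c, E d}"
      using g[of i1 j1 l1] g[of i2 j2 l2] g[of i3 j3 l3] xyb' unfolding w by simp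
    then show ?thesis using gen generate_subsetI[OF _ S] by blast
  qed
  ultimately show ?thesis by (auto simp: pc_gen_def)
qed

lemma card_two_torsion_pc:
  assumes "pc_gen G P x y b" "order G = 16"
  shows "card (two_torsion G) = length (filter (\<lambda>n. tmul P n n = 0) [0..<16])"
proof -
  let ?E = "pc_elem G P x y b"
  have rels: "pc_rels G P x y b" using assms(1) by (simp add: pc_gen_def)
  have bij: "bij_betw ?E {..<16} (carrier G)" by (rule pc_gen_bij[OF assms])
  then have inj: "inj_on ?E {..<16}" and img: "?E ` {..<16} = carrier G"
    by (auto simp: bij_betw_def)
  have E0: "?E 0 = \<one>" by (simp add: pc_elem_def)
  have "?E n [^] (2 :: nat) = \<one> \<longleftrightarrow> tmul P n n = 0" if n: "n < 16" for n
  proof -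
    note m = pc_elem_mult'[OF rels n n]
    have "?E n [^] (2 :: nat) = ?E n \<otimes> ?E n"
      using pc_elem_closed'[OF rels] by (simp add: numeral_2_eq_2)
    then have "?E n [^] (2 :: nat) = \<one> \<longleftrightarrow> ?E (tmul P n n) = ?E 0"
      unfolding m(1) E0 by simp
    also have "\<dots> \<longleftrightarrow> tmul P n n = 0"
      using inj_on_eq_iff[OF inj, of "tmul P n n" 0] m(2) by simp
    finally show ?thesis .
  qed
  then have "two_torsion G = ?E ` {n \<in> {..<16}. tmul P n n = 0}"
    unfolding two_torsion_def img[symmetric] by auto
  moreover have "inj_on ?E {n \<in> {..<16}. tmul P n n = 0}"
    by (rule inj_on_subset[OF inj]) auto
  ultimately have "card (two_torsion G) = card {n \<in> {..<16}. tmul P n n = 0}"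
    by (simp add: card_image)
  also have "{n \<in> {..<16}. tmul P n n = 0} = set (filter (\<lambda>n. tmul P n n = 0) [0..<16])"
    by auto
  also have "card \<dots> = length (filter (\<lambda>n. tmul P n n = 0) [0..<16])"
    by (rule distinct_card) simp
  finally show ?thesis .
qed

end

text \<open>Renumbering changes only the order of the coefficients; \<open>\<sigma> ! 0 = 0\<close>
  keeps the identity at index 0.\<close>

lemma (in char2) card_unitary_units_pc:
  fixes G :: "('g, 'm) monoid_scheme"
  assumes "group G" "pc_gen G P x y b" "order G = 16"
    and \<sigma>: "length \<sigma> = 16" "distinct \<sigma>" "set \<sigma> = {..<16}" "\<sigma> ! 0 = 0"
  shows "card (unitary_units G :: ('g \<Rightarrow> 'f) set) = card (unitary_sols (gmul \<sigma> P) :: 'f list set)"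
proof (rule card_unitary_units)
  interpret group G by fact
  let ?E = "pc_elem G P x y b"
  have rels: "pc_rels G P x y b" using assms(2) by (simp add: pc_gen_def)
  show "bij_betw (\<lambda>i. ?E (\<sigma> ! i)) {..<16} (carrier G)"
  proof -
    have "bij_betw ((!) \<sigma>) {..<16} {..<16}"
      using \<sigma>(1,3) by (intro bij_betw_nth[OF \<sigma>(2)]) simp_all
    from bij_betw_trans[OF this pc_gen_bij[OF assms(2,3)]] show ?thesis
      unfolding comp_def .
  qed
  show "?E (\<sigma> ! 0) = \<one>\<^bsub>G\<^esub>" unfolding \<sigma>(4) pc_elem_def by simp
  fix i j :: nat assume ij: "i < 16" "j < 16"
  then have "\<sigma> ! i \<in> set \<sigma>" "\<sigma> ! j \<in> set \<sigma>" using \<sigma>(1) by simp_all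
  then have "\<sigma> ! i < 16" "\<sigma> ! j < 16" unfolding \<sigma>(3) by simp_all
  note m = pc_elem_mult'[OF rels this]
  let ?n = "tmul P (\<sigma> ! i) (\<sigma> ! j)"
  have "length (takeWhile (\<lambda>m. m \<noteq> n) xs) < length xs" if "n \<in> set xs" for n :: nat and xs
    using that by (induction xs) auto
  then have l: "length (takeWhile (\<lambda>m. m \<noteq> ?n) \<sigma>) < length \<sigma>"
    using m(2) \<sigma>(3) by simp
  then have "\<sigma> ! gmul \<sigma> P i j = ?n"
    using nth_length_takeWhile[OF l] by (simp add: gmul_def)
  then show "?E (\<sigma> ! i) \<otimes>\<^bsub>G\<^esub> ?E (\<sigma> ! j) = ?E (\<sigma> ! gmul \<sigma> P i j) \<and> gmul \<sigma> P i j < 16"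
    using m(1) l \<sigma>(1) by (simp add: gmul_def)
qed (rule \<open>group G\<close>)

section \<open>Translating relators into polycyclic relations\<close>

lemma words_gen [simp]: "a \<in> S \<Longrightarrow> gen a \<in> words S"
  and words_Nil [simp]: "[] \<in> words S"
  by (simp_all add: words_def gen_def)

lemma words_wpow [simp]: "w \<in> words S \<Longrightarrow> wpow w n \<in> words S"
  by (induction n) (auto simp: wpow_def words_append)

lemma words_wcomm [simp]: "u \<in> words S \<Longrightarrow> v \<in> words S \<Longrightarrow> wcomm u v \<in> words S"
  by (simp add: wcomm_def words_append words_winv)

context group
begin

context
  fixes \<phi> :: "'x \<Rightarrow> 'a" and S
  assumes \<phi>: "\<phi> ` S \<subseteq> carrier G"
begin

lemma word_eval_gen: "a \<in> S \<Longrightarrow> word_eval \<phi> (gen a) = \<phi> a"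
  using \<phi> by (auto simp: gen_def)

lemma word_eval_wpow: "w \<in> words S \<Longrightarrow> word_eval \<phi> (wpow w n) = word_eval \<phi> w [^] n"
proof (induction n)
  case (Suc n)
  have "wpow w (Suc n) = w @ wpow w n" by (simp add: wpow_def)
  then show ?case
    using Suc word_eval_closed[OF \<phi>, of w]
    by (simp only: word_eval_append[OF \<phi>] words_wpow nat_pow_Suc2)
qed (simp add: wpow_def)

lemma word_eval_winv:
  assumes "w \<in> words S"
  shows "word_eval \<phi> (winv w) = inv (word_eval \<phi> w)"
proof -
  have "word_eval \<phi> (winv w @ w) = word_eval \<phi> []"
    using word_eval_word_eq[OF \<phi> word_eq_winv[OF assms, of "{}"]] by simp
  then have "word_eval \<phi> (winv w) \<otimes> word_eval \<phi> w = \<one>"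
    using assms by (simp add: word_eval_append[OF \<phi>] words_winv)
  then show ?thesis
    using assms inv_equality word_eval_closed[OF \<phi>] words_winv by metis
qed

lemma word_eval_wcomm:
  assumes w: "u \<in> words S" "v \<in> words S"
  shows "word_eval \<phi> (wcomm u v) =
    inv (word_eval \<phi> u) \<otimes> (inv (word_eval \<phi> v) \<otimes> (word_eval \<phi> u \<otimes> word_eval \<phi> v))"
  using w by (simp add: wcomm_def word_eval_append[OF \<phi>] word_eval_winv words_winv words_append)

lemma word_eval_conj_iff:
  assumes w: "u \<in> words S" "v \<in> words S"
  shows "word_eval \<phi> (winv v @ u @ v) = word_eval \<phi> (winv u) \<longleftrightarrow>
    word_eval \<phi> u \<otimes> word_eval \<phi> v = word_eval \<phi> v \<otimes> inv (word_eval \<phi> u)"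
proof -
  note c = word_eval_closed[OF \<phi>]
  have "word_eval \<phi> (winv v @ u @ v) = inv (word_eval \<phi> v) \<otimes> (word_eval \<phi> u \<otimes> word_eval \<phi> v)"
    using w by (simp add: word_eval_append[OF \<phi>] word_eval_winv words_winv words_append)
  then show ?thesis
    using c[OF w(1)] c[OF w(2)] inv_solve_left' m_closed inv_closed word_eval_winv[OF w(1)] by metis
qed

lemmas word_evals = word_eval_gen word_eval_wpow word_eval_wcomm word_eval_conj_iff

end

lemma comm_eq_iff:
  assumes "a \<in> carrier G" "b \<in> carrier G" "c \<in> carrier G"
  shows "inv a \<otimes> (inv b \<otimes> (a \<otimes> b)) = c \<longleftrightarrow> a \<otimes> b = b \<otimes> (a \<otimes> c)"
  using assms inv_solve_left' m_closed inv_closed by metis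

lemma pow_swap:
  assumes "a \<in> carrier G" "b \<in> carrier G" "c \<in> carrier G" "a \<otimes> b = b \<otimes> c"
  shows "a [^] (n :: nat) \<otimes> b = b \<otimes> c [^] n"
proof (induction n)
  case (Suc n)
  have "a [^] Suc n \<otimes> b = a [^] n \<otimes> (a \<otimes> b)"
    using assms(1-3) by (simp add: m_assoc)
  also have "\<dots> = a [^] n \<otimes> b \<otimes> c"
    using assms by (simp add: m_assoc)
  also have "\<dots> = b \<otimes> c [^] Suc n"
    using assms(1-3) by (simp add: Suc m_assoc)
  finally show ?case .
qed (use assms in simp)

text \<open>Presentations say what conjugation by b does to a from one side, polycyclic relations
  from the other. The two exponents are inverse to each other modulo the order; 3, 5 and 7 modulo 8
  and 3 modulo 4 are their own inverses.\<close>

lemma twist_iff: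
  assumes ab: "a \<in> carrier G" "b \<in> carrier G" and m: "a [^] (m :: nat) = \<one>" "p * p' mod m = 1"
  shows "a \<otimes> b = b \<otimes> a [^] p \<longleftrightarrow> b \<otimes> a = a [^] p' \<otimes> b"
proof -
  have 1: "a [^] (p * p') = a" "a [^] (p' * p) = a"
    using pow_mod_eq[OF ab(1) m(1), of "p * p'"] m(2) ab by (simp_all add: mult.commute)
  show ?thesis
  proof
    assume "a \<otimes> b = b \<otimes> a [^] p"
    from pow_swap[OF ab nat_pow_closed[OF ab(1)] this, of p']
    show "b \<otimes> a = a [^] p' \<otimes> b" using 1 ab by (simp add: nat_pow_pow)
  next
    assume "b \<otimes> a = a [^] p' \<otimes> b"
    from pow_swap[OF nat_pow_closed[OF ab(1)] ab(2,1) this[symmetric], of p]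
    show "a \<otimes> b = b \<otimes> a [^] p" using 1 ab by (simp add: nat_pow_pow)
  qed
qed

lemma pow_pred_eq_inv:
  assumes "a \<in> carrier G" "a [^] Suc m = \<one>"
  shows "a [^] m = inv a"
  using assms inv_equality[of "a [^] m" a] by simp

lemma pc_rels_cyclic:
  "pc_rels G (8, 1, p, 0, 0, 0, t, 0) a y b \<longleftrightarrow>
    {a, b} \<subseteq> carrier G \<and> y = \<one> \<and> a [^] (8::nat) = \<one> \<and> b \<otimes> a = a [^] p \<otimes> b \<and> b \<otimes> b = a [^] t"
  unfolding pc_rels.simps by (auto simp: nat_pow_eone)

end

text \<open>The two generators of the presentation serve directly as x and b, with y = 1, so only
  the relations have to be compared.\<close>

lemma iso_cyclic_presentation:
  fixes G :: "('g, 'm) monoid_scheme" and R :: "(nat word \<times> nat word) set"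
  assumes G: "group G" "order G = 16" and R: "R \<subseteq> words {0, 1} \<times> words {0, 1}"
    and 1: "\<And>\<phi>. \<phi> ` {0, 1} \<subseteq> carrier (presented_group {0, 1} R) \<Longrightarrow> word_sat (presented_group {0, 1} R) \<phi> R \<Longrightarrow>
      pc_rels (presented_group {0, 1} R) (8, 1, p, 0, 0, 0, t, 0) (\<phi> 0) \<one>\<^bsub>presented_group {0, 1} R\<^esub> (\<phi> 1)"
    and 2: "\<And>\<phi>. \<phi> ` {0, 1} \<subseteq> carrier G \<Longrightarrow>
      pc_rels G (8, 1, p, 0, 0, 0, t, 0) (\<phi> 0) \<one>\<^bsub>G\<^esub> (\<phi> 1) \<Longrightarrow> word_sat G \<phi> R"
  shows "G \<cong> presented_group {0, 1} R \<longleftrightarrow> (\<exists>x y b. pc_gen G (8, 1, p, 0, 0, 0, t, 0) x y b)"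
proof (rule presented_iso_iff[OF G R])
  fix \<phi> :: "nat \<Rightarrow> _" let ?Q = "presented_group {0, 1} R"
  assume \<phi>: "\<phi> ` {0, 1} \<subseteq> carrier ?Q" "word_sat ?Q \<phi> R"
  have "\<phi> ` {0, 1} \<subseteq> generate ?Q {\<phi> 0, \<one>\<^bsub>?Q\<^esub>, \<phi> 1}"
    by (auto intro: generate.incl)
  then show "\<exists>x y b. pc_rels ?Q (8, 1, p, 0, 0, 0, t, 0) x y b \<and> \<phi> ` {0, 1} \<subseteq> generate ?Q {x, y, b}"
    using 1[OF \<phi>] by blast
next
  fix x y b assume rels: "pc_rels G (8, 1, p, 0, 0, 0, t, 0) x y b"
  then have y: "y = \<one>\<^bsub>G\<^esub>" and c: "x \<in> carrier G" "b \<in> carrier G"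
    using group.pc_rels_cyclic[OF G(1)] by auto
  define \<phi> where "\<phi> = (\<lambda>i :: nat. if i = 0 then x else b)"
  have "\<phi> ` {0, 1} \<subseteq> carrier G" using c by (simp add: \<phi>_def)
  moreover from this have "word_sat G \<phi> R" using 2[of \<phi>] rels y by (simp add: \<phi>_def)
  moreover have "{x, y, b} \<subseteq> generate G (\<phi> ` {0, 1})"
    unfolding y by (auto simp: \<phi>_def intro: generate.incl generate.one)
  ultimately show "\<exists>\<phi>. \<phi> ` {0, 1} \<subseteq> carrier G \<and> word_sat G \<phi> R \<and> {x, y, b} \<subseteq> generate G (\<phi> ` {0, 1})"
    by blast
qed

lemma (in group) square_eq: "b \<in> carrier G \<Longrightarrow> b [^] (2::nat) = b \<otimes> b"
  by (simp add: numeral_2_eq_2)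


section \<open>The seven presentations without a direct factor of order two\<close>

lemma M16_iso_iff:
  fixes G :: "('g, 'm) monoid_scheme"
  assumes G: "group G" "order G = 16"
  shows "G \<cong> M16 \<longleftrightarrow> (\<exists>x y b. pc_gen G (8, 1, 5, 0, 0, 0, 0, 0) x y b)"
proof -
  define R :: "(nat word \<times> nat word) set" where
    "R = {(wpow (gen 0) 8, []), (wpow (gen 1) 2, []), (wcomm (gen 0) (gen 1), wpow (gen 0) 4)}"
  have M: "M16 = presented_group {0, 1} R"
    by (simp add: M16_def R_def Let_def)
  \<comment> \<open>An arbitrary group \<open>H\<close>, because the equivalence is applied to the
    presented group as well as to \<open>G\<close>.\<close>
  have *: "word_sat H \<phi> R \<longleftrightarrow> pc_rels H (8, 1, 5, 0, 0, 0, 0, 0) (\<phi> 0) \<one> (\<phi> 1)"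
    if H: "group H" and \<phi>: "\<phi> ` {0, 1} \<subseteq> carrier H"
    for H :: "('x, 'y) monoid_scheme" (structure) and \<phi>
  proof -
    interpret group H by fact
    have c: "\<phi> 0 \<in> carrier H" "\<phi> 1 \<in> carrier H" using \<phi> by auto
    have e: "\<phi> 0 \<otimes> \<phi> 0 [^] (4::nat) = \<phi> 0 [^] (5::nat)"
      using nat_pow_Suc2[OF c(1), of 4] by simp
    show ?thesis
      unfolding word_sat_def R_def pc_rels_cyclic
      using c twist_iff[OF c, of 8 5 5]
      by (auto simp: word_evals[OF \<phi>] comm_eq_iff square_eq[of "\<phi> (Suc 0)"] e)
  qed
  show ?thesis
    unfolding M by (rule iso_cyclic_presentation[OF G])
      (use * group_presented_group G in \<open>auto simp: R_def words_append words_winv\<close>)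
qed

lemma D16_minus_iso_iff:
  fixes G :: "('g, 'm) monoid_scheme"
  assumes G: "group G" "order G = 16"
  shows "G \<cong> D16_minus \<longleftrightarrow> (\<exists>x y b. pc_gen G (8, 1, 3, 0, 0, 0, 0, 0) x y b)"
proof -
  define R :: "(nat word \<times> nat word) set" where
    "R = {(wpow (gen 0) 8, []), (wpow (gen 1) 2, []), (wcomm (gen 0) (gen 1), wpow (gen 0) 2)}"
  have M: "D16_minus = presented_group {0, 1} R"
    by (simp add: D16_minus_def R_def Let_def)
  have *: "word_sat H \<phi> R \<longleftrightarrow> pc_rels H (8, 1, 3, 0, 0, 0, 0, 0) (\<phi> 0) \<one> (\<phi> 1)"
    if H: "group H" and \<phi>: "\<phi> ` {0, 1} \<subseteq> carrier H"
    for H :: "('x, 'y) monoid_scheme" (structure) and \<phi>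
  proof -
    interpret group H by fact
    have c: "\<phi> 0 \<in> carrier H" "\<phi> 1 \<in> carrier H" using \<phi> by auto
    have e: "\<phi> 0 \<otimes> \<phi> 0 [^] (2::nat) = \<phi> 0 [^] (3::nat)"
      using nat_pow_Suc2[OF c(1), of 2] by simp
    show ?thesis
      unfolding word_sat_def R_def pc_rels_cyclic
      using c twist_iff[OF c, of 8 3 3]
      by (auto simp: word_evals[OF \<phi>] comm_eq_iff square_eq[of "\<phi> (Suc 0)"] e)
  qed
  show ?thesis
    unfolding M by (rule iso_cyclic_presentation[OF G])
      (use * group_presented_group G in \<open>auto simp: R_def words_append words_winv\<close>)
qed

lemma dihedral_16_iso_iff:
  fixes G :: "('g, 'm) monoid_scheme"
  assumes G: "group G" "order G = 16"
  shows "G \<cong> dihedral_group 16 \<longleftrightarrow> (\<exists>x y b. pc_gen G (8, 1, 7, 0, 0, 0, 0, 0) x y b)"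
proof -
  define R :: "(nat word \<times> nat word) set" where
    "R = {(wpow (gen 0) 8, []), (wpow (gen 1) 2, []), (winv (gen 1) @ gen 0 @ gen 1, winv (gen 0))}"
  have M: "dihedral_group 16 = presented_group {0, 1} R"
    by (simp add: dihedral_group_def R_def Let_def)
  have *: "word_sat H \<phi> R \<longleftrightarrow> pc_rels H (8, 1, 7, 0, 0, 0, 0, 0) (\<phi> 0) \<one> (\<phi> 1)"
    if H: "group H" and \<phi>: "\<phi> ` {0, 1} \<subseteq> carrier H"
    for H :: "('x, 'y) monoid_scheme" (structure) and \<phi>
  proof -
    interpret group H by fact
    have c: "\<phi> 0 \<in> carrier H" "\<phi> 1 \<in> carrier H" using \<phi> by auto
    have e: "inv (\<phi> 0) = \<phi> 0 [^] (7::nat)" if "\<phi> 0 [^] (8::nat) = \<one>"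
      using pow_pred_eq_inv[OF c(1), of 7] that by simp
    show ?thesis
      unfolding word_sat_def R_def pc_rels_cyclic
      using c twist_iff[OF c, of 8 7 7] e
      by (auto simp: word_evals[OF \<phi>] square_eq[of "\<phi> (Suc 0)"])
  qed
  show ?thesis
    unfolding M by (rule iso_cyclic_presentation[OF G])
      (use * group_presented_group G in \<open>auto simp: R_def words_append words_winv\<close>)
qed

lemma quaternion_16_iso_iff:
  fixes G :: "('g, 'm) monoid_scheme"
  assumes G: "group G" "order G = 16"
  shows "G \<cong> quaternion_group 16 \<longleftrightarrow> (\<exists>x y b. pc_gen G (8, 1, 7, 0, 0, 0, 4, 0) x y b)"
proof -
  define R :: "(nat word \<times> nat word) set" where
    "R = {(wpow (gen 0) 8, []), (wpow (gen 1) 2, wpow (gen 0) 4), (winv (gen 1) @ gen 0 @ gen 1, winv (gen 0))}"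
  have M: "quaternion_group 16 = presented_group {0, 1} R"
    by (simp add: quaternion_group_def R_def Let_def)
  have *: "word_sat H \<phi> R \<longleftrightarrow> pc_rels H (8, 1, 7, 0, 0, 0, 4, 0) (\<phi> 0) \<one> (\<phi> 1)"
    if H: "group H" and \<phi>: "\<phi> ` {0, 1} \<subseteq> carrier H"
    for H :: "('x, 'y) monoid_scheme" (structure) and \<phi>
  proof -
    interpret group H by fact
    have c: "\<phi> 0 \<in> carrier H" "\<phi> 1 \<in> carrier H" using \<phi> by auto
    have e: "inv (\<phi> 0) = \<phi> 0 [^] (7::nat)" if "\<phi> 0 [^] (8::nat) = \<one>"
      using pow_pred_eq_inv[OF c(1), of 7] that by simp
    show ?thesis
      unfolding word_sat_def R_def pc_rels_cyclic
      using c twist_iff[OF c, of 8 7 7] e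
      by (auto simp: word_evals[OF \<phi>] square_eq[of "\<phi> (Suc 0)"])
  qed
  show ?thesis
    unfolding M by (rule iso_cyclic_presentation[OF G])
      (use * group_presented_group G in \<open>auto simp: R_def words_append words_winv\<close>)
qed

lemma (in group) pow_4_eq: "b \<in> carrier G \<Longrightarrow> b [^] (4::nat) = b \<otimes> (b \<otimes> (b \<otimes> b))"
  by (simp add: numeral_eq_Suc m_assoc)

text \<open>The second polycyclic generator is the square of b, so that \<langle>a,
  \<open>b^2\<close>\<rangle> becomes the abelian subgroup of order 8.\<close>

lemma C4_ltimes_C4_iso_iff:
  fixes G :: "('g, 'm) monoid_scheme"
  assumes G: "group G" "order G = 16"
  shows "G \<cong> C4_ltimes_C4 \<longleftrightarrow> (\<exists>x y b. pc_gen G (4, 2, 3, 0, 0, 1, 0, 1) x y b)"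
proof -
  define R :: "(nat word \<times> nat word) set" where
    "R = {(wpow (gen 0) 4, []), (wpow (gen 1) 4, []), (wcomm (gen 0) (gen 1), wpow (gen 0) 2)}"
  have M: "C4_ltimes_C4 = presented_group {0, 1} R"
    by (simp add: C4_ltimes_C4_def R_def Let_def)
  have fwd: "\<exists>x y b. pc_rels Q (4, 2, 3, 0, 0, 1, 0, 1) x y b \<and> \<phi> ` {0, 1} \<subseteq> generate Q {x, y, b}"
    if Q: "group Q" and \<phi>: "\<phi> ` {0, 1} \<subseteq> carrier Q" and sat: "word_sat Q \<phi> R"
    for Q :: "nat word set monoid" (structure) and \<phi>
  proof -
    interpret group Q by fact
    define a b where "a = \<phi> 0" and "b = \<phi> 1"
    have c [simp]: "a \<in> carrier Q" "b \<in> carrier Q" using \<phi> by (auto simp: a_def b_def)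

    have r: "a [^] (4::nat) = \<one>" "b [^] (4::nat) = \<one>" "a \<otimes> b = b \<otimes> (a \<otimes> a [^] (2::nat))"
      using sat c unfolding word_sat_def R_def
      by (simp_all add: word_evals[OF \<phi>] word_eval_simps(1) comm_eq_iff a_def b_def)
    have "a \<otimes> a [^] (2::nat) = a [^] (3::nat)" using nat_pow_Suc2[OF c(1), of 2] by simp
    then have r3: "a \<otimes> b = b \<otimes> a [^] (3::nat)" using r(3) by simp
    then have s: "b \<otimes> a = a [^] (3::nat) \<otimes> b"
      using twist_iff[OF c r(1), of 3 3] by simp
    \<comment> \<open>Conjugation by b inverts a, so conjugation by its square fixes a.\<close>
    have "b \<otimes> b \<otimes> a = b \<otimes> (b \<otimes> a)" by (simp only: m_assoc c)
    also have "\<dots> = b \<otimes> a [^] (3::nat) \<otimes> b" unfolding s by (simp only: m_assoc c nat_pow_closed)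
    also have "\<dots> = a \<otimes> (b \<otimes> b)" unfolding r3[symmetric] by (simp only: m_assoc c)
    finally have t: "b \<otimes> b \<otimes> a = a \<otimes> (b \<otimes> b)" .
    have "(b \<otimes> b) [^] (2::nat) = \<one>"
      using r(2) by (simp add: square_eq pow_4_eq m_assoc)
    then have rels: "pc_rels Q (4, 2, 3, 0, 0, 1, 0, 1) a (b \<otimes> b) b"
      unfolding pc_rels.simps using r(1) s t by (simp add: nat_pow_eone m_assoc)
    have gens: "\<phi> ` {0, 1} \<subseteq> generate Q {a, b \<otimes> b, b}"
      by (auto simp: a_def b_def intro: generate.incl)
    show ?thesis using rels gens by blast
  qed
  show ?thesis
    unfolding M
  proof (rule presented_iso_iff[OF G])
    show "R \<subseteq> words {0, 1} \<times> words {0, 1}" by (simp add: R_def)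
  next
    fix \<phi> :: "nat \<Rightarrow> nat word set" let ?Q = "presented_group {0, 1} R"
    assume "group ?Q" "\<phi> ` {0, 1} \<subseteq> carrier ?Q" "word_sat ?Q \<phi> R"
    then show "\<exists>x y b. pc_rels ?Q (4, 2, 3, 0, 0, 1, 0, 1) x y b \<and> \<phi> ` {0, 1} \<subseteq> generate ?Q {x, y, b}"
      by (rule fwd)
  next
    fix x y b assume rels: "pc_rels G (4, 2, 3, 0, 0, 1, 0, 1) x y b"
    interpret group G by fact
    define E where "E = pc_elem G (4, 2, 3, 0, 0, 1, 0, 1) x y b"
    have c: "x \<in> carrier G" "y \<in> carrier G" "b \<in> carrier G"
      using pc_rels_closed[OF rels] by auto
    have mult: "E i \<otimes>\<^bsub>G\<^esub> E j = E (tmul (4, 2, 3, 0, 0, 1, 0, 1) i j)" if "i < 16" "j < 16" for i j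
      using pc_elem_mult[OF rels] that by (simp add: E_def)
    have Ec: "E i \<in> carrier G" for i using pc_elem_closed[OF rels] by (simp add: E_def)
    have E0: "\<one>\<^bsub>G\<^esub> = E 0" by (simp add: E_def pc_elem_def)
    have E: "x = E 1" "y = E 4" "b = E 8" using c by (simp_all add: E_def pc_elem_def)
    define \<phi> where "\<phi> = (\<lambda>i :: nat. if i = 0 then E 1 else E 8)"
    have \<phi>: "\<phi> ` {0, 1} \<subseteq> carrier G" by (auto simp: \<phi>_def Ec)
    have [simp]: "\<phi> i \<in> carrier G" for i by (simp add: \<phi>_def Ec)
    have "word_sat G \<phi> R"
      unfolding word_sat_def R_def
      by (simp add: word_evals[OF \<phi>] word_eval_simps(1) comm_eq_iff square_eq pow_4_eq) 
         (simp add: \<phi>_def mult E0 tmul.simps)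
    moreover have "y = E 8 \<otimes>\<^bsub>G\<^esub> E 8" by (simp add: E mult tmul.simps)
    moreover have g: "E 1 \<in> generate G (\<phi> ` {0, 1})" "E 8 \<in> generate G (\<phi> ` {0, 1})"
      by (auto simp: \<phi>_def intro: generate.incl)
    ultimately have "word_sat G \<phi> R" "{x, y, b} \<subseteq> generate G (\<phi> ` {0, 1})"
      using generate.eng[OF g(2) g(2)] unfolding E(1,3) by simp_all
    then show "\<exists>\<phi>. \<phi> ` {0, 1} \<subseteq> carrier G \<and> word_sat G \<phi> R \<and> {x, y, b} \<subseteq> generate G (\<phi> ` {0, 1})"
      using \<phi> by blast
  qed
qed

text \<open>The commutator c becomes the second polycyclic generator.\<close>

lemma H16_iso_iff:
  fixes G :: "('g, 'm) monoid_scheme"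
  assumes G: "group G" "order G = 16"
  shows "G \<cong> H16 \<longleftrightarrow> (\<exists>x y b. pc_gen G (4, 2, 1, 1, 0, 1, 0, 0) x y b)"
proof -
  define R :: "(nat word \<times> nat word) set" where
    "R = {(wpow (gen 0) 4, []), (wpow (gen 1) 2, []), (wpow (gen 2) 2, []),
      (wcomm (gen 0) (gen 1), gen 2), (wcomm (gen 0) (gen 2), []), (wcomm (gen 1) (gen 2), [])}"
  have M: "H16 = presented_group {0, 1, 2} R"
    by (simp add: H16_def R_def Let_def)
  have fwd: "\<exists>x y b. pc_rels Q (4, 2, 1, 1, 0, 1, 0, 0) x y b \<and> \<phi> ` {0, 1, 2} \<subseteq> generate Q {x, y, b}"
    if Q: "group Q" and \<phi>: "\<phi> ` {0, 1, 2} \<subseteq> carrier Q" and sat: "word_sat Q \<phi> R"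
    for Q :: "nat word set monoid" (structure) and \<phi>
  proof -
    interpret group Q by fact
    define a b c where "a = \<phi> 0" and "b = \<phi> 1" and "c = \<phi> 2"
    have c [simp]: "a \<in> carrier Q" "b \<in> carrier Q" "c \<in> carrier Q"
      using \<phi> by (auto simp: a_def b_def c_def)

    have r: "a [^] (4::nat) = \<one>" "b [^] (2::nat) = \<one>" "c [^] (2::nat) = \<one>"
      "a \<otimes> b = b \<otimes> (a \<otimes> c)" "a \<otimes> c = c \<otimes> a" "b \<otimes> c = c \<otimes> b"
      using sat c unfolding word_sat_def R_def
      by (simp_all add: word_evals[OF \<phi>] word_eval_simps(1) comm_eq_iff a_def b_def c_def)
    \<comment> \<open>Since c commutes with a and b and has square 1, the commutator relation can be
      solved for ba.\<close>
    have "a \<otimes> c \<otimes> b = a \<otimes> b \<otimes> c" using r(6) by (simp add: m_assoc)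
    also have "\<dots> = b \<otimes> a \<otimes> (c \<otimes> c)" unfolding r(4) by (simp add: m_assoc)
    also have "\<dots> = b \<otimes> a" using r(3) by (simp add: square_eq)
    finally have s: "b \<otimes> a = a \<otimes> c \<otimes> b" ..
    have rels: "pc_rels Q (4, 2, 1, 1, 0, 1, 0, 0) a c b"
      unfolding pc_rels.simps using r(1-3,5,6) s square_eq[of b] by (simp add: nat_pow_eone)
    have gens: "\<phi> ` {0, 1, 2} \<subseteq> generate Q {a, c, b}"
      by (auto simp: a_def b_def c_def intro: generate.incl)
    show ?thesis using rels gens by blast
  qed
  show ?thesis
    unfolding M
  proof (rule presented_iso_iff[OF G])
    show "R \<subseteq> words {0, 1, 2} \<times> words {0, 1, 2}" by (simp add: R_def)
  next
    fix \<phi> :: "nat \<Rightarrow> nat word set" let ?Q = "presented_group {0, 1, 2} R"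
    assume "group ?Q" "\<phi> ` {0, 1, 2} \<subseteq> carrier ?Q" "word_sat ?Q \<phi> R"
    then show "\<exists>x y b. pc_rels ?Q (4, 2, 1, 1, 0, 1, 0, 0) x y b \<and> \<phi> ` {0, 1, 2} \<subseteq> generate ?Q {x, y, b}"
      by (rule fwd)
  next
    fix x y b assume rels: "pc_rels G (4, 2, 1, 1, 0, 1, 0, 0) x y b"
    interpret group G by fact
    define E where "E = pc_elem G (4, 2, 1, 1, 0, 1, 0, 0) x y b"
    have c: "x \<in> carrier G" "y \<in> carrier G" "b \<in> carrier G"
      using pc_rels_closed[OF rels] by auto
    have mult: "E i \<otimes>\<^bsub>G\<^esub> E j = E (tmul (4, 2, 1, 1, 0, 1, 0, 0) i j)" if "i < 16" "j < 16" for i j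
      using pc_elem_mult[OF rels] that by (simp add: E_def)
    have Ec: "E i \<in> carrier G" for i using pc_elem_closed[OF rels] by (simp add: E_def)
    have E0: "\<one>\<^bsub>G\<^esub> = E 0" by (simp add: E_def pc_elem_def)
    have E: "x = E 1" "y = E 4" "b = E 8" using c by (simp_all add: E_def pc_elem_def)
    define \<phi> where "\<phi> = (\<lambda>i :: nat. if i = 0 then E 1 else if i = 1 then E 8 else E 4)"
    have \<phi>: "\<phi> ` {0, 1, 2} \<subseteq> carrier G" by (auto simp: \<phi>_def Ec)
    have [simp]: "\<phi> i \<in> carrier G" for i by (simp add: \<phi>_def Ec)
    have "word_sat G \<phi> R"
      unfolding word_sat_def R_def
      by (simp add: word_evals[OF \<phi>] word_eval_simps(1) comm_eq_iff square_eq pow_4_eq) 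
         (simp add: \<phi>_def mult E0 tmul.simps)
    moreover have "{x, y, b} \<subseteq> generate G (\<phi> ` {0, 1, 2})"
      unfolding E by (auto simp: \<phi>_def intro!: generate.incl)
    ultimately show "\<exists>\<phi>. \<phi> ` {0, 1, 2} \<subseteq> carrier G \<and> word_sat G \<phi> R \<and> {x, y, b} \<subseteq> generate G (\<phi> ` {0, 1, 2})"
      using \<phi> by blast
  qed
qed

text \<open>The central generator c has order 4, so it cannot itself be the factor of order 2 beside
  a. The product ac can, because a and c commute and have equal squares; conversely c is recovered
  as \<open>a^3\<close> times ac.\<close>

lemma D8_Y_C4_iso_iff:
  fixes G :: "('g, 'm) monoid_scheme"
  assumes G: "group G" "order G = 16"
  shows "G \<cong> D8_Y_C4 \<longleftrightarrow> (\<exists>x y b. pc_gen G (4, 2, 3, 0, 2, 1, 0, 0) x y b)"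
proof -
  define R :: "(nat word \<times> nat word) set" where
    "R = {(wpow (gen 0) 4, []), (wpow (gen 1) 2, []), (wpow (gen 2) 4, []),
      (wcomm (gen 0) (gen 1), wpow (gen 0) 2), (wpow (gen 0) 2, wpow (gen 2) 2),
      (wcomm (gen 0) (gen 2), []), (wcomm (gen 1) (gen 2), [])}"
  have M: "D8_Y_C4 = presented_group {0, 1, 2} R"
    by (simp add: D8_Y_C4_def R_def Let_def)
  have fwd: "\<exists>x y b. pc_rels Q (4, 2, 3, 0, 2, 1, 0, 0) x y b \<and> \<phi> ` {0, 1, 2} \<subseteq> generate Q {x, y, b}"
    if Q: "group Q" and \<phi>: "\<phi> ` {0, 1, 2} \<subseteq> carrier Q" and sat: "word_sat Q \<phi> R"
    for Q :: "nat word set monoid" (structure) and \<phi>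
  proof -
    interpret group Q by fact
    define a b c where "a = \<phi> 0" and "b = \<phi> 1" and "c = \<phi> 2"
    have c [simp]: "a \<in> carrier Q" "b \<in> carrier Q" "c \<in> carrier Q"
      using \<phi> by (auto simp: a_def b_def c_def)

    have r: "a [^] (4::nat) = \<one>" "b [^] (2::nat) = \<one>"
      "a \<otimes> b = b \<otimes> (a \<otimes> a [^] (2::nat))" "a [^] (2::nat) = c [^] (2::nat)"
      "a \<otimes> c = c \<otimes> a" "b \<otimes> c = c \<otimes> b"
      using sat c unfolding word_sat_def R_def
      by (simp_all add: word_evals[OF \<phi>] word_eval_simps(1) comm_eq_iff a_def b_def c_def)
    have e: "a \<otimes> a [^] (2::nat) = a [^] (3::nat)" using nat_pow_Suc2[OF c(1), of 2] by simp
    then have s: "b \<otimes> a = a [^] (3::nat) \<otimes> b"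
      using twist_iff[OF c(1,2) r(1), of 3 3] r(3) by simp
    have "(a \<otimes> c) [^] (2::nat) = a [^] (2::nat) \<otimes> c [^] (2::nat)"
      by (intro pow_mult_distrib r(5) c)
    also have "\<dots> = a [^] (4::nat)" unfolding r(4)[symmetric] by (simp add: nat_pow_mult)
    finally have t: "(a \<otimes> c) [^] (2::nat) = \<one>" using r(1) by simp
    have "b \<otimes> (a \<otimes> c) = b \<otimes> a \<otimes> c" by (simp only: m_assoc c)
    also have "\<dots> = a [^] (3::nat) \<otimes> (b \<otimes> c)" unfolding s by (simp add: m_assoc)
    also have "\<dots> = a [^] (2::nat) \<otimes> a \<otimes> c \<otimes> b"
      unfolding r(6) e[symmetric] using nat_pow_Suc[of a 2] e by (simp add: m_assoc[symmetric])
    finally have u: "b \<otimes> (a \<otimes> c) = a [^] (2::nat) \<otimes> (a \<otimes> c) \<otimes> b" by (simp add: m_assoc)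
    have v: "a \<otimes> c \<otimes> a = a \<otimes> (a \<otimes> c)" by (metis m_assoc c(1,3) r(5))
    have rels: "pc_rels Q (4, 2, 3, 0, 2, 1, 0, 0) a (a \<otimes> c) b"
      unfolding pc_rels.simps using r(1,2) s t u v square_eq[of b] by (simp add: nat_pow_eone)
    have "a [^] (4::nat) \<otimes> c = a \<otimes> (a \<otimes> (a \<otimes> (a \<otimes> c)))"
      by (simp add: pow_4_eq m_assoc)
    then have "c = a \<otimes> (a \<otimes> (a \<otimes> (a \<otimes> c)))" using r(1) by simp
    moreover have g: "a \<in> generate Q {a, a \<otimes> c, b}" "b \<in> generate Q {a, a \<otimes> c, b}"
      "a \<otimes> c \<in> generate Q {a, a \<otimes> c, b}"
      by (auto intro: generate.incl)
    moreover have im: "\<phi> ` {0, 1, 2} = {a, b, c}" by (simp add: a_def b_def c_def)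
    ultimately have "c \<in> generate Q {a, a \<otimes> c, b}"
      using generate.eng[OF g(1) generate.eng[OF g(1) generate.eng[OF g(1) g(3)]]] by simp
    then have gens: "\<phi> ` {0, 1, 2} \<subseteq> generate Q {a, a \<otimes> c, b}"
      using g im by simp
    show ?thesis using rels gens by blast
  qed
  show ?thesis
    unfolding M
  proof (rule presented_iso_iff[OF G])
    show "R \<subseteq> words {0, 1, 2} \<times> words {0, 1, 2}" by (simp add: R_def)
  next
    fix \<phi> :: "nat \<Rightarrow> nat word set" let ?Q = "presented_group {0, 1, 2} R"
    assume "group ?Q" "\<phi> ` {0, 1, 2} \<subseteq> carrier ?Q" "word_sat ?Q \<phi> R"
    then show "\<exists>x y b. pc_rels ?Q (4, 2, 3, 0, 2, 1, 0, 0) x y b \<and> \<phi> ` {0, 1, 2} \<subseteq> generate ?Q {x, y, b}"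
      by (rule fwd)
  next
    fix x y b assume rels: "pc_rels G (4, 2, 3, 0, 2, 1, 0, 0) x y b"
    interpret group G by fact
    define E where "E = pc_elem G (4, 2, 3, 0, 2, 1, 0, 0) x y b"
    have c: "x \<in> carrier G" "y \<in> carrier G" "b \<in> carrier G"
      using pc_rels_closed[OF rels] by auto
    have mult: "E i \<otimes>\<^bsub>G\<^esub> E j = E (tmul (4, 2, 3, 0, 2, 1, 0, 0) i j)" if "i < 16" "j < 16" for i j
      using pc_elem_mult[OF rels] that by (simp add: E_def)
    have Ec: "E i \<in> carrier G" for i using pc_elem_closed[OF rels] by (simp add: E_def)
    have E0: "\<one>\<^bsub>G\<^esub> = E 0" by (simp add: E_def pc_elem_def)
    have E: "x = E 1" "y = E 4" "b = E 8" using c by (simp_all add: E_def pc_elem_def)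
    \<comment> \<open>Number 7 is \<open>x^3 y\<close>, the central element whose product with x is
      y.\<close>
    define \<phi> where "\<phi> = (\<lambda>i :: nat. if i = 0 then E 1 else if i = 1 then E 8 else E 7)"
    have \<phi>: "\<phi> ` {0, 1, 2} \<subseteq> carrier G" by (auto simp: \<phi>_def Ec)
    have [simp]: "\<phi> i \<in> carrier G" for i by (simp add: \<phi>_def Ec)
    have "word_sat G \<phi> R"
      unfolding word_sat_def R_def
      by (simp add: word_evals[OF \<phi>] word_eval_simps(1) comm_eq_iff square_eq pow_4_eq) 
         (simp add: \<phi>_def mult E0 tmul.simps, simp add: numeral_2_eq_2)
    moreover have "y = E 1 \<otimes>\<^bsub>G\<^esub> E 7" by (simp add: E mult tmul.simps)
    moreover have g: "E 1 \<in> generate G (\<phi> ` {0, 1, 2})" "E 8 \<in> generate G (\<phi> ` {0, 1, 2})"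
        "E 7 \<in> generate G (\<phi> ` {0, 1, 2})"
      by (auto simp: \<phi>_def intro: generate.incl)
    ultimately have "word_sat G \<phi> R" "{x, y, b} \<subseteq> generate G (\<phi> ` {0, 1, 2})"
      using generate.eng[OF g(1) g(3)] unfolding E(1,3) by simp_all
    then show "\<exists>\<phi>. \<phi> ` {0, 1, 2} \<subseteq> carrier G \<and> word_sat G \<phi> R \<and> {x, y, b} \<subseteq> generate G (\<phi> ` {0, 1, 2})"
      using \<phi> by blast
  qed
qed


section \<open>Direct products with the group of order two\<close>

lemma nat_pow_DirProd:
  "(g, h) [^]\<^bsub>G \<times>\<times> H\<^esub> (n :: nat) = (g [^]\<^bsub>G\<^esub> n, h [^]\<^bsub>H\<^esub> n)"
  by (induction n) (simp_all add: nat_pow_def)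

text \<open>The product is not given by a presentation of its own. A homomorphism on the first
  factor comes from Von Dyck's theorem, and the central involution y of \<open>G\<close> extends it
  to the second factor. The values \<open>t\<close> = 0 and \<open>t\<close> = 2 belong to D8 and
  Q8.\<close>

lemma iso_times_C2_iff:
  fixes G :: "('g, 'm) monoid_scheme" and R :: "(nat word \<times> nat word) set"
  defines "K \<equiv> presented_group {0, 1} R"
  assumes G: "group G" "order G = 16" and R: "R \<subseteq> words {0, 1} \<times> words {0, 1}" and t: "t \<in> {0, 2}"
    and 1: "\<And>\<phi>. \<phi> ` {0, 1} \<subseteq> carrier K \<Longrightarrow> word_sat K \<phi> R \<Longrightarrow>
      \<phi> 0 [^]\<^bsub>K\<^esub> (4 :: nat) = \<one>\<^bsub>K\<^esub> \<and> \<phi> 1 \<otimes>\<^bsub>K\<^esub> \<phi> 0 = \<phi> 0 [^]\<^bsub>K\<^esub> (3 :: nat) \<otimes>\<^bsub>K\<^esub> \<phi> 1 \<and>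
      \<phi> 1 \<otimes>\<^bsub>K\<^esub> \<phi> 1 = \<phi> 0 [^]\<^bsub>K\<^esub> t"
    and 2: "\<And>\<phi>. \<phi> ` {0, 1} \<subseteq> carrier G \<Longrightarrow>
      \<phi> 0 [^]\<^bsub>G\<^esub> (4 :: nat) = \<one>\<^bsub>G\<^esub> \<and> \<phi> 1 \<otimes>\<^bsub>G\<^esub> \<phi> 0 = \<phi> 0 [^]\<^bsub>G\<^esub> (3 :: nat) \<otimes>\<^bsub>G\<^esub> \<phi> 1 \<and>
      \<phi> 1 \<otimes>\<^bsub>G\<^esub> \<phi> 1 = \<phi> 0 [^]\<^bsub>G\<^esub> t \<Longrightarrow> word_sat G \<phi> R"
  shows "G \<cong> K \<times>\<times> integer_mod_group 2 \<longleftrightarrow> (\<exists>x y b. pc_gen G (4, 2, 3, 0, 0, 1, t, 0) x y b)"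
proof -
  let ?Z = "integer_mod_group 2" and ?P = "(4, 2, 3, 0, 0, 1, t, 0)"
  interpret G: group G by fact
  interpret K: group K unfolding K_def by (rule group_presented_group)
  interpret D: group "K \<times>\<times> ?Z" by (rule DirProd_group) (simp_all add: K.is_group)
  have Z: "carrier ?Z = {0, 1}" by (auto simp: carrier_integer_mod_group)
  define a b where "a = word_class {0, 1} R (gen 0)" and "b = word_class {0, 1} R (gen 1)"
  note gen = presented_group_gen[OF R, folded K_def]
  have ab: "a \<in> carrier K" "b \<in> carrier K" and "carrier K \<subseteq> generate K {a, b}"
    using gen(1,3) by (auto simp: a_def b_def)
  then have genK: "carrier K = generate K {a, b}" using K.generate_incl[of "{a, b}"] by blast
  have rel: "a [^]\<^bsub>K\<^esub> (4 :: nat) = \<one>\<^bsub>K\<^esub>" "b \<otimes>\<^bsub>K\<^esub> a = a [^]\<^bsub>K\<^esub> (3 :: nat) \<otimes>\<^bsub>K\<^esub> b"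
    "b \<otimes>\<^bsub>K\<^esub> b = a [^]\<^bsub>K\<^esub> t"
    using 1[OF gen(1,2)] by (simp_all add: a_def b_def)
  have rels: "pc_rels (K \<times>\<times> ?Z) ?P (a, 0) (\<one>\<^bsub>K\<^esub>, 1) (b, 0)"
    using ab rel unfolding pc_rels.simps
    by (simp add: nat_pow_DirProd Z pow_integer_mod_group)
  have "carrier (K \<times>\<times> ?Z) \<subseteq> generate (K \<times>\<times> ?Z) {(a, 0), (\<one>\<^bsub>K\<^esub>, 1), (b, 0)}" (is "_ \<subseteq> ?gen")
  proof
    interpret i: group_hom K "K \<times>\<times> ?Z" "\<lambda>g. (g, 0)"
      by (unfold_locales) (auto simp: hom_def Z)
    fix d assume "d \<in> carrier (K \<times>\<times> ?Z)"
    then obtain g e where d: "d = (g, e)" "g \<in> carrier K" "e \<in> {0, 1}" by (auto simp: Z)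
    have "(g, 0) \<in> generate (K \<times>\<times> ?Z) {(a, 0), (b, 0)}"
      using i.generate_img[of "{a, b}"] genK ab d(2) by auto
    then have g: "(g, 0) \<in> ?gen"
      using D.mono_generate[of "{(a, 0), (b, 0)}" "{(a, 0), (\<one>\<^bsub>K\<^esub>, 1), (b, 0)}"] by auto
    moreover have "(\<one>\<^bsub>K\<^esub>, 1) \<in> ?gen" by (auto intro: generate.incl)
    from generate.eng[OF g this] have "(g, 1) \<in> ?gen" using d(2) by simp
    ultimately show "d \<in> ?gen" using d by auto
  qed
  then have pc: "pc_gen (K \<times>\<times> ?Z) ?P (a, 0) (\<one>\<^bsub>K\<^esub>, 1) (b, 0)"
    using rels by (simp add: pc_gen_def)
  show ?thesis
  proof
    assume "\<exists>x y b. pc_gen G ?P x y b"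
    then obtain x y b' where pc': "pc_gen G ?P x y b'" by blast
    then have rels': "pc_rels G ?P x y b'" and gen': "carrier G \<subseteq> generate G {x, y, b'}"
      by (auto simp: pc_gen_def)
    note D' = G.pc_relsD[OF rels'] and c = G.pc_closed[OF rels']
    define \<phi> where "\<phi> = (\<lambda>i :: nat. if i = 0 then x else b')"
    have \<phi>: "\<phi> ` {0, 1} \<subseteq> carrier G" using c by (simp add: \<phi>_def)
    have "word_sat G \<phi> R"
      by (rule 2[OF \<phi>]) (use D'(2,5,7) c in \<open>simp add: \<phi>_def\<close>)
    then obtain h where h: "h \<in> hom K G" "\<phi> ` {0, 1} \<subseteq> h ` carrier K"
      using presented_group_hom[OF G(1) \<phi>] unfolding K_def by blast
    interpret h: group_hom K G h
      using h(1) by unfold_locales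
    \<comment> \<open>The number of y is 4; that it commutes with everything is read off the two
      multiplication tables.\<close>
    have central: "y \<otimes>\<^bsub>G\<^esub> g = g \<otimes>\<^bsub>G\<^esub> y" if "g \<in> carrier G" for g
    proof -
      define E where "E = pc_elem G ?P x y b'"
      have "g \<in> E ` {..<16}"
        using that G.pc_gen_bij[OF pc' G(2)] by (simp add: E_def bij_betw_def)
      then obtain n where n: "n < 16" "g = E n" by blast
      have y: "y = E 4" using c by (simp add: E_def pc_elem_def)
      from t consider "t = 0" | "t = 2" by blast
      then have "list_all (\<lambda>n. tmul ?P 4 n = tmul ?P n 4) [0..<16]"
      proof cases
        case 1
        show ?thesis unfolding 1 by code_simp
      next
        case 2
        show ?thesis unfolding 2 by code_simp
      qed
      then have "\<forall>n\<in>set [0..<16]. tmul ?P 4 n = tmul ?P n 4"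
        by (simp only: list_all_iff)
      then have "tmul ?P 4 n = tmul ?P n 4"
        by (rule bspec) (use n(1) in simp)
      then have "E 4 \<otimes>\<^bsub>G\<^esub> E n = E n \<otimes>\<^bsub>G\<^esub> E 4"
        using G.pc_elem_mult[OF rels', of 4 n] G.pc_elem_mult[OF rels', of n 4] n(1)
        by (simp add: E_def)
      then show ?thesis unfolding n(2) y[symmetric] .
    qed
    define h' where "h' = (\<lambda>(g, e). h g \<otimes>\<^bsub>G\<^esub> y [^]\<^bsub>G\<^esub> nat e)"
    have yy: "y \<otimes>\<^bsub>G\<^esub> y = \<one>\<^bsub>G\<^esub>" using D'(3) c by (simp add: numeral_2_eq_2)
    have h'_hom: "h' \<in> hom (K \<times>\<times> ?Z) G"
    proof (rule homI)
      fix d assume "d \<in> carrier (K \<times>\<times> ?Z)"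
      then show "h' d \<in> carrier G" using c by (auto simp: h'_def)
    next
      fix d d' assume "d \<in> carrier (K \<times>\<times> ?Z)" "d' \<in> carrier (K \<times>\<times> ?Z)"
      then obtain g e g' e' where d: "d = (g, e)" "d' = (g', e')"
        and g: "g \<in> carrier K" "g' \<in> carrier K" and e: "e \<in> {0, 1}" "e' \<in> {0, 1}"
        by (auto simp: Z)
      have hg: "h g \<in> carrier G" "h g' \<in> carrier G" using g by auto
      have 1: "h g \<otimes>\<^bsub>G\<^esub> y \<otimes>\<^bsub>G\<^esub> h g' = h g \<otimes>\<^bsub>G\<^esub> h g' \<otimes>\<^bsub>G\<^esub> y"
        by (simp only: G.m_assoc hg c central[OF hg(2)])
      then have 2: "h g \<otimes>\<^bsub>G\<^esub> y \<otimes>\<^bsub>G\<^esub> (h g' \<otimes>\<^bsub>G\<^esub> y) = h g \<otimes>\<^bsub>G\<^esub> h g'"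
        by (metis G.m_assoc G.m_closed G.r_one c(2) hg yy)
      have "h (g \<otimes>\<^bsub>K\<^esub> g') \<otimes>\<^bsub>G\<^esub> y [^]\<^bsub>G\<^esub> nat ((e + e') mod 2) =
          h g \<otimes>\<^bsub>G\<^esub> y [^]\<^bsub>G\<^esub> nat e \<otimes>\<^bsub>G\<^esub> (h g' \<otimes>\<^bsub>G\<^esub> y [^]\<^bsub>G\<^esub> nat e')"
        using e
      proof safe
        show "h (g \<otimes>\<^bsub>K\<^esub> g') \<otimes>\<^bsub>G\<^esub> y [^]\<^bsub>G\<^esub> nat ((0 + 0) mod 2) =
            h g \<otimes>\<^bsub>G\<^esub> y [^]\<^bsub>G\<^esub> nat 0 \<otimes>\<^bsub>G\<^esub> (h g' \<otimes>\<^bsub>G\<^esub> y [^]\<^bsub>G\<^esub> nat 0)"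
          using g hg by simp
        show "h (g \<otimes>\<^bsub>K\<^esub> g') \<otimes>\<^bsub>G\<^esub> y [^]\<^bsub>G\<^esub> nat ((0 + 1) mod 2) =
            h g \<otimes>\<^bsub>G\<^esub> y [^]\<^bsub>G\<^esub> nat 0 \<otimes>\<^bsub>G\<^esub> (h g' \<otimes>\<^bsub>G\<^esub> y [^]\<^bsub>G\<^esub> nat 1)"
          using g hg c(2) by (simp add: G.m_assoc)
        show "h (g \<otimes>\<^bsub>K\<^esub> g') \<otimes>\<^bsub>G\<^esub> y [^]\<^bsub>G\<^esub> nat ((1 + 0) mod 2) =
            h g \<otimes>\<^bsub>G\<^esub> y [^]\<^bsub>G\<^esub> nat 1 \<otimes>\<^bsub>G\<^esub> (h g' \<otimes>\<^bsub>G\<^esub> y [^]\<^bsub>G\<^esub> nat 0)"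
          using g hg c(2) 1 by simp
        show "h (g \<otimes>\<^bsub>K\<^esub> g') \<otimes>\<^bsub>G\<^esub> y [^]\<^bsub>G\<^esub> nat ((1 + 1) mod 2) =
            h g \<otimes>\<^bsub>G\<^esub> y [^]\<^bsub>G\<^esub> nat 1 \<otimes>\<^bsub>G\<^esub> (h g' \<otimes>\<^bsub>G\<^esub> y [^]\<^bsub>G\<^esub> nat 1)"
          using g hg c(2) 2 by simp
      qed
      then show "h' (d \<otimes>\<^bsub>K \<times>\<times> ?Z\<^esub> d') = h' d \<otimes>\<^bsub>G\<^esub> h' d'"
        by (simp only: h'_def d prod.case mult_DirProd mult_integer_mod_group) simp
    qed
    interpret h': group_hom "K \<times>\<times> ?Z" G h'
      using h'_hom by unfold_locales
    have im: "h g \<in> h' ` carrier (K \<times>\<times> ?Z)" if "g \<in> carrier K" for g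
      using that by (intro image_eqI[of _ _ "(g, 0)"]) (auto simp: h'_def Z)
    have "{x, b'} \<subseteq> h' ` carrier (K \<times>\<times> ?Z)"
      using h(2) im by (auto simp: \<phi>_def)
    moreover have "y \<in> h' ` carrier (K \<times>\<times> ?Z)"
      using c by (intro image_eqI[of _ _ "(\<one>\<^bsub>K\<^esub>, 1)"]) (auto simp: h'_def Z)
    ultimately have "{x, y, b'} \<subseteq> h' ` carrier (K \<times>\<times> ?Z)" by simp
    then have "carrier G \<subseteq> h' ` carrier (K \<times>\<times> ?Z)"
      using gen' G.generate_subgroup_incl[OF _ h'.img_is_subgroup] by blast
    then have "h' ` carrier (K \<times>\<times> ?Z) = carrier G" using h'_hom by (auto simp: hom_def)
    then show "G \<cong> K \<times>\<times> ?Z"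
      using pc_gen_iso[OF D.is_group G(1) h'_hom _ pc G(2)] by blast
  qed (use iso_pc_gen[OF G(1) D.is_group _ pc] in blast)
qed

lemma dihedral_8_times_C2_iso_iff:
  fixes G :: "('g, 'm) monoid_scheme"
  assumes G: "group G" "order G = 16"
  shows "G \<cong> dihedral_group 8 \<times>\<times> integer_mod_group 2 \<longleftrightarrow>
    (\<exists>x y b. pc_gen G (4, 2, 3, 0, 0, 1, 0, 0) x y b)"
proof -
  define R :: "(nat word \<times> nat word) set" where
    "R = {(wpow (gen 0) 4, []), (wpow (gen 1) 2, []), (winv (gen 1) @ gen 0 @ gen 1, winv (gen 0))}"
  have M: "dihedral_group 8 = presented_group {0, 1} R"
    by (simp add: dihedral_group_def R_def Let_def)
  have *: "word_sat H \<phi> R \<longleftrightarrow> \<phi> 0 [^] (4 :: nat) = \<one> \<and>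
      \<phi> 1 \<otimes> \<phi> 0 = \<phi> 0 [^] (3 :: nat) \<otimes> \<phi> 1 \<and>
      \<phi> 1 \<otimes> \<phi> 1 = \<phi> 0 [^] (0 :: nat)"
    if H: "group H" and \<phi>: "\<phi> ` {0, 1} \<subseteq> carrier H"
    for H :: "('x, 'y) monoid_scheme" (structure) and \<phi>
  proof -
    interpret group H by fact
    have c: "\<phi> 0 \<in> carrier H" "\<phi> 1 \<in> carrier H" using \<phi> by auto
    have e: "inv (\<phi> 0) = \<phi> 0 [^] (3::nat)" if "\<phi> 0 [^] (4::nat) = \<one>"
      using pow_pred_eq_inv[OF c(1), of 3] that by simp
    show ?thesis
      unfolding word_sat_def R_def
      using c twist_iff[OF c, of 4 3 3] e
      by (auto simp: word_evals[OF \<phi>] square_eq[of "\<phi> (Suc 0)"])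
  qed
  show ?thesis
    unfolding M by (rule iso_times_C2_iff[OF G])
      (use * group_presented_group G in \<open>auto simp: R_def words_append words_winv\<close>)
qed

lemma quaternion_8_times_C2_iso_iff:
  fixes G :: "('g, 'm) monoid_scheme"
  assumes G: "group G" "order G = 16"
  shows "G \<cong> quaternion_group 8 \<times>\<times> integer_mod_group 2 \<longleftrightarrow>
    (\<exists>x y b. pc_gen G (4, 2, 3, 0, 0, 1, 2, 0) x y b)"
proof -
  define R :: "(nat word \<times> nat word) set" where
    "R = {(wpow (gen 0) 4, []), (wpow (gen 1) 2, wpow (gen 0) 2), (winv (gen 1) @ gen 0 @ gen 1, winv (gen 0))}"
  have M: "quaternion_group 8 = presented_group {0, 1} R"
    by (simp add: quaternion_group_def R_def Let_def)
  have *: "word_sat H \<phi> R \<longleftrightarrow> \<phi> 0 [^] (4 :: nat) = \<one> \<and>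
      \<phi> 1 \<otimes> \<phi> 0 = \<phi> 0 [^] (3 :: nat) \<otimes> \<phi> 1 \<and>
      \<phi> 1 \<otimes> \<phi> 1 = \<phi> 0 [^] (2 :: nat)"
    if H: "group H" and \<phi>: "\<phi> ` {0, 1} \<subseteq> carrier H"
    for H :: "('x, 'y) monoid_scheme" (structure) and \<phi>
  proof -
    interpret group H by fact
    have c: "\<phi> 0 \<in> carrier H" "\<phi> 1 \<in> carrier H" using \<phi> by auto
    have e: "inv (\<phi> 0) = \<phi> 0 [^] (3::nat)" if "\<phi> 0 [^] (4::nat) = \<one>"
      using pow_pred_eq_inv[OF c(1), of 3] that by simp
    show ?thesis
      unfolding word_sat_def R_def
      using c twist_iff[OF c, of 4 3 3] e
      by (auto simp: word_evals[OF \<phi>] square_eq[of "\<phi> (Suc 0)"])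
  qed
  show ?thesis
    unfolding M by (rule iso_times_C2_iff[OF G])
      (use * group_presented_group G in \<open>auto simp: R_def words_append words_winv\<close>)
qed

section \<open>Classification of the non-abelian groups of order 16\<close>

context group
begin

section \<open>An abelian subgroup of order 8\<close>

definition centralizer :: "'a \<Rightarrow> 'a set" where
  "centralizer x = {g \<in> carrier G. g \<otimes> x = x \<otimes> g}"

text \<open>One statement for centralizers in G, for centralizers inside a subgroup, and for the
  centre of a subgroup.\<close>

lemma subgroup_commuting:
  assumes "subgroup H G" "A \<subseteq> carrier G"
  shows "subgroup {g \<in> H. \<forall>a\<in>A. g \<otimes> a = a \<otimes> g} G"
proof (rule subgroupI)
  interpret subgroup H G by fact
  show "{g \<in> H. \<forall>a\<in>A. g \<otimes> a = a \<otimes> g} \<subseteq> carrier G" by auto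
  show "{g \<in> H. \<forall>a\<in>A. g \<otimes> a = a \<otimes> g} \<noteq> {}"
    using assms(2) one_closed by (auto intro!: exI[of _ \<one>])
  fix g assume "g \<in> {g \<in> H. \<forall>a\<in>A. g \<otimes> a = a \<otimes> g}"
  then have g: "g \<in> H" "g \<in> carrier G" "\<And>a. a \<in> A \<Longrightarrow> g \<otimes> a = a \<otimes> g" by auto
  have "inv g \<otimes> a = a \<otimes> inv g" if "a \<in> A" for a
  proof -
    have a: "a \<in> carrier G" using that assms(2) by blast
    have "inv g \<otimes> a \<otimes> g = inv g \<otimes> (g \<otimes> a)" using g(2) g(3)[OF that] a by (simp add: m_assoc)
    also have "\<dots> = a" using g(2) a by (simp add: m_assoc[symmetric])
    finally show ?thesis using inv_solve_right[of "inv g \<otimes> a" a g] g(2) a by simp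
  qed
  then show "inv g \<in> {g \<in> H. \<forall>a\<in>A. g \<otimes> a = a \<otimes> g}" using g(1) by auto
  fix h assume "h \<in> {g \<in> H. \<forall>a\<in>A. g \<otimes> a = a \<otimes> g}"
  then have h: "h \<in> H" "h \<in> carrier G" "\<And>a. a \<in> A \<Longrightarrow> h \<otimes> a = a \<otimes> h" by auto
  have "g \<otimes> h \<otimes> a = a \<otimes> (g \<otimes> h)" if "a \<in> A" for a
  proof -
    have a: "a \<in> carrier G" using that assms(2) by blast
    have "g \<otimes> h \<otimes> a = g \<otimes> (a \<otimes> h)" using g(2) h a that by (simp add: m_assoc)
    also have "\<dots> = a \<otimes> g \<otimes> h" using g h(2) a that by (simp add: m_assoc[symmetric])
    also have "\<dots> = a \<otimes> (g \<otimes> h)" using g(2) h(2) a by (simp add: m_assoc)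
    finally show ?thesis .
  qed
  then show "g \<otimes> h \<in> {g \<in> H. \<forall>a\<in>A. g \<otimes> a = a \<otimes> g}" using g(1) h(1) by auto
qed

lemma centralizer_eq: "x \<in> carrier G \<Longrightarrow> centralizer x = {g \<in> carrier G. \<forall>a\<in>{x}. g \<otimes> a = a \<otimes> g}"
  by (auto simp: centralizer_def)

lemma subgroup_centralizer: "x \<in> carrier G \<Longrightarrow> subgroup (centralizer x) G"
  using subgroup_commuting[OF subgroup_self, of "{x}"] by (simp add: centralizer_eq)

lemma card_class_mult_centralizer:
  assumes "finite (carrier G)" "x \<in> carrier G"
  shows "card ((\<lambda>g. g \<otimes> x \<otimes> inv g) ` carrier G) * card (centralizer x) = order G"
proof -
  let ?\<phi> = "\<lambda>g. \<lambda>h \<in> carrier G. g \<otimes> h \<otimes> inv g"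
  interpret act: group_action G "carrier G" ?\<phi> by (rule action_by_conjugation)
  have "orbit G ?\<phi> x = (\<lambda>g. g \<otimes> x \<otimes> inv g) ` carrier G"
    using assms(2) by (auto simp: orbit_def)
  moreover have "stabilizer G ?\<phi> x = centralizer x"
    using assms(2) by (auto simp: stabilizer_def centralizer_def inv_solve_right')
  ultimately show ?thesis
    using act.orbit_stabilizer_theorem[OF assms(2)] by simp
qed

text \<open>The class equation modulo \<open>d\<close>: the carrier is the disjoint union of the
  centre and the noncentral classes.\<close>

lemma dvd_card_center:
  assumes fin: "finite (carrier G)"
    and d: "d dvd order G"
    and dvd: "\<And>x. x \<in> carrier G \<Longrightarrow> centralizer x \<noteq> carrier G \<Longrightarrow>
      d dvd card ((\<lambda>g. g \<otimes> x \<otimes> inv g) ` carrier G)"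
  shows "d dvd card {x \<in> carrier G. centralizer x = carrier G}"
proof -
  let ?\<phi> = "\<lambda>g. \<lambda>h \<in> carrier G. g \<otimes> h \<otimes> inv g"
  interpret act: group_action G "carrier G" ?\<phi> by (rule action_by_conjugation)
  let ?Z = "{x \<in> carrier G. centralizer x = carrier G}"
  define cl where "cl = (\<lambda>x. (\<lambda>g. g \<otimes> x \<otimes> inv g) ` carrier G)"
  have orb: "orbit G ?\<phi> x = cl x" if "x \<in> carrier G" for x
    using that by (auto simp: orbit_def cl_def)
  let ?C = "cl ` (carrier G - ?Z)"
  have mem: "x \<in> cl x" if "x \<in> carrier G" for x
    using act.orbit_refl[OF that] orb[OF that] by simp
  have sub: "cl x \<subseteq> carrier G" if "x \<in> carrier G" for x
    using that by (auto simp: cl_def)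
  have disj: "cl x = cl y \<or> cl x \<inter> cl y = {}" if "x \<in> carrier G" "y \<in> carrier G" for x y
    using act.disjoint_union[of "cl x" "cl y"] that orb by (auto simp: orbits_def)
  have clZ: "cl z = {z}" if "z \<in> ?Z" for z
  proof -
    have "g \<otimes> z \<otimes> inv g = z" if "g \<in> carrier G" for g
    proof -
      have "g \<in> centralizer z" using \<open>z \<in> ?Z\<close> that by blast
      then show ?thesis using that \<open>z \<in> ?Z\<close> by (auto simp: centralizer_def inv_solve_right')
    qed
    then show ?thesis unfolding cl_def using one_closed by (auto simp: image_iff intro!: bexI[of _ \<one>])
  qed
  have Un: "\<Union> ?C = carrier G - ?Z"
  proof
    show "carrier G - ?Z \<subseteq> \<Union> ?C" using mem by blast
    show "\<Union> ?C \<subseteq> carrier G - ?Z"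
    proof
      fix y assume "y \<in> \<Union> ?C"
      then obtain x where x: "x \<in> carrier G - ?Z" "y \<in> cl x" by blast
      then have y: "y \<in> carrier G" using sub by blast
      have "y \<notin> ?Z"
      proof
        assume "y \<in> ?Z"
        then have "cl y = {y}" by (rule clZ)
        then have "cl x = {y}" using disj[of x y] x y by auto
        then have "x = y" using mem[of x] x by blast
        then show False using \<open>y \<in> ?Z\<close> x(1) by blast
      qed
      then show "y \<in> carrier G - ?Z" using y by blast
    qed
  qed
  have "d dvd card (\<Union> ?C)"
  proof (rule dvd_partition)
    show "finite (\<Union> ?C)" unfolding Un using fin by blast
    show "\<forall>c\<in>?C. d dvd card c" using dvd by (auto simp: cl_def)
    show "\<forall>c1\<in>?C. \<forall>c2\<in>?C. c1 \<noteq> c2 \<longrightarrow> c1 \<inter> c2 = {}" using disj by blast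
  qed
  moreover have "order G = card ?Z + card (carrier G - ?Z)"
  proof -
    have "card ?Z \<le> card (carrier G)" by (intro card_mono fin) auto
    then show ?thesis using fin by (subst card_Diff_subset) (auto simp: order_def)
  qed
  ultimately show ?thesis
    using d dvd_add_left_iff[of d "card (carrier G - ?Z)" "card ?Z"] unfolding Un by simp
qed

lemma power_2_dvd_16:
  assumes "n dvd (16::nat)"
  shows "n \<in> {1, 2, 4, 8, 16}"
proof -
  have "n dvd 2 ^ 4" using assms by simp
  then obtain i where "i \<le> 4" "n = 2 ^ i" using divides_primepow_nat[of 2 n 4] by auto
  then show ?thesis by (auto simp: le_Suc_eq numeral_eq_Suc)
qed

text \<open>The centre has even order. If no noncentral class had two elements, 4 would divide the
  order of the centre, and the centralizer of any noncentral element, holding the centre and that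
  element, would be forced up to order 8. So some centralizer has order 8, and the same counting
  inside it shows that it is abelian.\<close>

lemma abelian_subgroup_order_8:
  assumes nab: "\<not> comm_group G" and ord: "order G = 16"
  obtains H where "subgroup H G" "card H = 8" "\<And>g h. g \<in> H \<Longrightarrow> h \<in> H \<Longrightarrow> g \<otimes> h = h \<otimes> g"
proof -
  have fin: "finite (carrier G)" using ord order_gt_0_iff_finite by simp
  let ?Z = "{x \<in> carrier G. centralizer x = carrier G}"
  define cl where "cl = (\<lambda>x. (\<lambda>g. g \<otimes> x \<otimes> inv g) ` carrier G)"
  have sg: "card K \<in> {1, 2, 4, 8, 16}" if "subgroup K G" for K
    using lagrange[OF that] ord power_2_dvd_16[of "card K"] by (metis dvd_triv_right)
  have cs: "card (cl x) * card (centralizer x) = 16" if "x \<in> carrier G" for x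
    using card_class_mult_centralizer[OF fin that] ord by (simp add: cl_def)
  have cn: "card (centralizer x) \<noteq> 16" if "x \<in> carrier G" "centralizer x \<noteq> carrier G" for x
    using that fin ord card_subset_eq[OF fin, of "centralizer x"]
    by (auto simp: order_def centralizer_def)
  have "\<exists>x\<in>carrier G. \<exists>y\<in>carrier G. x \<otimes> y \<noteq> y \<otimes> x"
    using nab comm_groupI[of G] group_comm_groupI by blast
  then obtain x0 where x0: "x0 \<in> carrier G" "centralizer x0 \<noteq> carrier G"
    by (auto simp: centralizer_def)
  have Zsub: "?Z \<subseteq> centralizer x" if "x \<in> carrier G" for x
    using that by (force simp: centralizer_def)
  have xC: "x \<in> centralizer x" if "x \<in> carrier G" for x
    using that by (simp add: centralizer_def)
  have finC: "finite (centralizer x)" for x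
    using fin by (simp add: centralizer_def)
  have "2 dvd card ?Z"
  \<comment> \<open>A noncentral class has size 16 divided by a proper divisor of 16, hence even
    size.\<close>
  proof (rule dvd_card_center[OF fin])
    fix x assume x: "x \<in> carrier G" "centralizer x \<noteq> carrier G"
    show "2 dvd card ((\<lambda>g. g \<otimes> x \<otimes> inv g) ` carrier G)"
      using cs[OF x(1)] cn[OF x] sg[OF subgroup_centralizer[OF x(1)]] by (auto simp: cl_def)
  qed (simp add: ord)
  have oneZ: "\<one> \<in> ?Z" by (auto simp: centralizer_def)
  have finZ: "finite ?Z" using fin by simp
  then have "card ?Z \<ge> 2"
    using \<open>2 dvd card ?Z\<close> oneZ by (metis (no_types, lifting) card_gt_0_iff dvd_imp_le empty_iff)
  obtain x where x: "x \<in> carrier G" "centralizer x \<noteq> carrier G" "card (centralizer x) = 8"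
  proof (rule ccontr)
    assume "\<not> thesis"
    then have no8: "\<And>x. x \<in> carrier G \<Longrightarrow> centralizer x \<noteq> carrier G \<Longrightarrow> card (centralizer x) \<noteq> 8"
      using that by blast
    have "4 dvd card ?Z"
    proof (rule dvd_card_center[OF fin])
      fix x assume x: "x \<in> carrier G" "centralizer x \<noteq> carrier G"
      show "4 dvd card ((\<lambda>g. g \<otimes> x \<otimes> inv g) ` carrier G)"
        using cs[OF x(1)] cn[OF x] no8[OF x] sg[OF subgroup_centralizer[OF x(1)]] by (auto simp: cl_def)
    qed (simp add: ord)
    then have "card ?Z \<ge> 4" using \<open>card ?Z \<ge> 2\<close> by (auto dest: dvd_imp_le)
    moreover have "insert x0 ?Z \<subseteq> centralizer x0" using Zsub[OF x0(1)] xC[OF x0(1)] by blast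
    then have "card (insert x0 ?Z) \<le> card (centralizer x0)" by (rule card_mono[OF finC])
    moreover have "card (insert x0 ?Z) = Suc (card ?Z)" using x0 finZ by simp
    ultimately have "card (centralizer x0) \<ge> 5" by simp
    then show False
      using sg[OF subgroup_centralizer[OF x0(1)]] cn[OF x0] no8[OF x0] by auto
  qed
  let ?C = "centralizer x"
  let ?D = "{d \<in> ?C. \<forall>c\<in>?C. d \<otimes> c = c \<otimes> d}"
  have Csub: "?C \<subseteq> carrier G" by (auto simp: centralizer_def)
  have D: "subgroup ?D G" by (rule subgroup_commuting[OF subgroup_centralizer[OF x(1)] Csub])
  have "insert x ?Z \<subseteq> ?D"
  proof
    fix d assume "d \<in> insert x ?Z"
    then consider "d = x" | "d \<in> ?Z" by blast
    then show "d \<in> ?D"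
    proof cases
      case 1
      then show ?thesis using xC[OF x(1)] by (auto simp: centralizer_def)
    next
      case 2
      then show ?thesis using Zsub[OF x(1)] Csub by (force simp: centralizer_def)
    qed
  qed
  moreover have finD: "finite ?D" using finC by simp
  moreover have "card (insert x ?Z) = Suc (card ?Z)" using x finZ by simp
  ultimately have "card ?D \<ge> 3" using \<open>card ?Z \<ge> 2\<close> card_mono[of ?D "insert x ?Z"] by simp
  \<comment> \<open>The centre of the centralizer contains x and the centre of G, thus at least
    three elements; its order is a power of two.\<close>
  then have D4: "card ?D \<ge> 4" using sg[OF D] by auto
  have "?D = ?C"
  proof (rule ccontr)
    assume "?D \<noteq> ?C"
    then obtain c where c: "c \<in> ?C" "c \<notin> ?D" by blast
    let ?E = "{g \<in> ?C. \<forall>a\<in>{c}. g \<otimes> a = a \<otimes> g}"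
    have E: "subgroup ?E G"
      by (rule subgroup_commuting[OF subgroup_centralizer[OF x(1)]]) (use c Csub in auto)
    \<comment> \<open>An element c outside the centre of C commutes with that centre and with
      itself, so its centralizer in C has more than half of the elements of C and is all of
      C.\<close>
    have "insert c ?D \<subseteq> ?E" using c(1) by auto
    then have "card (insert c ?D) \<le> card ?E" using finC by (intro card_mono) auto
    then have "card ?E \<ge> 5" using D4 c(2) finD by simp
    moreover have "card ?E \<le> 8" unfolding x(3)[symmetric] using finC by (intro card_mono) auto
    ultimately have "card ?E = card ?C" using sg[OF E] x(3) by auto
    then have EC: "?E = ?C" by (intro card_subset_eq[OF finC]) auto
    have "g \<otimes> c = c \<otimes> g" if "g \<in> ?C" for g
    proof -
      have "g \<in> ?E" using that unfolding EC .
      then show ?thesis by blast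
    qed
    then have "\<forall>g\<in>?C. c \<otimes> g = g \<otimes> c" by simp
    then have "c \<in> ?D" using c(1) by blast
    then show False using c(2) by blast
  qed
  then have "g \<otimes> h = h \<otimes> g" if "g \<in> ?C" "h \<in> ?C" for g h using that by blast
  then show thesis using that[OF subgroup_centralizer[OF x(1)] x(3)] by blast
qed

end

lemma (in group) finite_closed_subgroup:
  assumes "finite H" "H \<subseteq> carrier G" "\<one> \<in> H" "\<And>g h. g \<in> H \<Longrightarrow> h \<in> H \<Longrightarrow> g \<otimes> h \<in> H"
  shows "subgroup H G"
proof (rule subgroupI)
  fix g assume g: "g \<in> H"
  have "(\<lambda>h. g \<otimes> h) ` H = H"
  proof (rule card_subset_eq)
    have "inj_on (\<lambda>h. g \<otimes> h) H"
      using assms(2) g by (auto simp: inj_on_def subset_iff)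
    then show "card ((\<lambda>h. g \<otimes> h) ` H) = card H" by (rule card_image)
  qed (use assms g in auto)
  then have "\<one> \<in> (\<lambda>h. g \<otimes> h) ` H" using assms(3) by simp
  then obtain h where h: "h \<in> H" "g \<otimes> h = \<one>" by (metis imageE)
  have "g \<in> carrier G" "h \<in> carrier G" using assms(2) g h by blast+
  then have "inv g = h" using h(2) inv_equality inv_comm by blast
  then show "inv g \<in> H" using h by simp
qed (use assms in auto)

context group
begin

section \<open>Polycyclic coordinates from an abelian subgroup of index two\<close>

text \<open>\<open>H\<close> and its translate by \<open>h\<close> are disjoint and have 8 elements
  each, so they fill the group.\<close>

lemma index_2_mult_inv:
  assumes H: "subgroup H G" "card H = 8" and ord: "order G = 16"
    and gh: "g \<in> carrier G" "h \<in> carrier G" "g \<notin> H" "h \<notin> H"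
  shows "g \<otimes> inv h \<in> H"
proof -
  interpret subgroup H G by fact
  have fin: "finite (carrier G)" using ord order_gt_0_iff_finite by simp
  let ?K = "(\<lambda>a. a \<otimes> h) ` H"
  have "inj_on (\<lambda>a. a \<otimes> h) H" using gh by (auto simp: inj_on_def)
  then have cK: "card ?K = 8" using H(2) by (simp add: card_image)
  have disj: "H \<inter> ?K = {}"
  proof (rule ccontr)
    assume "H \<inter> ?K \<noteq> {}"
    then obtain a where a: "a \<in> H" "a \<otimes> h \<in> H" by blast
    then have "inv a \<otimes> (a \<otimes> h) \<in> H" by blast
    then show False using a gh by (simp add: m_assoc[symmetric])
  qed
  have finH: "finite H" using fin subset by (rule rev_finite_subset)
  have "card (H \<union> ?K) = 16" using cK H(2) disj finH by (simp add: card_Un_disjoint)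
  moreover have sub: "H \<union> ?K \<subseteq> carrier G" using gh by auto
  ultimately have "H \<union> ?K = carrier G" using ord fin by (intro card_subset_eq) (auto simp: order_def)
  then obtain a where a: "a \<in> H" "g = a \<otimes> h" using gh by blast
  then show ?thesis using gh by (simp add: m_assoc)
qed

text \<open>Any element b outside \<open>H\<close> acts on \<open>H\<close> by conjugation and has
  its square in \<open>H\<close>. Writing these values as \<open>x^i y^j\<close> yields the
  parameters.\<close>

lemma pc_gen_of_abelian_subgroup:
  fixes m k :: nat
  assumes ord: "order G = 16" and m: "m * k = 8"
    and xy: "x \<in> carrier G" "y \<in> carrier G" "x [^] m = \<one>" "y [^] k = \<one>" "y \<otimes> x = x \<otimes> y"
    and H: "subgroup H G" "card H = 8" "H = {x [^] (i :: nat) \<otimes> y [^] (j :: nat) |i j. True}"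
  shows "\<exists>p<m. \<exists>q<k. \<exists>r<m. \<exists>s<k. \<exists>t<m. \<exists>u<k. \<exists>b. (k = 1 \<longrightarrow> r = 0) \<and> pc_gen G (m, k, p, q, r, s, t, u) x y b"
proof -
  interpret subgroup H G by fact
  have m0: "m > 0" "k > 0" using m by (auto intro: Nat.gr0I)
  have nf: "\<exists>i<m. \<exists>j<k. g = x [^] i \<otimes> y [^] j" if "g \<in> H" for g
  proof -
    have "g \<in> {x [^] (i :: nat) \<otimes> y [^] (j :: nat) |i j. True}" using that H(3) by simp
    then obtain i j :: nat where "g = x [^] i \<otimes> y [^] j" by blast
    then have "g = x [^] (i mod m) \<otimes> y [^] (j mod k)" using pow_mod_eq xy by simp
    then show ?thesis using m0 mod_less_divisor by blast
  qed
  have "x [^] (1 :: nat) \<otimes> y [^] (0 :: nat) \<in> H" "x [^] (0 :: nat) \<otimes> y [^] (1 :: nat) \<in> H"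
    unfolding H(3) by blast+
  then have xyH: "x \<in> H" "y \<in> H" using xy by (simp_all add: nat_pow_eone)
  have "H \<noteq> carrier G" using H(2) ord by (auto simp: order_def)
  then obtain b where b: "b \<in> carrier G" "b \<notin> H" using subset by blast
  have bH: "b \<otimes> h \<notin> H" if "h \<in> H" for h
  proof
    assume "b \<otimes> h \<in> H"
    then have "b \<otimes> h \<otimes> inv h \<in> H" using that by blast
    then show False using b that by (simp add: m_assoc)
  qed
  have conj: "\<exists>i<m. \<exists>j<k. b \<otimes> h = x [^] i \<otimes> y [^] j \<otimes> b" if "h \<in> H" for h
  proof -
    have "b \<otimes> h \<otimes> inv b \<in> H"
      using index_2_mult_inv[OF H(1,2) ord _ b(1) bH[OF that] b(2)] b(1) that by simp
    then obtain i j where "i < m" "j < k" "b \<otimes> h \<otimes> inv b = x [^] i \<otimes> y [^] j" using nf by blast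
    moreover have "b \<otimes> h = b \<otimes> h \<otimes> inv b \<otimes> b"
      using b(1) that by (simp add: m_assoc)
    ultimately show ?thesis by metis
  qed
  have "b \<otimes> b \<in> H"
  proof (rule ccontr)
    assume "b \<otimes> b \<notin> H"
    then have "b \<otimes> b \<otimes> inv b \<in> H" using index_2_mult_inv[OF H(1,2) ord _ b(1) _ b(2)] b(1) by simp
    then show False using b by (simp add: m_assoc)
  qed
  then obtain t u where tu: "t < m" "u < k" "b \<otimes> b = x [^] t \<otimes> y [^] u" using nf by blast
  obtain p q where pq: "p < m" "q < k" "b \<otimes> x = x [^] p \<otimes> y [^] q \<otimes> b" using conj xyH by blast
  \<comment> \<open>When y = 1 its conjugate is 1, so \<open>r\<close> can be taken as 0; this keeps
    the list of candidates short.\<close>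
  have "\<exists>r<m. \<exists>s<k. (k = 1 \<longrightarrow> r = 0) \<and> b \<otimes> y = x [^] r \<otimes> y [^] s \<otimes> b"
  proof (cases "k = 1")
    case True
    then have "y = \<one>" using xy by (simp add: nat_pow_eone)
    then show ?thesis using True m0 b(1) by (intro exI[of _ 0]) simp
  next
    case False
    then show ?thesis using conj xyH by blast
  qed
  then obtain r s where rs: "r < m" "s < k" "k = 1 \<longrightarrow> r = 0" "b \<otimes> y = x [^] r \<otimes> y [^] s \<otimes> b" by blast
  have "pc_rels G (m, k, p, q, r, s, t, u) x y b"
    unfolding pc_rels.simps using m xy b(1) pq(3) rs(4) tu(3) by blast
  moreover have "carrier G \<subseteq> generate G {x, y, b}"
  proof
    have "{x, y, b} \<subseteq> carrier G" using xy b by simp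
    then interpret S: subgroup "generate G {x, y, b}" G by (rule generate_is_subgroup)
    have "g [^] j \<in> generate G {x, y, b}" if "g \<in> {x, y}" for g and j :: nat
      using that by (induction j) (auto intro: generate.incl)
    then have "H \<subseteq> generate G {x, y, b}" unfolding H(3) by blast
    moreover have "b \<in> generate G {x, y, b}" by (auto intro: generate.incl)
    ultimately have *: "h \<otimes> b \<in> generate G {x, y, b}" "h \<in> generate G {x, y, b}" if "h \<in> H" for h
      using that by blast+
    fix g assume g: "g \<in> carrier G"
    show "g \<in> generate G {x, y, b}"
    proof (cases "g \<in> H")
      case False
      then have "g \<otimes> inv b \<in> H" using index_2_mult_inv[OF H(1,2) ord g b(1) _ b(2)] by blast
      then have "g \<otimes> inv b \<otimes> b \<in> generate G {x, y, b}" by (rule *)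
      then show ?thesis using g b(1) by (simp add: m_assoc)
    qed (rule *)
  qed
  ultimately have "pc_gen G (m, k, p, q, r, s, t, u) x y b" by (simp add: pc_gen_def)
  then show ?thesis using pq rs tu by blast
qed

lemma abelian_subgroup_of_pair:
  fixes m k :: nat
  assumes fin: "finite (carrier G)" and m: "m > 0" "k > 0"
    and xy: "x \<in> carrier G" "y \<in> carrier G" "x [^] m = \<one>" "y [^] k = \<one>" "y \<otimes> x = x \<otimes> y"
    and inj: "inj_on (\<lambda>(i, j). x [^] i \<otimes> y [^] j) ({..<m} \<times> {..<k})"
  defines "H \<equiv> {x [^] (i :: nat) \<otimes> y [^] (j :: nat) |i j. True}"
  shows "subgroup H G" "card H = m * k"
proof -
  have sub: "H \<subseteq> carrier G" unfolding H_def using xy by auto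
  show "subgroup H G"
  proof (rule finite_closed_subgroup)
    show "finite H" using sub fin by (rule finite_subset)
    have "x [^] (0 :: nat) \<otimes> y [^] (0 :: nat) \<in> H" unfolding H_def by blast
    then show "\<one> \<in> H" by simp
    fix g h assume "g \<in> H" "h \<in> H"
    then obtain i j i' j' :: nat where "g = x [^] i \<otimes> y [^] j" "h = x [^] i' \<otimes> y [^] j'"
      unfolding H_def by blast
    moreover have "x [^] i \<otimes> y [^] j \<otimes> (x [^] i' \<otimes> y [^] j') = x [^] (i + i') \<otimes> y [^] (j + j')"
    proof -
      have "y [^] j \<otimes> x [^] i' = x [^] i' \<otimes> y [^] j"
        by (metis group_commutes_pow nat_pow_closed xy(1,2,5))
      then have "x [^] i \<otimes> (y [^] j \<otimes> x [^] i') \<otimes> y [^] j' = x [^] i \<otimes> x [^] i' \<otimes> (y [^] j \<otimes> y [^] j')"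
        using xy(1,2) by (simp add: m_assoc)
      then show ?thesis using xy(1,2) by (simp add: m_assoc nat_pow_mult)
    qed
    ultimately show "g \<otimes> h \<in> H" unfolding H_def by blast
  qed (rule sub)
  have "H = (\<lambda>(i, j). x [^] i \<otimes> y [^] j) ` ({..<m} \<times> {..<k})"
  proof
    show "H \<subseteq> (\<lambda>(i, j). x [^] i \<otimes> y [^] j) ` ({..<m} \<times> {..<k})"
    proof
      fix g assume "g \<in> H"
      then obtain i j :: nat where "g = x [^] i \<otimes> y [^] j" unfolding H_def by blast
      then have "g = x [^] (i mod m) \<otimes> y [^] (j mod k)" using pow_mod_eq xy by simp
      then show "g \<in> (\<lambda>(i, j). x [^] i \<otimes> y [^] j) ` ({..<m} \<times> {..<k})"
        using m by (intro image_eqI[of _ _ "(i mod m, j mod k)"]) auto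
    qed
  qed (auto simp: H_def)
  then have "card H = card ({..<m} \<times> {..<k})" using card_image[OF inj] by (rule ssubst)
  then show "card H = m * k" unfolding card_cartesian_product card_lessThan .
qed

lemma not_comm_square:
  assumes "\<not> comm_group G"
  shows "\<exists>g\<in>carrier G. g \<otimes> g \<noteq> \<one>"
proof (rule ccontr)
  assume "\<not> (\<exists>g\<in>carrier G. g \<otimes> g \<noteq> \<one>)"
  then have i: "inv g = g" if "g \<in> carrier G" for g using that inv_equality by blast
  have "g \<otimes> h = h \<otimes> g" if "g \<in> carrier G" "h \<in> carrier G" for g h
    using i[of "g \<otimes> h"] i[OF that(1)] i[OF that(2)] inv_mult_group[OF that] that
    by (simp only: m_closed)
  then show False using assms group_comm_groupI by blast
qed

lemma l_inv_cancel: "g \<in> carrier G \<Longrightarrow> h \<in> carrier G \<Longrightarrow> inv g \<otimes> (g \<otimes> h) = h"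
  by (simp add: m_assoc[symmetric])

section \<open>Commuting elements of orders 4 and 2 in exponent four\<close>

text \<open>The abelian subgroup of order 8 just found may be elementary abelian. In that case it is
  replaced: an element g of order 4 outside it commutes with some involution of it that is not a
  power of g.\<close>

lemma pair_4_2:
  assumes ex: "\<And>g. g \<in> carrier G \<Longrightarrow> g [^] (4 :: nat) = \<one>"
    and nab: "\<not> comm_group G" and ord: "order G = 16"
  obtains x y where "x \<in> carrier G" "y \<in> carrier G" "x [^] (2 :: nat) \<noteq> \<one>" "y [^] (2 :: nat) = \<one>"
    "y \<otimes> x = x \<otimes> y" "\<And>i :: nat. y \<noteq> x [^] i"
proof -
  note main = that
  obtain N where N: "subgroup N G" "card N = 8" and comm: "\<And>g h. g \<in> N \<Longrightarrow> h \<in> N \<Longrightarrow> g \<otimes> h = h \<otimes> g"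
    using abelian_subgroup_order_8[OF nab ord] by blast
  interpret subgroup N G by fact
  have fin: "finite N" using N(2) card.infinite by fastforce
  have sq: "g [^] (2 :: nat) = g \<otimes> g" if "g \<in> carrier G" for g
    using that by (simp add: numeral_2_eq_2)
  have pow: "g [^] i \<in> {\<one>, g, g \<otimes> g, g \<otimes> g \<otimes> g}" if "g \<in> carrier G" for g and i :: nat
  proof -
    have "i mod 4 \<in> {0, 1, 2, 3}" by auto
    moreover have "g [^] (i mod 4) = g [^] i" by (rule pow_mod_eq[OF that ex[OF that]])
    ultimately show ?thesis using that by (auto simp: numeral_2_eq_2 numeral_3_eq_3)
  qed
  have four: "g \<otimes> g \<otimes> (g \<otimes> g) = \<one>" if "g \<in> carrier G" for g
    using ex[OF that] that by (simp add: numeral_eq_Suc m_assoc)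
  show thesis
  proof (cases "\<exists>h\<in>N. h \<otimes> h \<noteq> \<one>")
    case True
    then obtain h where h: "h \<in> N" "h \<otimes> h \<noteq> \<one>" by blast
    define A where "A = {\<one>, h, h \<otimes> h, h \<otimes> h \<otimes> h}"
    have hc: "h \<in> carrier G" using h(1) by simp
    then have hhc: "h \<otimes> h \<in> carrier G" by simp
    have AA: "a \<otimes> a' \<in> A" if "a \<in> A" "a' \<in> A" for a a'
    proof -
      obtain i j :: nat where "a = h [^] i" "a' = h [^] j"
      proof -
        have "\<exists>i :: nat. a = h [^] i" if "a \<in> A" for a
        proof -
          have "\<one> = h [^] (0 :: nat)" "h = h [^] (1 :: nat)" "h \<otimes> h = h [^] (2 :: nat)"
            "h \<otimes> h \<otimes> h = h [^] (3 :: nat)"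
            using hc by (simp_all add: numeral_2_eq_2 numeral_3_eq_3)
          then show ?thesis using that unfolding A_def by blast
        qed
        then show thesis using that \<open>a \<in> A\<close> \<open>a' \<in> A\<close> by blast
      qed
      then have "a \<otimes> a' = h [^] (i + j)" using hc by (simp add: nat_pow_mult)
      then show ?thesis using pow[OF hc, of "i + j"] by (simp only: A_def)
    qed
    have cA: "card A \<le> 4" and finA: "finite A" by (simp_all add: A_def card_insert_if)
    have "h \<otimes> h \<in> N" "h \<otimes> h \<otimes> h \<in> N" using h(1) by simp_all
    then have AN: "A \<subseteq> N" using h(1) by (simp add: A_def)
    then have Ac: "A \<subseteq> carrier G" using subset by blast
    have A1: "\<one> \<in> A" "h \<in> A" by (simp_all add: A_def)
    have "\<not> N \<subseteq> A"
    proof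
      assume "N \<subseteq> A"
      then have "card N \<le> card A" by (intro card_mono finA)
      then show False using cA N(2) by simp
    qed
    then obtain y where y: "y \<in> N" "y \<notin> A" by blast
    have yc: "y \<in> carrier G" using y by simp
    have Asub: "subgroup A G"
      by (rule finite_closed_subgroup[OF finA Ac A1(1) AA])
    note A_inv = subgroup.m_inv_closed[OF Asub]
    have card4: "card A = 4"
    proof -
      have 1: "h \<noteq> \<one>" using h(2) by auto
      have 2: "h \<otimes> h \<otimes> h \<noteq> \<one>"
      proof
        assume "h \<otimes> h \<otimes> h = \<one>"
        then have "h \<otimes> h \<otimes> h \<otimes> h = h" using hc by simp
        moreover have "h \<otimes> h \<otimes> h \<otimes> h = h \<otimes> h \<otimes> (h \<otimes> h)" using hc by (simp add: m_assoc)
        ultimately show False using four[OF hc] 1 by simp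
      qed
      have 3: "h \<otimes> h \<noteq> h" "h \<otimes> h \<otimes> h \<noteq> h" "h \<otimes> h \<otimes> h \<noteq> h \<otimes> h"
        using l_cancel_one[OF hc hc] r_cancel_one[OF hc hhc] l_cancel_one[OF hhc hc] 1 h(2) by blast+
      show ?thesis
        unfolding A_def using 1 2 3 h(2) 1[symmetric] 2[symmetric] 3[symmetric] h(2)[symmetric]
        by (simp only: card_insert_disjoint insert_iff empty_iff finite.intros card.empty simp_thms)
    qed
    let ?B = "(\<lambda>a. a \<otimes> y) ` A"
    have "inj_on (\<lambda>a. a \<otimes> y) A" using yc Ac by (auto simp: inj_on_def subset_iff)
    then have cB: "card ?B = 4" using card4 by (simp only: card_image)
    have disj: "A \<inter> ?B = {}"
    proof (rule ccontr)
      assume "A \<inter> ?B \<noteq> {}"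
      then obtain a where a: "a \<in> A" "a \<otimes> y \<in> A" by blast
      then have "inv a \<otimes> (a \<otimes> y) \<in> A" by (blast intro: AA A_inv)
      moreover have "inv a \<otimes> (a \<otimes> y) = y"
        proof -
        have "a \<in> carrier G" using a(1) Ac by blast
        then show ?thesis using yc by (simp add: m_assoc[symmetric])
      qed
      ultimately show False using y(2) by simp
    qed
    have "A \<union> ?B = N"
    proof (rule card_subset_eq[OF fin])
      show "A \<union> ?B \<subseteq> N" using AN y(1) by blast
      have "card (A \<union> ?B) = card A + card ?B" by (rule card_Un_disjoint) (use disj finA in auto)
      then show "card (A \<union> ?B) = card N" using card4 cB N(2) by simp
    qed
    moreover have "y \<otimes> y \<in> N" using y by blast
    moreover have "y \<otimes> y \<notin> ?B"
    proof
      assume "y \<otimes> y \<in> ?B"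
      then obtain a where a: "a \<in> A" "y \<otimes> y = a \<otimes> y" by blast
      moreover have "a \<in> carrier G" using a(1) Ac by blast
      ultimately have "y = a" using yc by simp
      then show False using a y by simp
    qed
    ultimately have yy: "y \<otimes> y \<in> A" by blast
    have hy: "h \<otimes> y = y \<otimes> h" by (rule comm) (use h y in auto)
    \<comment> \<open>The square of y lies in \<langle>h\<rangle> and is neither h nor
      \<open>h^3\<close>, since then \<open>y^4 = 1\<close> would give
      \<open>h^2 = 1\<close>.\<close>
    have "y \<otimes> y = \<one> \<or> y \<otimes> y = h \<otimes> h"
    proof -
      have "y \<otimes> y \<noteq> h" using four[OF yc] h(2) by auto
      moreover have "y \<otimes> y \<noteq> h \<otimes> h \<otimes> h"
      proof
        assume "y \<otimes> y = h \<otimes> h \<otimes> h"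
        then have "h \<otimes> h \<otimes> h \<otimes> (h \<otimes> h \<otimes> h) = \<one>" using four[OF yc] by simp
        moreover have "h \<otimes> h \<otimes> h \<otimes> (h \<otimes> h \<otimes> h) = h \<otimes> h \<otimes> (h \<otimes> h) \<otimes> (h \<otimes> h)"
          using hc by (simp add: m_assoc)
        ultimately show False using four[OF hc] h(2) hc by simp
      qed
      ultimately show ?thesis using yy unfolding A_def by blast
    qed
    then consider "y \<otimes> y = \<one>" | "y \<otimes> y = h \<otimes> h" by blast
    then show thesis
    proof cases
      case 1
      show thesis
      proof (rule that[of h y])
        show "y \<noteq> h [^] i" for i :: nat using pow[OF hc, of i] y(2) unfolding A_def by metis
      qed (simp_all only: hc yc h(2) 1 hy sq not_False_eq_True)
    next
      case 2
      \<comment> \<open>If y and h have equal squares, hy is an involution and can replace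
        y.\<close>
      have "h \<otimes> y \<otimes> (h \<otimes> y) = h \<otimes> (y \<otimes> h) \<otimes> y" using hc yc by (simp add: m_assoc)
      also have "\<dots> = h \<otimes> h \<otimes> (y \<otimes> y)" using hc yc by (simp add: hy[symmetric] m_assoc)
      also have "\<dots> = \<one>" using 2 four[OF hc] by simp
      finally have 3: "h \<otimes> y \<otimes> (h \<otimes> y) = \<one>" .
      have "h \<otimes> y \<notin> A"
      proof
        assume "h \<otimes> y \<in> A"
        then have "inv h \<otimes> (h \<otimes> y) \<in> A" by (rule AA[OF A_inv[OF A1(2)]])
        then show False using y(2) hc yc by (simp add: m_assoc[symmetric])
      qed
      then have 4: "h \<otimes> y \<noteq> h [^] i" for i :: nat using pow[OF hc, of i] unfolding A_def by metis
      have hyc: "h \<otimes> y \<in> carrier G" using hc yc by simp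
      have 5: "h \<otimes> y \<otimes> h = h \<otimes> (h \<otimes> y)" using hc yc by (simp add: m_assoc hy[symmetric])
      show thesis
        by (rule that[of h "h \<otimes> y"]) (simp_all only: hc yc hyc h(2) 3 4 5 sq not_False_eq_True)
    qed
  next
    case False
    then have inv2: "n \<otimes> n = \<one>" if "n \<in> N" for n using that by blast
    obtain g where g: "g \<in> carrier G" "g \<otimes> g \<noteq> \<one>"
      using not_comm_square[OF nab] by blast
    define c where "c = g \<otimes> g"
    have gN: "g \<notin> N" using g inv2 by blast
    have cN: "c \<in> N"
    proof (rule ccontr)
      assume "c \<notin> N"
      then have "c \<otimes> inv g \<in> N" using index_2_mult_inv[OF N ord _ g(1) _ gN] g by (simp add: c_def)
      then show False using g gN by (simp add: c_def m_assoc)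
    qed
    \<comment> \<open>Such an involution n is no power of g, since g and its cube lie outside N;
      hence (g, n) is the required pair.\<close>
    have fix_N: "thesis" if n: "n \<in> N" "n \<noteq> \<one>" "n \<noteq> c" "g \<otimes> n = n \<otimes> g" for n
    proof (rule main[of g n])
      have "g \<otimes> g \<otimes> g \<notin> N"
      proof
        assume "g \<otimes> g \<otimes> g \<in> N"
        then have "c \<otimes> g \<in> N" by (simp only: c_def)
        then have "inv c \<otimes> (c \<otimes> g) \<in> N" using cN by blast
        then show False using l_inv_cancel[OF mem_carrier[OF cN] g(1)] gN by simp
      qed
      then show "n \<noteq> g [^] i" for i :: nat
        using pow[OF g(1), of i] n gN by (auto simp: c_def)
    qed (use g n inv2 sq in auto)
    \<comment> \<open>The product of n with its conjugate under g. As the square of g lies in the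
      abelian subgroup N, conjugation by g is an involution there, so \<open>f n\<close> is fixed by
      it.\<close>
    define f where "f = (\<lambda>n. n \<otimes> (g \<otimes> n \<otimes> inv g))"
    have conjN: "g \<otimes> n \<otimes> inv g \<in> N" if n: "n \<in> N" for n
    proof (rule index_2_mult_inv[OF N ord _ g(1) _ gN])
      show "g \<otimes> n \<notin> N"
      proof
        assume "g \<otimes> n \<in> N"
        then have "g \<otimes> n \<otimes> inv n \<in> N" using n by blast
        then show False using n g gN by (simp add: m_assoc)
      qed
    qed (use g n in auto)
    have fN: "f n \<in> N" if "n \<in> N" for n using that conjN by (auto simp: f_def)
    have f_fix: "g \<otimes> f n = f n \<otimes> g" if n: "n \<in> N" for n
    proof -
      have nc: "n \<in> carrier G" using n by simp
      have "g \<otimes> f n = (g \<otimes> n \<otimes> inv g) \<otimes> (c \<otimes> n \<otimes> inv g)"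
        using nc g(1) by (simp add: f_def c_def m_assoc l_inv_cancel)
      also have "\<dots> = (g \<otimes> n \<otimes> inv g) \<otimes> (n \<otimes> c \<otimes> inv g)"
        by (simp only: comm[OF cN n])
      also have "\<dots> = (g \<otimes> n \<otimes> inv g) \<otimes> n \<otimes> g"
        using nc g(1) by (simp add: c_def m_assoc)
      also have "\<dots> = f n \<otimes> g"
        by (simp only: f_def comm[OF n conjN[OF n]])
      finally show ?thesis .
    qed
    have f1: "g \<otimes> n = n \<otimes> g" if n: "n \<in> N" "f n = \<one>" for n
    proof -
      have nc: "n \<in> carrier G" using n by simp
      have "n \<otimes> (g \<otimes> n \<otimes> inv g) = n \<otimes> n" using n(2) inv2[OF n(1)] by (simp add: f_def)
      then have "g \<otimes> n \<otimes> inv g = n" using nc g(1) by simp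
      moreover have "g \<otimes> n = g \<otimes> n \<otimes> inv g \<otimes> g" using nc g(1) by (simp add: m_assoc)
      ultimately show ?thesis by (simp only:)
    qed
    have fc: "g \<otimes> n = n \<otimes> c \<otimes> g" if n: "n \<in> N" "f n = c" for n
    proof -
      have nc: "n \<in> carrier G" "c \<in> carrier G" using n cN by simp_all
      have "n \<otimes> (n \<otimes> (g \<otimes> n \<otimes> inv g)) = n \<otimes> c" using n(2) by (simp add: f_def)
      moreover have "n \<otimes> (n \<otimes> (g \<otimes> n \<otimes> inv g)) = n \<otimes> n \<otimes> (g \<otimes> n \<otimes> inv g)"
        using nc g(1) by (simp add: m_assoc)
      moreover have "n \<otimes> n \<otimes> (g \<otimes> n \<otimes> inv g) = g \<otimes> n \<otimes> inv g"
        unfolding inv2[OF n(1)] using nc g(1) by simp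
      ultimately have "g \<otimes> n \<otimes> inv g = n \<otimes> c" by (simp only:)
      moreover have "g \<otimes> n = g \<otimes> n \<otimes> inv g \<otimes> g" using nc g(1) by (simp add: m_assoc)
      ultimately show ?thesis by (simp only:)
    qed
    \<comment> \<open>If \<open>f n = 1\<close>, then n itself commutes with g; otherwise
      \<open>f n\<close> does. In the absence of a suitable pair only \<open>f n = c\<close>
      remains.\<close>
    have step: "f n = c" if "n \<in> N" "n \<noteq> \<one>" "n \<noteq> c" "\<not> thesis" for n
      using fix_N[of n] fix_N[of "f n"] f1[of n] f_fix[of n] fN[of n] that by blast
    show thesis
    proof (rule ccontr)
      assume nt: "\<not> thesis"
      have more: "\<exists>n\<in>N. n \<notin> S" if "card S < 8" "finite S" for S
      proof (rule ccontr)
        assume "\<not> (\<exists>n\<in>N. n \<notin> S)"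
        then have "card N \<le> card S" by (intro card_mono \<open>finite S\<close>) blast
        then show False using \<open>card S < 8\<close> N(2) by simp
      qed
      obtain n where n: "n \<in> N" "n \<noteq> \<one>" "n \<noteq> c"
      proof -
        have "card {\<one>, c} < 8" by (simp add: card_insert_if)
        from more[OF this] show thesis using that by blast
      qed
      \<comment> \<open>A second element outside {1, c, n, nc}: conjugation by g multiplies both n
        and n' by c, so it fixes their product, which is neither 1 nor c.\<close>
      obtain n' where n': "n' \<in> N" "n' \<noteq> \<one>" "n' \<noteq> c" "n' \<noteq> n" "n' \<noteq> n \<otimes> c"
      proof -
        have "card {\<one>, c, n, n \<otimes> c} < 8" by (simp add: card_insert_if)
        from more[OF this] show thesis using that by blast
      qed
      have cc: "n \<in> carrier G" "n' \<in> carrier G" "c \<in> carrier G" using n n' cN by simp_all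
      have "g \<otimes> (n \<otimes> n') = n \<otimes> c \<otimes> (g \<otimes> n')"
        using fc[OF n(1) step[OF n nt]] cc g(1) by (simp add: m_assoc[symmetric])
      also have "\<dots> = n \<otimes> (c \<otimes> n') \<otimes> c \<otimes> g"
        using fc[OF n'(1) step[OF n'(1-3) nt]] cc g(1) by (simp add: m_assoc)
      also have "\<dots> = n \<otimes> (n' \<otimes> c) \<otimes> c \<otimes> g" by (simp only: comm[OF cN n'(1)])
      also have "\<dots> = n \<otimes> n' \<otimes> (c \<otimes> c) \<otimes> g" using cc g(1) by (simp add: m_assoc)
      also have "\<dots> = n \<otimes> n' \<otimes> g" using inv2[OF cN] cc by simp
      finally have "g \<otimes> (n \<otimes> n') = n \<otimes> n' \<otimes> g" .
      moreover have "n \<otimes> n' \<noteq> \<one>"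
      proof
        assume "n \<otimes> n' = \<one>"
        then have "n \<otimes> n' = n \<otimes> n" using inv2[OF n(1)] by (simp only:)
        then show False using n'(4) cc by simp
      qed
      moreover have "n \<otimes> n' \<noteq> c"
      proof
        assume "n \<otimes> n' = c"
        then have "n \<otimes> (n \<otimes> n') = n \<otimes> c" by simp
        then show False using n'(5) inv2[OF n(1)] cc by (simp add: m_assoc[symmetric])
      qed
      ultimately show False using fix_N[of "n \<otimes> n'"] n n' nt by blast
    qed
  qed
qed

end

text \<open>A few instances of associativity; in the non-abelian case they leave only 28 parameters.\<close>

definition pc_consistent :: "pc_param \<Rightarrow> bool" where
  "pc_consistent P \<longleftrightarrow>
    (let \<mu> = tmul P; y = fst P mod 8 in
      if \<mu> 8 (\<mu> y y) = \<mu> (\<mu> 8 y) y then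
        if \<mu> (\<mu> 8 8) 1 = \<mu> 8 (\<mu> 8 1) then
          if \<mu> (\<mu> 8 8) y = \<mu> 8 (\<mu> 8 y) then \<mu> (\<mu> 8 8) 8 = \<mu> 8 (\<mu> 8 8)
          else False
        else False
      else False)"

definition pc_noncomm :: "pc_param \<Rightarrow> bool" where
  "pc_noncomm P \<longleftrightarrow> tmul P 8 1 \<noteq> tmul P 1 8 \<or> tmul P 8 (fst P mod 8) \<noteq> tmul P (fst P mod 8) 8"

definition pc_params :: "pc_param list" where
  "pc_params =
    [(8, 1, p, 0, 0, 0, t, 0). p \<leftarrow> [0..<8], t \<leftarrow> [0..<8]] @
    [(4, 2, p, q, r, s, t, u). p \<leftarrow> [0..<4], q \<leftarrow> [0..<2], r \<leftarrow> [0..<4], s \<leftarrow> [0..<2],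
      t \<leftarrow> [0..<4], u \<leftarrow> [0..<2]]"

definition pc_types :: "pc_param list" where
  "pc_types = [(8, 1, 7, 0, 0, 0, 0, 0),
    (8, 1, 3, 0, 0, 0, 0, 0),
    (8, 1, 5, 0, 0, 0, 0, 0),
    (8, 1, 7, 0, 0, 0, 4, 0),
    (4, 2, 3, 0, 0, 1, 0, 0),
    (4, 2, 3, 0, 0, 1, 2, 0),
    (4, 2, 3, 0, 0, 1, 0, 1),
    (4, 2, 1, 1, 0, 1, 0, 0),
    (4, 2, 3, 0, 2, 1, 0, 0)]"

text \<open>
  Every entry consists of the parameters of a group, its type, new generators of that type, and
  the exponents of the old generators in the new ones.
\<close>

definition pc_table :: "(pc_param \<times> pc_param \<times> (nat \<times> nat \<times> nat) \<times>
    (nat \<times> nat \<times> nat) \<times> (nat \<times> nat \<times> nat) \<times> (nat \<times> nat \<times> nat)) list" where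
  "pc_table =
    [((8, 1, 3, 0, 0, 0, 0, 0), (8, 1, 3, 0, 0, 0, 0, 0), (1, 0, 8), ((1, 0, 0), (0, 0, 0), (0, 0, 1))),
     ((8, 1, 3, 0, 0, 0, 4, 0), (8, 1, 3, 0, 0, 0, 0, 0), (1, 0, 9), ((1, 0, 0), (0, 0, 0), (7, 0, 1))),
     ((8, 1, 5, 0, 0, 0, 0, 0), (8, 1, 5, 0, 0, 0, 0, 0), (1, 0, 8), ((1, 0, 0), (0, 0, 0), (0, 0, 1))),
     ((8, 1, 5, 0, 0, 0, 2, 0), (8, 1, 5, 0, 0, 0, 0, 0), (1, 0, 9), ((1, 0, 0), (0, 0, 0), (7, 0, 1))),
     ((8, 1, 5, 0, 0, 0, 4, 0), (8, 1, 5, 0, 0, 0, 0, 0), (1, 0, 10), ((1, 0, 0), (0, 0, 0), (6, 0, 1))),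
     ((8, 1, 5, 0, 0, 0, 6, 0), (8, 1, 5, 0, 0, 0, 0, 0), (1, 0, 11), ((1, 0, 0), (0, 0, 0), (5, 0, 1))),
     ((8, 1, 7, 0, 0, 0, 0, 0), (8, 1, 7, 0, 0, 0, 0, 0), (1, 0, 8), ((1, 0, 0), (0, 0, 0), (0, 0, 1))),
     ((8, 1, 7, 0, 0, 0, 4, 0), (8, 1, 7, 0, 0, 0, 4, 0), (1, 0, 8), ((1, 0, 0), (0, 0, 0), (0, 0, 1))),
     ((4, 2, 1, 0, 2, 1, 0, 0), (4, 2, 3, 0, 2, 1, 0, 0), (5, 4, 8), ((1, 1, 0), (0, 1, 0), (0, 0, 1))),
     ((4, 2, 1, 0, 2, 1, 1, 0), (8, 1, 5, 0, 0, 0, 0, 0), (8, 0, 4), ((2, 0, 0), (0, 0, 1), (1, 0, 0))),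
     ((4, 2, 1, 0, 2, 1, 2, 0), (4, 2, 3, 0, 2, 1, 0, 0), (5, 4, 9), ((1, 1, 0), (0, 1, 0), (3, 1, 1))),
     ((4, 2, 1, 0, 2, 1, 3, 0), (8, 1, 5, 0, 0, 0, 0, 0), (8, 0, 4), ((6, 0, 0), (0, 0, 1), (1, 0, 0))),
     ((4, 2, 1, 1, 0, 1, 0, 0), (4, 2, 1, 1, 0, 1, 0, 0), (1, 4, 8), ((1, 0, 0), (0, 1, 0), (0, 0, 1))),
     ((4, 2, 1, 1, 0, 1, 0, 1), (4, 2, 3, 0, 0, 1, 0, 1), (8, 2, 1), ((0, 0, 1), (2, 0, 0), (1, 0, 0))),
     ((4, 2, 1, 1, 0, 1, 2, 0), (4, 2, 3, 0, 0, 1, 0, 1), (9, 2, 1), ((0, 0, 1), (2, 0, 0), (3, 1, 1))),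
     ((4, 2, 1, 1, 0, 1, 2, 1), (4, 2, 1, 1, 0, 1, 0, 0), (1, 4, 9), ((1, 0, 0), (0, 1, 0), (3, 0, 1))),
     ((4, 2, 3, 0, 0, 1, 0, 0), (4, 2, 3, 0, 0, 1, 0, 0), (1, 4, 8), ((1, 0, 0), (0, 1, 0), (0, 0, 1))),
     ((4, 2, 3, 0, 0, 1, 0, 1), (4, 2, 3, 0, 0, 1, 0, 1), (1, 4, 8), ((1, 0, 0), (0, 1, 0), (0, 0, 1))),
     ((4, 2, 3, 0, 0, 1, 2, 0), (4, 2, 3, 0, 0, 1, 2, 0), (1, 4, 8), ((1, 0, 0), (0, 1, 0), (0, 0, 1))),
     ((4, 2, 3, 0, 0, 1, 2, 1), (4, 2, 3, 0, 0, 1, 0, 1), (1, 6, 8), ((1, 0, 0), (2, 1, 0), (0, 0, 1))),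
     ((4, 2, 3, 0, 2, 1, 0, 0), (4, 2, 3, 0, 2, 1, 0, 0), (1, 4, 8), ((1, 0, 0), (0, 1, 0), (0, 0, 1))),
     ((4, 2, 3, 0, 2, 1, 1, 1), (8, 1, 5, 0, 0, 0, 0, 0), (8, 0, 4), ((2, 0, 1), (0, 0, 1), (1, 0, 0))),
     ((4, 2, 3, 0, 2, 1, 2, 0), (4, 2, 3, 0, 2, 1, 0, 0), (1, 4, 12), ((1, 0, 0), (0, 1, 0), (0, 1, 1))),
     ((4, 2, 3, 0, 2, 1, 3, 1), (8, 1, 5, 0, 0, 0, 0, 0), (8, 0, 4), ((6, 0, 1), (0, 0, 1), (1, 0, 0))),
     ((4, 2, 3, 1, 0, 1, 0, 0), (4, 2, 1, 1, 0, 1, 0, 0), (1, 6, 8), ((1, 0, 0), (2, 1, 0), (0, 0, 1))),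
     ((4, 2, 3, 1, 0, 1, 0, 1), (4, 2, 1, 1, 0, 1, 0, 0), (1, 6, 9), ((1, 0, 0), (2, 1, 0), (3, 0, 1))),
     ((4, 2, 3, 1, 0, 1, 2, 0), (4, 2, 3, 0, 0, 1, 0, 1), (9, 2, 1), ((0, 0, 1), (2, 1, 0), (3, 1, 1))),
     ((4, 2, 3, 1, 0, 1, 2, 1), (4, 2, 3, 0, 0, 1, 0, 1), (8, 2, 1), ((0, 0, 1), (2, 1, 0), (1, 0, 0)))]"

text \<open>All 576 candidates are evaluated. Only this inclusion matters for the classification: a
  candidate realized by a non-abelian group must be among the keys of the table.\<close>

lemma pc_consistent_table:
  "list_all (\<lambda>P. if pc_consistent P then if pc_noncomm P then P \<in> set (map fst pc_table) else True else True)
    pc_params"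
  by code_simp

lemma pc_table_check: "list_all (\<lambda>(P, T, n, es). pc_check P T n es \<and> T \<in> set pc_types) pc_table"
  by code_simp

context group
begin

text \<open>Two passes through centralizers: first every element commutes with the generators, then
  with everything they generate.\<close>

lemma comm_group_of_generators:
  assumes "{x, y, b} \<subseteq> carrier G" "carrier G \<subseteq> generate G {x, y, b}"
    and "y \<otimes> x = x \<otimes> y" "b \<otimes> x = x \<otimes> b" "b \<otimes> y = y \<otimes> b"
  shows "comm_group G"
proof -
  have "generate G {x, y, b} \<subseteq> {g \<in> carrier G. \<forall>a\<in>{x, y, b}. g \<otimes> a = a \<otimes> g}"
    by (rule generate_subgroup_incl[OF _ subgroup_commuting[OF subgroup_self assms(1)]])
      (use assms(1,3-5) in auto)
  then have *: "g \<otimes> a = a \<otimes> g" if "g \<in> carrier G" "a \<in> {x, y, b}" for g a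
    using assms(2) that by blast
  have "generate G {x, y, b} \<subseteq> {g \<in> carrier G. \<forall>a\<in>carrier G. g \<otimes> a = a \<otimes> g}"
    by (rule generate_subgroup_incl[OF _ subgroup_commuting[OF subgroup_self subset_refl]])
      (use assms(1) *[symmetric] in auto)
  then have "g \<otimes> a = a \<otimes> g" if "g \<in> carrier G" "a \<in> carrier G" for g a
    using assms(2) that by blast
  then show ?thesis using group_comm_groupI by blast
qed

text \<open>Order 16 makes the numbering of the elements injective, so \<open>tmul P\<close>
  inherits associativity from the group. If b commuted with x and y, the group would be
  abelian.\<close>

lemma pc_gen_consistent:
  assumes pc: "pc_gen G P x y b" and ord: "order G = 16" and nab: "\<not> comm_group G"
    and P: "fst P = 4 \<or> fst P = 8"
  shows "pc_consistent P" "pc_noncomm P"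
proof -
  let ?E = "pc_elem G P x y b"
  have rels: "pc_rels G P x y b" and gen: "carrier G \<subseteq> generate G {x, y, b}"
    using pc by (auto simp: pc_gen_def)
  have inj: "inj_on ?E {..<16}"
    using pc_gen_bij[OF pc ord] by (simp add: bij_betw_def)
  note mult = pc_elem_mult'[OF rels] and c = pc_elem_closed'[OF rels]
  have assoc: "tmul P (tmul P i j) l = tmul P i (tmul P j l)" if "i < 16" "j < 16" "l < 16" for i j l
  proof (rule inj_onD[OF inj])
    have "?E (tmul P (tmul P i j) l) = ?E i \<otimes> ?E j \<otimes> ?E l"
      using mult(1)[OF mult(2)[OF that(1,2)] that(3)] mult(1)[OF that(1,2)] by simp
    also have "\<dots> = ?E i \<otimes> (?E j \<otimes> ?E l)" using c by (simp add: m_assoc)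
    also have "\<dots> = ?E (tmul P i (tmul P j l))"
      using mult(1)[OF that(1) mult(2)[OF that(2,3)]] mult(1)[OF that(2,3)] by simp
    finally show "?E (tmul P (tmul P i j) l) = ?E (tmul P i (tmul P j l))" .
  qed (use mult(2) that in auto)
  have y: "fst P mod 8 < 16" using P by auto
  show "pc_consistent P"
    unfolding pc_consistent_def Let_def using assoc y by simp
  show "pc_noncomm P"
  proof (rule ccontr)
    assume "\<not> pc_noncomm P"
    then have t: "tmul P 8 1 = tmul P 1 8" "tmul P 8 (fst P mod 8) = tmul P (fst P mod 8) 8"
      by (auto simp: pc_noncomm_def)
    obtain m k p q r s t u where P': "P = (m, k, p, q, r, s, t, u)"
      by (cases P rule: prod_cases7) (metis surj_pair)
    note D = pc_relsD[OF rels[unfolded P']] and cl = pc_closed[OF rels[unfolded P']]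
    have E: "?E 1 = x \<and> ?E (fst P mod 8) = y \<and> ?E 8 = b"
    proof (cases "m = 4")
      case True
      then have "k = 2" using D(1) by simp
      then show ?thesis using cl unfolding pc_elem_def P' True fst_conv snd_conv by simp
    next
      case False
      then have "m = 8" using P by (simp add: P')
      moreover from this have "k = 1" using D(1) by simp
      moreover from this have "y = \<one>" using D(3) cl by (simp add: nat_pow_eone)
      ultimately show ?thesis using cl unfolding pc_elem_def P' fst_conv snd_conv by simp
    qed
    have "b \<otimes> x = x \<otimes> b"
      using mult(1)[of 8 1] mult(1)[of 1 8] t(1) E by simp
    moreover have "b \<otimes> y = y \<otimes> b"
      using mult(1)[of 8 "fst P mod 8"] mult(1)[of "fst P mod 8" 8] t(2) E y by simp
    ultimately have "comm_group G"
      using comm_group_of_generators[OF pc_rels_closed[OF rels] gen D(4)] by blast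
    then show False using nab by blast
  qed
qed

text \<open>An element whose fourth power is not 1 has order 8 and generates the abelian subgroup.
  Otherwise the exponent divides 4, and a commuting pair of orders 4 and 2 takes its place.\<close>

lemma ex_pc_gen:
  assumes nab: "\<not> comm_group G" and ord: "order G = 16"
  shows "\<exists>P\<in>set pc_params. \<exists>x y b. pc_gen G P x y b"
proof -
  have fin: "finite (carrier G)" using ord order_gt_0_iff_finite by simp
  show ?thesis
  proof (cases "\<exists>x\<in>carrier G. x [^] (4 :: nat) \<noteq> \<one>")
    case True
    then obtain x where x: "x \<in> carrier G" "x [^] (4 :: nat) \<noteq> \<one>" by blast
    have "ord x dvd 16" using ord_dvd_group_order[OF x(1)] ord by simp
    then have o: "ord x \<in> {1, 2, 4, 8, 16}" by (rule power_2_dvd_16)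
    have "\<not> ord x dvd 4" using x pow_eq_id by blast
    then have o': "ord x = 8 \<or> ord x = 16" using o by auto
    have pow1: "x [^] ord x = \<one>" by (rule pow_ord_eq_1[OF x(1)])
    have one: "\<one> [^] (1 :: nat) = \<one>" by simp
    have one_x: "\<one> \<otimes> x = x \<otimes> \<one>" using x by simp
    have pos: "ord x > 0" using o' by auto
    have inj: "inj_on (\<lambda>(i, j). x [^] i \<otimes> \<one> [^] j) ({..<ord x} \<times> {..<1 :: nat})"
    proof (rule inj_onI)
      fix u v assume "u \<in> {..<ord x} \<times> {..<1 :: nat}" "v \<in> {..<ord x} \<times> {..<1 :: nat}"
        and e: "(case u of (i, j) \<Rightarrow> x [^] i \<otimes> \<one> [^] j) = (case v of (i, j) \<Rightarrow> x [^] i \<otimes> \<one> [^] j)"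
      then obtain i i' where uv: "u = (i, 0)" "v = (i', 0)" "i < ord x" "i' < ord x" by auto
      then have "x [^] i = x [^] i'" using e x by simp
      then have "i = i'" using inj_onD[OF ord_inj[OF x(1)], of i i'] uv by auto
      then show "u = v" using uv by simp
    qed
    note H = abelian_subgroup_of_pair[OF fin pos zero_less_one x(1) one_closed pow1 one one_x inj]
    \<comment> \<open>An element of order 16 would make the group cyclic, hence abelian.\<close>
    have "ord x \<noteq> 16"
    proof
      assume o16: "ord x = 16"
      let ?H = "{x [^] (i :: nat) \<otimes> \<one> [^] (j :: nat) |i j. True}"
      have "?H = carrier G"
        using H(2) o16 ord subgroup.subset[OF H(1)] by (intro card_subset_eq[OF fin]) (auto simp: order_def)
      then have "\<exists>i :: nat. g = x [^] i" if "g \<in> carrier G" for g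
        using that x by (auto simp: set_eq_iff)
      moreover have "x [^] i \<otimes> x [^] j = x [^] j \<otimes> x [^] i" for i j :: nat
        using x by (simp add: nat_pow_mult add.commute)
      ultimately have "g \<otimes> h = h \<otimes> g" if "g \<in> carrier G" "h \<in> carrier G" for g h
        using that by metis
      then show False using nab group_comm_groupI by blast
    qed
    then have o8: "ord x = 8" using o' by blast
    have "\<exists>p<8. \<exists>q<1. \<exists>r<8. \<exists>s<1. \<exists>t<8. \<exists>u<1. \<exists>b. ((1 :: nat) = 1 \<longrightarrow> r = 0) \<and>
        pc_gen G (8, 1, p, q, r, s, t, u) x \<one> b"
      by (rule pc_gen_of_abelian_subgroup[OF ord _ x(1) one_closed _ one one_x H(1) _ HOL.refl])
        (use pow1 H(2) o8 in simp_all)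
    then obtain p t b where "p < 8" "t < 8" "pc_gen G (8, 1, p, 0, 0, 0, t, 0) x \<one> b" by auto
    moreover from this have "(8, 1, p, 0, 0, 0, t, 0) \<in> set pc_params"
      by (auto simp: pc_params_def image_iff)
    ultimately show ?thesis by blast
  next
    case False
    then have ex: "g [^] (4 :: nat) = \<one>" if "g \<in> carrier G" for g using that by blast
    obtain x y where xy: "x \<in> carrier G" "y \<in> carrier G" "x [^] (2 :: nat) \<noteq> \<one>"
      "y [^] (2 :: nat) = \<one>" "y \<otimes> x = x \<otimes> y" and ny: "\<And>i :: nat. y \<noteq> x [^] i"
      using pair_4_2[OF ex nab ord] by metis
    have "ord x dvd 4" "\<not> ord x dvd 2" using ex[OF xy(1)] xy pow_eq_id by blast+
    then have "ord x \<in> {1, 2, 4}"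
      using power_2_dvd_16[OF dvd_trans[of "ord x" 4 16]] dvd_imp_le[of "ord x" 4] by auto
    then have o4: "ord x = 4" using \<open>\<not> ord x dvd 2\<close> by auto
    \<comment> \<open>A coincidence would make y a power of x; this separates the two cosets of
      \<langle>x\<rangle> and gives injectivity.\<close>
    have no: "x [^] i \<noteq> x [^] i' \<otimes> y" if "i' < 4" for i i' :: nat
    proof
      assume "x [^] i = x [^] i' \<otimes> y"
      then have "x [^] (4 - i') \<otimes> x [^] i = x [^] (4 - i') \<otimes> x [^] i' \<otimes> y"
        using xy by (simp add: m_assoc)
      also have "\<dots> = y" using xy ex[OF xy(1)] that by (simp add: nat_pow_mult)
      finally show False using ny[of "4 - i' + i"] xy by (simp add: nat_pow_mult)
    qed
    have inj: "inj_on (\<lambda>(i, j). x [^] i \<otimes> y [^] j) ({..<4 :: nat} \<times> {..<2 :: nat})"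
    proof (rule inj_onI)
      fix u v assume uv: "u \<in> {..<4 :: nat} \<times> {..<2 :: nat}" "v \<in> {..<4 :: nat} \<times> {..<2 :: nat}"
        and e: "(case u of (i, j) \<Rightarrow> x [^] i \<otimes> y [^] j) = (case v of (i, j) \<Rightarrow> x [^] i \<otimes> y [^] j)"
      obtain i j i' j' where d: "u = (i, j)" "v = (i', j')" by (cases u; cases v)
      have i: "i < 4" "i' < 4" and j: "j = 0 \<or> j = 1" "j' = 0 \<or> j' = 1" using uv d by auto
      have e': "x [^] i \<otimes> y [^] j = x [^] i' \<otimes> y [^] j'" using e d by simp
      have "j = j'"
        using j e' no[OF i(1), of i'] no[OF i(2), of i] xy(1,2) by auto
      then have "x [^] i = x [^] i'" using e' xy(1,2) by simp
      then have "i = i'" using inj_onD[OF ord_inj[OF xy(1)], of i i'] i o4 by auto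
      then show "u = v" using d \<open>j = j'\<close> by simp
    qed
    have "\<exists>p<4. \<exists>q<2. \<exists>r<4. \<exists>s<2. \<exists>t<4. \<exists>u<2. \<exists>b. ((2 :: nat) = 1 \<longrightarrow> r = 0) \<and>
        pc_gen G (4, 2, p, q, r, s, t, u) x y b"
      using abelian_subgroup_of_pair[OF fin _ _ xy(1,2) ex[OF xy(1)] xy(4,5) inj]
      by (intro pc_gen_of_abelian_subgroup[OF ord _ xy(1,2) ex[OF xy(1)] xy(4,5) _ _ HOL.refl]) simp_all
    then obtain p q r s t u b where "p < 4" "q < 2" "r < 4" "s < 2" "t < 4" "u < 2"
      "pc_gen G (4, 2, p, q, r, s, t, u) x y b" by blast
    moreover from this have "(4, 2, p, q, r, s, t, u) \<in> set pc_params"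
      by (auto simp: pc_params_def image_iff)
    ultimately show ?thesis by blast
  qed
qed

theorem ex_pc_type:
  assumes nab: "\<not> comm_group G" and ord: "order G = 16"
  shows "\<exists>T\<in>set pc_types. \<exists>x y b. pc_gen G T x y b"
proof -
  obtain P x y b where P: "P \<in> set pc_params" and pc: "pc_gen G P x y b"
    using ex_pc_gen[OF assms] by blast
  have "fst P = 4 \<or> fst P = 8" using P by (auto simp: pc_params_def)
  note c = pc_gen_consistent[OF pc ord nab this]
  have "if pc_consistent P then if pc_noncomm P then P \<in> set (map fst pc_table) else True else True"
    using pc_consistent_table P unfolding list_all_iff by blast
  then have "P \<in> set (map fst pc_table)" using c by (simp only: if_True)
  then obtain e where e: "e \<in> set pc_table" "P = fst e" unfolding set_map by blast
  obtain T n es where "e = (P, T, n, es)" using e(2) by (metis prod.collapse)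
  then have "pc_check P T n es \<and> T \<in> set pc_types"
    using pc_table_check e(1) unfolding list_all_iff by fast
  then show ?thesis using pc_change[OF pc] by blast
qed

end

section \<open>The order of the unitary subgroup for each of the nine types\<close>

lemma (in char2) card_unitary_units_perm:
  fixes G :: "('g, 'm) monoid_scheme"
  assumes "group G" "pc_gen G P x y b" "order G = 16" "sort \<sigma> = [0..<16]" "\<sigma> ! 0 = 0"
  shows "card (unitary_units G :: ('g \<Rightarrow> 'f) set) = card (unitary_sols (gmul \<sigma> P) :: 'f list set)"
proof (rule card_unitary_units_pc[OF assms(1-3)])
  show "length \<sigma> = 16"
    using arg_cong[OF assms(4), of length] by simp
  show "distinct \<sigma>"
    using arg_cong[OF assms(4), of distinct] by simp
  show "set \<sigma> = {..<16}"
    using arg_cong[OF assms(4), of set] by (simp add: atLeast0LessThan)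
qed (rule assms)

context char2
begin

text \<open>\<open>t\<close> is the number of elements with square 1, identity included, so
  \<open>e\<close> is half the sum of 16 and \<open>t\<close>, minus one. It remains to evaluate
  \<open>t\<close> and to collect the powers of q in the solution count.\<close>

lemma card_unitary_eqI:
  fixes G :: "('g, 'm) monoid_scheme"
  assumes G: "group G" "order G = 16" and pc: "\<exists>x y b. pc_gen G P x y b"
    and \<sigma>: "sort \<sigma> = [0..<16]" "\<sigma> ! 0 = 0"
    and t: "length (filter (\<lambda>n. tmul P n n = 0) [0..<16]) = t"
    and c: "card (unitary_sols (gmul \<sigma> P) :: 'f list set) = n * CARD('f) ^ e"
    and e: "(16 + t) div 2 - 1 = e"
  shows "card (unitary_units G :: ('g \<Rightarrow> 'f) set) =
    n * CARD('f) ^ ((order G + card (two_torsion G)) div 2 - 1)"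
proof -
  obtain x y b where pc: "pc_gen G P x y b" using pc by blast
  show ?thesis
    unfolding card_unitary_units_perm[OF G(1) pc G(2) \<sigma>] c
      group.card_two_torsion_pc[OF G(1) pc G(2)] t G(2) e ..
qed

lemma card_unitary_D16:
  fixes G :: "('g, 'm) monoid_scheme"
  assumes "group G" "order G = 16" "\<exists>x y b. pc_gen G (8, 1, 7, 0, 0, 0, 0, 0) x y b"
  shows "card (unitary_units G :: ('g \<Rightarrow> 'f) set) =
    1 * CARD('f) ^ ((order G + card (two_torsion G)) div 2 - 1)"
proof (rule card_unitary_eqI[OF assms])
  show "sort std_perm = [0..<16 :: nat]" by code_simp
  \<comment> \<open>The eight reflections, the central involution and the identity.\<close>
  show "length (filter (\<lambda>n. tmul (8, 1, 7, 0, 0, 0, 0, 0) n n = 0) [0..<16]) = 10" by code_simp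
  show "card (unitary_sols (gmul std_perm (8, 1, 7, 0, 0, 0, 0, 0)) :: 'f list set) =
      1 * CARD('f) ^ 12"
    unfolding card_sols_D16 by (simp add: numeral_eq_Suc algebra_simps)
qed simp_all

lemma card_unitary_D8C2:
  fixes G :: "('g, 'm) monoid_scheme"
  assumes "group G" "order G = 16" "\<exists>x y b. pc_gen G (4, 2, 3, 0, 0, 1, 0, 0) x y b"
  shows "card (unitary_units G :: ('g \<Rightarrow> 'f) set) =
    1 * CARD('f) ^ ((order G + card (two_torsion G)) div 2 - 1)"
proof (rule card_unitary_eqI[OF assms])
  show "sort std_perm = [0..<16 :: nat]" by code_simp
  show "length (filter (\<lambda>n. tmul (4, 2, 3, 0, 0, 1, 0, 0) n n = 0) [0..<16]) = 12" by code_simp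
  show "card (unitary_sols (gmul std_perm (4, 2, 3, 0, 0, 1, 0, 0)) :: 'f list set) =
      1 * CARD('f) ^ 13"
    unfolding card_sols_D8C2 by (simp add: numeral_eq_Suc algebra_simps)
qed simp_all

lemma card_unitary_D8YC4:
  fixes G :: "('g, 'm) monoid_scheme"
  assumes "group G" "order G = 16" "\<exists>x y b. pc_gen G (4, 2, 3, 0, 2, 1, 0, 0) x y b"
  shows "card (unitary_units G :: ('g \<Rightarrow> 'f) set) =
    1 * CARD('f) ^ ((order G + card (two_torsion G)) div 2 - 1)"
proof (rule card_unitary_eqI[OF assms])
  show "sort [0, 1, 5, 6, 8, 9, 13, 14, 2, 3, 7, 4, 10, 11, 15, 12] = [0..<16 :: nat]" by code_simp
  show "length (filter (\<lambda>n. tmul (4, 2, 3, 0, 2, 1, 0, 0) n n = 0) [0..<16]) = 8" by code_simp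
  show "card (unitary_sols (gmul [0, 1, 5, 6, 8, 9, 13, 14, 2, 3, 7, 4, 10, 11, 15, 12] (4, 2, 3, 0, 2, 1, 0, 0)) :: 'f list set) =
      1 * CARD('f) ^ 11"
    unfolding card_sols_D8YC4 by (simp add: numeral_eq_Suc algebra_simps)
qed simp_all

lemma card_unitary_M16:
  fixes G :: "('g, 'm) monoid_scheme"
  assumes "group G" "order G = 16" "\<exists>x y b. pc_gen G (8, 1, 5, 0, 0, 0, 0, 0) x y b"
  shows "card (unitary_units G :: ('g \<Rightarrow> 'f) set) =
    2 * CARD('f) ^ ((order G + card (two_torsion G)) div 2 - 1)"
proof (rule card_unitary_eqI[OF assms])
  show "sort std_perm = [0..<16 :: nat]" by code_simp
  show "length (filter (\<lambda>n. tmul (8, 1, 5, 0, 0, 0, 0, 0) n n = 0) [0..<16]) = 4" by code_simp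
  show "card (unitary_sols (gmul std_perm (8, 1, 5, 0, 0, 0, 0, 0)) :: 'f list set) =
      2 * CARD('f) ^ 9"
    unfolding card_sols_M16 by (simp add: numeral_eq_Suc algebra_simps)
qed simp_all

lemma card_unitary_SD16:
  fixes G :: "('g, 'm) monoid_scheme"
  assumes "group G" "order G = 16" "\<exists>x y b. pc_gen G (8, 1, 3, 0, 0, 0, 0, 0) x y b"
  shows "card (unitary_units G :: ('g \<Rightarrow> 'f) set) =
    2 * CARD('f) ^ ((order G + card (two_torsion G)) div 2 - 1)"
proof (rule card_unitary_eqI[OF assms])
  show "sort std_perm = [0..<16 :: nat]" by code_simp
  show "length (filter (\<lambda>n. tmul (8, 1, 3, 0, 0, 0, 0, 0) n n = 0) [0..<16]) = 6" by code_simp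
  show "card (unitary_sols (gmul std_perm (8, 1, 3, 0, 0, 0, 0, 0)) :: 'f list set) =
      2 * CARD('f) ^ 10"
    unfolding card_sols_SD16 by (simp add: numeral_eq_Suc algebra_simps)
qed simp_all

lemma card_unitary_H16:
  fixes G :: "('g, 'm) monoid_scheme"
  assumes "group G" "order G = 16" "\<exists>x y b. pc_gen G (4, 2, 1, 1, 0, 1, 0, 0) x y b"
  shows "card (unitary_units G :: ('g \<Rightarrow> 'f) set) =
    2 * CARD('f) ^ ((order G + card (two_torsion G)) div 2 - 1)"
proof (rule card_unitary_eqI[OF assms])
  show "sort [0, 9, 4, 13, 8, 1, 12, 5, 2, 11, 6, 15, 10, 3, 14, 7] = [0..<16 :: nat]" by code_simp
  show "length (filter (\<lambda>n. tmul (4, 2, 1, 1, 0, 1, 0, 0) n n = 0) [0..<16]) = 8" by code_simp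
  show "card (unitary_sols (gmul [0, 9, 4, 13, 8, 1, 12, 5, 2, 11, 6, 15, 10, 3, 14, 7] (4, 2, 1, 1, 0, 1, 0, 0)) :: 'f list set) =
      2 * CARD('f) ^ 11"
    unfolding card_sols_H16 by (simp add: numeral_eq_Suc algebra_simps)
qed simp_all

lemma card_unitary_Q16:
  fixes G :: "('g, 'm) monoid_scheme"
  assumes "group G" "order G = 16" "\<exists>x y b. pc_gen G (8, 1, 7, 0, 0, 0, 4, 0) x y b"
  shows "card (unitary_units G :: ('g \<Rightarrow> 'f) set) =
    4 * CARD('f) ^ ((order G + card (two_torsion G)) div 2 - 1)"
proof (rule card_unitary_eqI[OF assms])
  show "sort std_perm = [0..<16 :: nat]" by code_simp
  show "length (filter (\<lambda>n. tmul (8, 1, 7, 0, 0, 0, 4, 0) n n = 0) [0..<16]) = 2" by code_simp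
  show "card (unitary_sols (gmul std_perm (8, 1, 7, 0, 0, 0, 4, 0)) :: 'f list set) =
      4 * CARD('f) ^ 8"
    unfolding card_sols_Q16 by (simp add: numeral_eq_Suc algebra_simps)
qed simp_all

lemma card_unitary_C4C4:
  fixes G :: "('g, 'm) monoid_scheme"
  assumes "group G" "order G = 16" "\<exists>x y b. pc_gen G (4, 2, 3, 0, 0, 1, 0, 1) x y b"
  shows "card (unitary_units G :: ('g \<Rightarrow> 'f) set) =
    4 * CARD('f) ^ ((order G + card (two_torsion G)) div 2 - 1)"
proof (rule card_unitary_eqI[OF assms])
  show "sort std_perm = [0..<16 :: nat]" by code_simp
  show "length (filter (\<lambda>n. tmul (4, 2, 3, 0, 0, 1, 0, 1) n n = 0) [0..<16]) = 4" by code_simp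
  show "card (unitary_sols (gmul std_perm (4, 2, 3, 0, 0, 1, 0, 1)) :: 'f list set) =
      4 * CARD('f) ^ 9"
    unfolding card_sols_C4C4 by (simp add: numeral_eq_Suc algebra_simps)
qed simp_all

lemma card_unitary_Q8C2:
  fixes G :: "('g, 'm) monoid_scheme"
  assumes "group G" "order G = 16" "\<exists>x y b. pc_gen G (4, 2, 3, 0, 0, 1, 2, 0) x y b"
  shows "card (unitary_units G :: ('g \<Rightarrow> 'f) set) =
    4 * CARD('f) ^ ((order G + card (two_torsion G)) div 2 - 1)"
proof (rule card_unitary_eqI[OF assms])
  show "sort [0, 1, 4, 5, 8, 9, 12, 13, 2, 3, 6, 7, 10, 11, 14, 15] = [0..<16 :: nat]" by code_simp
  show "length (filter (\<lambda>n. tmul (4, 2, 3, 0, 0, 1, 2, 0) n n = 0) [0..<16]) = 4" by code_simp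
  show "card (unitary_sols (gmul [0, 1, 4, 5, 8, 9, 12, 13, 2, 3, 6, 7, 10, 11, 14, 15] (4, 2, 3, 0, 0, 1, 2, 0)) :: 'f list set) =
      4 * CARD('f) ^ 9"
    unfolding card_sols_Q8C2 by (simp add: numeral_eq_Suc algebra_simps)
qed simp_all

end

theorem theorem2:
  fixes G :: "('g, 'm) monoid_scheme"
  assumes "group G" and "\<not> comm_group G" and "order G = 2 ^ 4"
    and "CHAR('f::{field, finite}) = 2"
  shows "\<exists>n.
      card (unitary_units G :: ('g \<Rightarrow> 'f) set) =
        n * card (UNIV :: 'f set) ^ ((order G + card (two_torsion G)) div 2 - 1) \<and>
      (G \<cong> D8_Y_C4 \<or> G \<cong> dihedral_group 16 \<or> G \<cong> dihedral_group 8 \<times>\<times> integer_mod_group 2 \<or>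
       G \<cong> M16 \<or> G \<cong> D16_minus \<or> G \<cong> H16 \<or>
       G \<cong> quaternion_group 16 \<or> G \<cong> C4_ltimes_C4 \<or>
         G \<cong> quaternion_group 8 \<times>\<times> integer_mod_group 2) \<and>
      (G \<cong> D8_Y_C4 \<or> G \<cong> dihedral_group 16 \<or> G \<cong> dihedral_group 8 \<times>\<times> integer_mod_group 2
        \<longrightarrow> n = 1) \<and>
      (G \<cong> M16 \<or> G \<cong> D16_minus \<or> G \<cong> H16 \<longrightarrow> n = 2) \<and>
      (G \<cong> quaternion_group 16 \<or> G \<cong> C4_ltimes_C4 \<or>
         G \<cong> quaternion_group 8 \<times>\<times> integer_mod_group 2 \<longrightarrow> n = 4)"
proof -
  interpret group G by fact
  interpret char2 "TYPE('f)"
    using of_nat_CHAR[where ?'a = 'f] assms(4) by unfold_locales simp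
  have G: "group G" "order G = 16" using assms by simp_all
  let ?c = "card (unitary_units G :: ('g \<Rightarrow> 'f) set)"
  let ?q = "card (UNIV :: 'f set) ^ ((order G + card (two_torsion G)) div 2 - 1)"
  let ?I = "G \<cong> D8_Y_C4 \<or> G \<cong> dihedral_group 16 \<or> G \<cong> dihedral_group 8 \<times>\<times> integer_mod_group 2"
  let ?II = "G \<cong> M16 \<or> G \<cong> D16_minus \<or> G \<cong> H16"
  let ?IV = "G \<cong> quaternion_group 16 \<or> G \<cong> C4_ltimes_C4 \<or> G \<cong> quaternion_group 8 \<times>\<times> integer_mod_group 2"
  note iso = D8_Y_C4_iso_iff[OF G] dihedral_16_iso_iff[OF G] dihedral_8_times_C2_iso_iff[OF G]
    M16_iso_iff[OF G] D16_minus_iso_iff[OF G] H16_iso_iff[OF G]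
    quaternion_16_iso_iff[OF G] C4_ltimes_C4_iso_iff[OF G] quaternion_8_times_C2_iso_iff[OF G]
  have 1: "?I \<Longrightarrow> ?c = 1 * ?q"
    unfolding iso using card_unitary_D8YC4[OF G] card_unitary_D16[OF G] card_unitary_D8C2[OF G] by blast
  have 2: "?II \<Longrightarrow> ?c = 2 * ?q"
    unfolding iso using card_unitary_M16[OF G] card_unitary_SD16[OF G] card_unitary_H16[OF G] by blast
  have 4: "?IV \<Longrightarrow> ?c = 4 * ?q"
    unfolding iso using card_unitary_Q16[OF G] card_unitary_C4C4[OF G] card_unitary_Q8C2[OF G] by blast
  have or: "?I \<or> ?II \<or> ?IV"
    using ex_pc_type[OF assms(2) G(2)] unfolding iso pc_types_def list.set bex_simps by blast
  have "card (UNIV :: 'f set) > 0" by (simp add: card_gt_0_iff)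
  then have q: "?q > 0" by simp
  \<comment> \<open>Cancelling the positive power of q makes the factor unique, so all three
    implications hold for one and the same \<open>n\<close>.\<close>
  have u: "n = n'" if "?c = n * ?q" "?c = n' * ?q" for n n' :: nat
    using that q by simp
  from or consider ?I | ?II | ?IV by blast
  then obtain n where n: "?c = n * ?q" using 1 2 4 by cases blast+
  show ?thesis
  proof (intro exI[of _ n] conjI)
    show "?c = n * ?q" by (rule n)
    show "?I \<longrightarrow> n = 1" using 1 u[OF n] by blast
    show "?II \<longrightarrow> n = 2" using 2 u[OF n] by blast
    show "?IV \<longrightarrow> n = 4" using 4 u[OF n] by blast
  qed (use or in blast)
qed

end
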